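(* Let $k \ge 7$ be a fixed integer. There is an algorithm which, given a directed graph $G=(V,E)$ with $n=|V|$ vertices and $m=|E|$ edges, runs in $O(nm\log n)$ time and returns a $k$-path partition $\mathcal{Q}$ of $G$ such that $|\mathcal{Q}| \le \frac{k+2}{3}\,|\mathcal{Q}^*|$, where $\mathcal{Q}^*$ is a $k$-path partition of $G$ with the minimum number of paths. That is, for $k\ge 7$ the $k$-path partition problem on directed graphs admits an $O(nm\log n)$-time $(k+2)/3$-approximation algorithm.
   Context: All graphs are directed, without self-loops or multiple edges. A path is a simple directed path, i.e. a sequence of distinct vertices such that there is an edge from each vertex to the next one; a single vertex is a path. The order of a path is its number of vertices. Given a directed graph $G=(V,E)$ and a positive integer $k$, a $k$-path partition of $G$ is a collection of vertex-disjoint paths of $G$, each of order at most $k$, such that every vertex of $V$ lies on some path of the collection; its size $|\mathcal{Q}|$ is the number of paths. The $k$-path partition problem asks for a $k$-path partition of minimum size. An algorithm is a $\rho$-approximation if it always returns a $k$-path partition of size at most $\rho$ times the minimum size. *)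

theory Defs
  imports
    Complex_Main
    "HOL-Library.Disjoint_Sets"
    "Graph_Theory.Graph_Theory"
begin

section \<open>Path partitions\<close>

text \<open>
  Digraphs without self-loops and multiple edges are those of the locale \<^locale>\<open>pair_digraph\<close>.
  A \<^const>\<open>vpath\<close> is a nonempty list of distinct vertices with arcs between consecutive ones,
  so its order is the length of the list.
\<close>

definition k_path_partition :: "'a pair_pre_digraph \<Rightarrow> nat \<Rightarrow> 'a list set \<Rightarrow> bool" where
  "k_path_partition G k Q \<longleftrightarrow>
     (\<forall>p\<in>Q. vpath p (with_proj G) \<and> length p \<le> k) \<and>
     disjoint_family_on set Q \<and>
     (\<Union>p\<in>Q. set p) = pverts G"

definition minimum_k_path_partition :: "'a pair_pre_digraph \<Rightarrow> nat \<Rightarrow> 'a list set \<Rightarrow> bool" where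
  "minimum_k_path_partition G k Q \<longleftrightarrow> is_arg_min card (k_path_partition G k) Q"


section \<open>Programs and their running time\<close>

text \<open>
  Algorithms are programs for a random access machine, in structured form: natural numbers are
  held in finitely many registers and arrays (those named in the program), array access is random
  access, and the arithmetic operations are addition and truncated subtraction. Every node of an
  evaluated expression and every executed command costs one unit.
\<close>

datatype aexp =
    Const nat
  | Reg string
  | Get string aexp
  | Add aexp aexp
  | Sub aexp aexp

datatype bexp =
    Less aexp aexp
  | Equal aexp aexp
  | Not bexp
  | And bexp bexp

datatype com =
    Skip
  | Assign string aexp
  | Put string aexp aexp  \<comment> \<open>array, index, value\<close>
  | Seq com com
  | If bexp com com
  | While bexp com

record store =
  reg :: "string \<Rightarrow> nat"
  arr :: "string \<Rightarrow> nat \<Rightarrow> nat"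

primrec aval :: "aexp \<Rightarrow> store \<Rightarrow> nat" where
  "aval (Const c) s = c"
| "aval (Reg x) s = reg s x"
| "aval (Get a i) s = arr s a (aval i s)"
| "aval (Add e f) s = aval e s + aval f s"
| "aval (Sub e f) s = aval e s - aval f s"

primrec bval :: "bexp \<Rightarrow> store \<Rightarrow> bool" where
  "bval (Less e f) s \<longleftrightarrow> aval e s < aval f s"
| "bval (Equal e f) s \<longleftrightarrow> aval e s = aval f s"
| "bval (Not b) s \<longleftrightarrow> \<not> bval b s"
| "bval (And b c) s \<longleftrightarrow> bval b s \<and> bval c s"

primrec acost :: "aexp \<Rightarrow> nat" where
  "acost (Const c) = 1"
| "acost (Reg x) = 1"
| "acost (Get a i) = 1 + acost i"
| "acost (Add e f) = 1 + acost e + acost f"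
| "acost (Sub e f) = 1 + acost e + acost f"

primrec bcost :: "bexp \<Rightarrow> nat" where
  "bcost (Less e f) = 1 + acost e + acost f"
| "bcost (Equal e f) = 1 + acost e + acost f"
| "bcost (Not b) = 1 + bcost b"
| "bcost (And b c) = 1 + bcost b + bcost c"

text \<open>
  \<open>exec B c s t s'\<close>: started in \<open>s\<close>, the program \<open>c\<close> halts in \<open>s'\<close> after \<open>t\<close> units of time, and
  never stores a number exceeding the word bound \<open>B\<close>; an attempt to store a larger number gets
  stuck. The word bound is what justifies charging a unit for each arithmetic operation.
\<close>

inductive exec :: "nat \<Rightarrow> com \<Rightarrow> store \<Rightarrow> nat \<Rightarrow> store \<Rightarrow> bool" for B :: nat where
  Skip: "exec B Skip s 1 s"
| Assign: "aval e s \<le> B \<Longrightarrow>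
    exec B (Assign x e) s (1 + acost e) (s\<lparr>reg := (reg s)(x := aval e s)\<rparr>)"
| Put: "aval e s \<le> B \<Longrightarrow>
    exec B (Put a i e) s (1 + acost i + acost e)
      (s\<lparr>arr := (arr s)(a := (arr s a)(aval i s := aval e s))\<rparr>)"
| Seq: "exec B c s t s' \<Longrightarrow> exec B d s' t' s'' \<Longrightarrow> exec B (Seq c d) s (1 + t + t') s''"
| IfTrue: "bval b s \<Longrightarrow> exec B c s t s' \<Longrightarrow> exec B (If b c d) s (1 + bcost b + t) s'"
| IfFalse: "\<not> bval b s \<Longrightarrow> exec B d s t s' \<Longrightarrow> exec B (If b c d) s (1 + bcost b + t) s'"
| WhileFalse: "\<not> bval b s \<Longrightarrow> exec B (While b c) s (1 + bcost b) s"
| WhileTrue: "bval b s \<Longrightarrow> exec B c s t s' \<Longrightarrow> exec B (While b c) s' t' s'' \<Longrightarrow>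
    exec B (While b c) s (1 + bcost b + t + t') s''"

inductive_cases Skip_elim: "exec B Skip s t s'"
inductive_cases Assign_elim: "exec B (Assign x e) s t s'"
inductive_cases Put_elim: "exec B (Put a i e) s t s'"
inductive_cases Seq_elim: "exec B (Seq c d) s t s'"
inductive_cases If_elim: "exec B (If b c d) s t s'"
inductive_cases While_elim: "exec B (While b c) s t s'"

lemma exec_deterministic:
  "exec B c s t s' \<Longrightarrow> exec B c s u s'' \<Longrightarrow> t = u \<and> s' = s''"
proof (induction arbitrary: u s'' rule: exec.induct)
  case (Seq c s t s' d t' s1)
  from Seq.prems obtain t1 s2 t2 where u: "u = Suc (t1 + t2)"
    and 1: "exec B c s t1 s2" and 2: "exec B d s2 t2 s''"
    by (rule Seq_elim) simp
  from Seq.IH(1)[OF 1] have "t1 = t" "s2 = s'" by simp_all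
  with Seq.IH(2)[of t2 s''] 2 u show ?case by simp
next
  case (IfTrue b s c t s' d)
  from IfTrue.prems obtain t1 where u: "u = Suc (bcost b + t1)" and 1: "exec B c s t1 s''"
    by (rule If_elim) (simp_all add: IfTrue.hyps(1))
  from IfTrue.IH[OF 1] u show ?case by simp
next
  case (IfFalse b s d t s' c)
  from IfFalse.prems obtain t1 where u: "u = Suc (bcost b + t1)" and 1: "exec B d s t1 s''"
    by (rule If_elim) (simp_all add: IfFalse.hyps(1))
  from IfFalse.IH[OF 1] u show ?case by simp
next
  case (WhileFalse b s c)
  from WhileFalse.prems show ?case
    by (rule While_elim) (simp_all add: WhileFalse.hyps(1))
next
  case (WhileTrue b s c t s1 t' s2)
  from WhileTrue.prems obtain t1 s3 t2
    where u: "u = Suc (bcost b + t1 + t2)"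
      and 1: "exec B c s t1 s3" and 2: "exec B (While b c) s3 t2 s''"
    by (rule While_elim) (simp_all add: WhileTrue.hyps(1))
  from WhileTrue.IH(1)[OF 1] have "t1 = t" "s3 = s1" by simp_all
  with WhileTrue.IH(2)[of t2 s''] 2 u show ?case by simp
qed (auto elim: Skip_elim Assign_elim Put_elim)


section \<open>Input and output\<close>

text \<open>
  The input graph has the vertices \<open>0, ..., n - 1\<close> and is given by a list of its arcs in
  arbitrary order; all memory outside the input is initially zero.
\<close>

definition arc_list_of :: "nat pair_pre_digraph \<Rightarrow> nat \<Rightarrow> (nat \<times> nat) list \<Rightarrow> bool" where
  "arc_list_of G n es \<longleftrightarrow> pverts G = {0..<n} \<and> distinct es \<and> set es = parcs G"

definition input_store :: "nat \<Rightarrow> (nat \<times> nat) list \<Rightarrow> store" where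
  "input_store n es =
     \<lparr>reg = (\<lambda>_. 0)(''n'' := n, ''m'' := length es),
      arr = (\<lambda>_ _. 0)
        (''tail'' := (\<lambda>i. if i < length es then fst (es ! i) else 0),
         ''head'' := (\<lambda>i. if i < length es then snd (es ! i) else 0))\<rparr>"

text \<open>
  The output consists of \<open>q\<close> vertex lists, stored in the array \<open>path\<close>; the list number \<open>i\<close> occupies
  the positions from \<open>start[i]\<close> up to, but excluding, \<open>start[i + 1]\<close>.
\<close>

definition output_paths :: "store \<Rightarrow> nat list list" where
  "output_paths s =
     map (\<lambda>i. map (arr s ''path'') [arr s ''start'' i ..< arr s ''start'' (Suc i)])
       [0..<reg s ''q'']"

end

theory Submission
  imports Defs
begin

text \<open>
  A maximum matching between out-copies and in-copies of the vertices is a set of vertex-disjoint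
  paths and cycles with at most \<open>|Q*|\<close> paths, because an optimal partition \<open>Q*\<close> is also such a
  matching. Cutting a path of order \<open>l\<close> costs at most \<open>(l + 2) / 3\<close> pieces and cutting a cycle of
  order \<open>l \<ge> 3\<close> at most \<open>l / 3\<close>; without 2-cycles this gives
  \<open>2/3 |Q*| + n/3 \<le> (k + 2)/3 |Q*|\<close>. Only a 2-cycle, at cost 1, exceeds its share, by \<open>1/3\<close>.

  A second maximum matching assigns to a 2-cycle an arc that joins it to a vertex of another component,
  such that each vertex is used at most once from the inside and once from the outside.
  Forcing such an arc into the matching opens the 2-cycle and lowers the number of arcs by at most one,
  while the 2-cycle becomes an end of the resulting path; the two effects cancel. A 2-cycle that is left
  unmatched can be charged to a path of \<open>Q*\<close> that stays inside a 2-cycle and so is shorter than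
  \<open>k\<close> by at least \<open>k - 2\<close>. A 2-cycle cannot be attached to a 2-cycle that is itself attached, so the
  functional graph between 2-cycles is split into stars; on an odd directed cycle of that graph one
  2-cycle is lost, and it is paid for by a star that consists of two 2-cycles only, whose path of order 4
  costs \<open>1/3\<close> less than its share.
\<close>

section \<open>Reasoning about programs\<close>

text \<open>All counting is done in units of 1/3. A component of order \<open>L\<close> costs
  \<open>3 * pieces k L\<close> units and owns \<open>L\<close> units; a path component receives 2
  more. A cover with arc set \<open>S\<close> has \<open>n - card S\<close> path components, so the
  total allowance is \<open>3 * n - 2 * card S\<close>; for \<open>S = M\<close>, the bound
  \<open>n <= card M + card Q\<close> turns this into at most \<open>n + 2 * card Q\<close>. Forcing
  an arc deletes up to two arcs of \<open>M\<close> and adds one, which uses up 2 units. They come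
  back because a path component leaves 2 units unspent for each of its ends that is an attached
  2-cycle. This refund is why attached 2-cycles must not interact: each has to form the end of a
  path on its own, untouched by other forced arcs. The second matching yields only a function
  \<open>h\<close> on the 2-cycles, with chains and cycles in it; the labels reduce it to arcs that
  join a guest to a host or to a vertex outside all 2-cycles. The time is dominated by the two
  matchings: each has at most one phase more than left vertices, and a phase is linear in the number
  of arcs.\<close>

definition runs :: "nat \<Rightarrow> com \<Rightarrow> store \<Rightarrow> nat \<Rightarrow> (store \<Rightarrow> bool) \<Rightarrow> bool" where
  "runs B c s T Q \<longleftrightarrow> (\<exists>t s'. exec B c s t s' \<and> t \<le> T \<and> Q s')"

abbreviation Sequence :: "com \<Rightarrow> com \<Rightarrow> com" (infixr \<open>;;\<close> 60) where
  "c ;; d \<equiv> Seq c d"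

lemma runs_mono:
  "runs B c s T Q \<Longrightarrow> T \<le> T' \<Longrightarrow> (\<And>s'. Q s' \<Longrightarrow> Q' s') \<Longrightarrow> runs B c s T' Q'"
  unfolding runs_def by (meson order_trans)

lemma runs_Seq:
  assumes "runs B c s T1 R" "\<And>s'. R s' \<Longrightarrow> runs B d s' T2 Q" "1 + T1 + T2 \<le> T"
  shows "runs B (c ;; d) s T Q"
proof -
  obtain t1 s1 where 1: "exec B c s t1 s1" "t1 \<le> T1" "R s1"
    using assms(1) by (auto simp: runs_def)
  obtain t2 s2 where 2: "exec B d s1 t2 s2" "t2 \<le> T2" "Q s2"
    using assms(2)[OF 1(3)] by (auto simp: runs_def)
  show ?thesis
    unfolding runs_def using exec.Seq[OF 1(1) 2(1)] 1 2 assms(3)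
    by (intro exI[of _ "1 + t1 + t2"] exI[of _ s2]) auto
qed

text \<open>\<open>False\<close> for loops confines \<open>wp\<close> to loop-free code, which the
  simplifier can then execute symbolically; loops are treated by \<open>runs_WhileI\<close> with an
  invariant.\<close>

primrec wp :: "nat \<Rightarrow> com \<Rightarrow> (store \<Rightarrow> bool) \<Rightarrow> store \<Rightarrow> bool" where
  "wp B Skip Q s \<longleftrightarrow> Q s"
| "wp B (Assign x e) Q s \<longleftrightarrow> aval e s \<le> B \<and> Q (s\<lparr>reg := (reg s)(x := aval e s)\<rparr>)"
| "wp B (Put a i e) Q s \<longleftrightarrow>
    aval e s \<le> B \<and> Q (s\<lparr>arr := (arr s)(a := (arr s a)(aval i s := aval e s))\<rparr>)"
| "wp B (Seq c d) Q s \<longleftrightarrow> wp B c (wp B d Q) s"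
| "wp B (If b c d) Q s \<longleftrightarrow> (if bval b s then wp B c Q s else wp B d Q s)"
| "wp B (While b c) Q s \<longleftrightarrow> False"

text \<open>The worst case over both branches, so that the bound does not depend on the store. The
  value at loops is arbitrary, since \<open>wp\<close> fails as soon as a loop would be
  executed.\<close>

primrec cost :: "com \<Rightarrow> nat" where
  "cost Skip = 1"
| "cost (Assign x e) = 1 + acost e"
| "cost (Put a i e) = 1 + acost i + acost e"
| "cost (Seq c d) = 1 + cost c + cost d"
| "cost (If b c d) = 1 + bcost b + max (cost c) (cost d)"
| "cost (While b c) = 0"

lemma runs_wp: "wp B c Q s \<Longrightarrow> runs B c s (cost c) Q"
proof (induction c arbitrary: Q s)
  case (Seq c d)
  show ?case
    by (rule runs_Seq[OF Seq.IH(1) Seq.IH(2)]) (use Seq.prems in auto)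
next
  case (If b c d)
  show ?case
  proof (cases "bval b s")
    case True
    then obtain t s' where "exec B c s t s'" "t \<le> cost c" "Q s'"
      using If.IH(1)[of Q s] If.prems by (auto simp: runs_def)
    with exec.IfTrue[OF True this(1), of d] show ?thesis
      unfolding runs_def by (intro exI[of _ "1 + bcost b + t"] exI[of _ s']) auto
  next
    case False
    then obtain t s' where "exec B d s t s'" "t \<le> cost d" "Q s'"
      using If.IH(2)[of Q s] If.prems by (auto simp: runs_def)
    with exec.IfFalse[OF False this(1), of c] show ?thesis
      unfolding runs_def by (intro exI[of _ "1 + bcost b + t"] exI[of _ s']) auto
  qed
next
  case Skip
  then show ?case using exec.Skip by (fastforce simp: runs_def)
next
  case (Assign x e)
  then show ?case using exec.Assign[of e s B x] by (fastforce simp: runs_def)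
next
  case (Put a i e)
  then show ?case using exec.Put[of e s B a i] by (fastforce simp: runs_def)
qed simp

text \<open>The index \<open>v\<close> of the invariant is a potential: a round lowers it by at
  least 1 and costs at most \<open>K\<close> plus the test, whence the product. It may drop by more
  than 1, hence the strong induction. Loops with rounds of different kinds need only one common
  potential.\<close>

lemma runs_While:
  assumes "I v s"
    and "\<And>v s. I v s \<Longrightarrow> bval b s \<Longrightarrow> runs B c s K (\<lambda>s'. \<exists>v'<v. I v' s')"
    and "v * (1 + bcost b + K) + 1 + bcost b \<le> T"
  shows "runs B (While b c) s T (\<lambda>s'. (\<exists>v. I v s') \<and> \<not> bval b s')"
proof -
  have "runs B (While b c) s (v * (1 + bcost b + K) + 1 + bcost b)
      (\<lambda>s'. (\<exists>v. I v s') \<and> \<not> bval b s')"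
    using assms(1)
  proof (induction v arbitrary: s rule: less_induct)
    case (less v)
    show ?case
    proof (cases "bval b s")
      case True
      obtain t1 s1 v1 where 1: "exec B c s t1 s1" "t1 \<le> K" "v1 < v" "I v1 s1"
        using assms(2)[OF less.prems True] by (auto simp: runs_def)
      obtain t2 s2 where 2: "exec B (While b c) s1 t2 s2"
        "t2 \<le> v1 * (1 + bcost b + K) + 1 + bcost b" "(\<exists>v. I v s2) \<and> \<not> bval b s2"
        using less.IH[OF 1(3,4)] by (auto simp: runs_def)
      have "Suc v1 * (1 + bcost b + K) \<le> v * (1 + bcost b + K)"
        using 1(3) by (intro mult_le_mono1) simp
      then have "1 + bcost b + t1 + t2 \<le> v * (1 + bcost b + K) + 1 + bcost b"
        using 1(2) 2(2) by simp
      with exec.WhileTrue[OF True 1(1) 2(1)] 2(3) show ?thesis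
        unfolding runs_def by blast
    next
      case False
      with exec.WhileFalse[OF False] less.prems show ?thesis
        unfolding runs_def by fastforce
    qed
  qed
  with assms(3) show ?thesis by (rule_tac runs_mono)
qed

section \<open>Frame conditions read off from the program text\<close>

primrec written_regs :: "com \<Rightarrow> string set" where
  "written_regs Skip = {}"
| "written_regs (Assign x e) = {x}"
| "written_regs (Put a i e) = {}"
| "written_regs (Seq c d) = written_regs c \<union> written_regs d"
| "written_regs (If b c d) = written_regs c \<union> written_regs d"
| "written_regs (While b c) = written_regs c"

primrec written_arrs :: "com \<Rightarrow> string set" where
  "written_arrs Skip = {}"
| "written_arrs (Assign x e) = {}"
| "written_arrs (Put a i e) = {a}"
| "written_arrs (Seq c d) = written_arrs c \<union> written_arrs d"
| "written_arrs (If b c d) = written_arrs c \<union> written_arrs d"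
| "written_arrs (While b c) = written_arrs c"

lemma exec_frame:
  "exec B c s t s' \<Longrightarrow>
    (\<forall>x. x \<notin> written_regs c \<longrightarrow> reg s' x = reg s x) \<and>
    (\<forall>a. a \<notin> written_arrs c \<longrightarrow> arr s' a = arr s a)"
  by (induction rule: exec.induct) auto

text \<open>Specifications of program parts state only what is computed; that everything else
  survives is added here from the syntactic sets.\<close>

lemma runs_frame:
  assumes "runs B c s T Q"
  shows "runs B c s T (\<lambda>s'. Q s' \<and> (\<forall>x. x \<notin> written_regs c \<longrightarrow> reg s' x = reg s x) \<and>
    (\<forall>a. a \<notin> written_arrs c \<longrightarrow> arr s' a = arr s a))"
  using assms exec_frame unfolding runs_def by meson

lemma runs_WhileI:
  assumes "I v s"
    and "\<And>v s. I v s \<Longrightarrow> bval b s \<Longrightarrow> runs B c s K (\<lambda>s'. \<exists>v'<v. I v' s')"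
    and "v * (1 + bcost b + K) + 1 + bcost b \<le> T"
    and "\<And>v s. I v s \<Longrightarrow> \<not> bval b s \<Longrightarrow> Q s"
  shows "runs B (While b c) s T Q"
  using runs_mono[OF runs_While[of I, OF assms(1-3)] order_refl] assms(4) by blast

lemma runs_wpI: "wp B c Q s \<Longrightarrow> cost c \<le> T \<Longrightarrow> runs B c s T Q"
  by (rule runs_mono[OF runs_wp])

section \<open>Bipartite matching\<close>

text \<open>
  Arc \<open>j < M\<close> joins the left vertex \<open>T j\<close> to the right vertex \<open>H j\<close>. The mate arrays hold arc
  numbers increased by one, so that 0 means unmatched.
\<close>

definition matching_rep ::
    "nat \<Rightarrow> (nat \<Rightarrow> nat) \<Rightarrow> (nat \<Rightarrow> nat) \<Rightarrow> (nat \<Rightarrow> nat) \<Rightarrow> (nat \<Rightarrow> nat) \<Rightarrow> bool" where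
  "matching_rep M T H mL mR \<longleftrightarrow>
     (\<forall>x. mL x \<noteq> 0 \<longrightarrow> mL x \<le> M \<and> T (mL x - 1) = x \<and> mR (H (mL x - 1)) = mL x) \<and>
     (\<forall>w. mR w \<noteq> 0 \<longrightarrow> mR w \<le> M \<and> H (mR w - 1) = w \<and> mL (T (mR w - 1)) = mR w)"

lemma matching_repL:
  assumes "matching_rep M T H mL mR" "mL x \<noteq> 0"
  shows "mL x \<le> M" "T (mL x - 1) = x" "mR (H (mL x - 1)) = mL x"
  using assms unfolding matching_rep_def by blast+

lemma matching_repR:
  assumes "matching_rep M T H mL mR" "mR w \<noteq> 0"
  shows "mR w \<le> M" "H (mR w - 1) = w" "mL (T (mR w - 1)) = mR w"
  using assms unfolding matching_rep_def by blast+

text \<open>A set of arc numbers on which \<open>T\<close> and \<open>H\<close> are injective is a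
  matching. Competitors are such sets rather than mate arrays, so that the bound applies directly to
  the arcs of a path partition.\<close>

definition maximum_matching_rep ::
    "nat \<Rightarrow> (nat \<Rightarrow> nat) \<Rightarrow> (nat \<Rightarrow> nat) \<Rightarrow> (nat \<Rightarrow> nat) \<Rightarrow> (nat \<Rightarrow> nat) \<Rightarrow> bool" where
  "maximum_matching_rep M T H mL mR \<longleftrightarrow> matching_rep M T H mL mR \<and>
     (\<forall>N. N \<subseteq> {..<M} \<longrightarrow> inj_on T N \<longrightarrow> inj_on H N \<longrightarrow> card N \<le> card {x. mL x \<noteq> 0})"

text \<open>The alternating forest of one phase, recorded through its right vertices:
  \<open>Q\<close> lists them in order of discovery, and \<open>par w\<close> is the arc (plus one)
  that reached \<open>w\<close>. The tail of that arc is free, hence a root, or its mate occurs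
  earlier in \<open>Q\<close>; this order makes tracing back terminate.\<close>

definition search_tree where
  "search_tree M T H mL st vis par Q qt \<longleftrightarrow>
     (\<forall>w::nat. vis w = (st::nat) \<longleftrightarrow> (\<exists>i<qt. Q i = w)) \<and> inj_on Q {..<qt} \<and>
     (\<forall>i<qt. 1 \<le> par (Q i) \<and> par (Q i) \<le> M \<and> H (par (Q i) - 1) = Q i \<and>
        (mL (T (par (Q i) - 1)) \<noteq> 0 \<longrightarrow> (\<exists>j<i. Q j = H (mL (T (par (Q i) - 1)) - 1))))"
  for M qt :: nat and T H mL vis par Q :: "nat \<Rightarrow> nat"

text \<open>A nonzero \<open>g\<close> is one more than a visited free right vertex, the end of an
  augmenting path. No stamp exceeds \<open>st\<close>, so the stamp of the next phase is fresh and
  nothing has to be erased.\<close>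

definition search_inv where
  "search_inv M T H mL mR st vis par Q qt g \<longleftrightarrow>
     search_tree M T H mL st vis par Q qt \<and> (\<forall>w. vis w \<le> st) \<and>
     (if g = 0 then \<forall>i<qt. mR (Q i) \<noteq> 0 else mR (g - 1) = 0 \<and> (\<exists>i<qt. Q i = g - 1))"
  for M qt g :: nat and T H mL mR vis par Q :: "nat \<Rightarrow> nat"

text \<open>The visited vertices are the heads of their parent arcs, so these arcs are distinct. The
  queue is thus bounded by the number of arcs, whatever the number of vertices.\<close>

lemma search_tree_le:
  assumes "search_tree M T H mL st vis par Q qt"
  shows "qt \<le> M"
proof -
  have "inj_on (\<lambda>i. par (Q i)) {..<qt}"
    using assms unfolding search_tree_def inj_on_def by (metis lessThan_iff)
  moreover have "(\<lambda>i. par (Q i)) ` {..<qt} \<subseteq> {1..M}"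
    using assms unfolding search_tree_def by auto
  ultimately have "card {..<qt} \<le> card {1..M}"
    by (intro card_inj_on_le[of "\<lambda>i. par (Q i)"]) auto
  then show ?thesis by simp
qed

lemma search_inv_visit:
  assumes I: "search_inv M T H mL mR st vis par Q qt g"
    and a: "1 \<le> a" "a \<le> M" and w: "w = H (a - 1)" "vis w \<noteq> st"
    and t: "mL (T (a - 1)) \<noteq> 0 \<Longrightarrow> \<exists>j<qt. Q j = H (mL (T (a - 1)) - 1)"
    and g': "g' = (if mR w = 0 then Suc w else g)"
  shows "search_inv M T H mL mR st (vis(w := st)) (par(w := a)) (Q(qt := w)) (Suc qt) g'"
proof -
  have new: "Q i \<noteq> w" if "i < qt" for i
    using I w(2) that unfolding search_inv_def search_tree_def by auto
  have "search_tree M T H mL st (vis(w := st)) (par(w := a)) (Q(qt := w)) (Suc qt)"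
    unfolding search_tree_def
  proof (intro conjI)
    show "\<forall>v. ((vis(w := st)) v = st) = (\<exists>i<Suc qt. (Q(qt := w)) i = v)"
      using I unfolding search_inv_def search_tree_def
      by (auto simp: less_Suc_eq)
    show "inj_on (Q(qt := w)) {..<Suc qt}"
      using I new unfolding search_inv_def search_tree_def lessThan_Suc
      by (auto simp: inj_on_def)
    show "\<forall>i<Suc qt. 1 \<le> (par(w := a)) ((Q(qt := w)) i) \<and> (par(w := a)) ((Q(qt := w)) i) \<le> M \<and>
       H ((par(w := a)) ((Q(qt := w)) i) - 1) = (Q(qt := w)) i \<and>
       (mL (T ((par(w := a)) ((Q(qt := w)) i) - 1)) \<noteq> 0 \<longrightarrow>
        (\<exists>j<i. (Q(qt := w)) j = H (mL (T ((par(w := a)) ((Q(qt := w)) i) - 1)) - 1)))"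
    proof (intro allI impI)
      fix i assume "i < Suc qt"
      then consider "i = qt" | "i < qt" by linarith
      then show "1 \<le> (par(w := a)) ((Q(qt := w)) i) \<and> (par(w := a)) ((Q(qt := w)) i) \<le> M \<and>
       H ((par(w := a)) ((Q(qt := w)) i) - 1) = (Q(qt := w)) i \<and>
       (mL (T ((par(w := a)) ((Q(qt := w)) i) - 1)) \<noteq> 0 \<longrightarrow>
        (\<exists>j<i. (Q(qt := w)) j = H (mL (T ((par(w := a)) ((Q(qt := w)) i) - 1)) - 1)))"
      proof cases
        case 1
        then show ?thesis using a w t by auto
      next
        case 2
        then have "\<exists>j<i. (Q(qt := w)) j = v" if "\<exists>j<i. Q j = v" for v
          using that by fastforce
        with 2 new[OF 2] I show ?thesis
          unfolding search_inv_def search_tree_def by auto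
      qed
    qed
  qed
  moreover have "\<forall>v. (vis(w := st)) v \<le> st"
    using I unfolding search_inv_def by auto
  moreover have "if g' = 0 then \<forall>i<Suc qt. mR ((Q(qt := w)) i) \<noteq> 0
      else mR (g' - 1) = 0 \<and> (\<exists>i<Suc qt. (Q(qt := w)) i = g' - 1)"
  proof (cases "mR w = 0")
    case True
    then show ?thesis using g' by auto
  next
    case False
    then have "g' = g" using g' by simp
    with I False show ?thesis unfolding search_inv_def
      by (auto simp: less_Suc_eq split: if_splits)
  qed
  ultimately show ?thesis unfolding search_inv_def by blast
qed

text \<open>
  While the path is being flipped, the mate entry of the right vertex \<open>Q i\<close> is stale: its arc has
  already been replaced on the left side.
\<close>

definition augmenting where
  "augmenting M T H mL mR par Q i \<longleftrightarrow>
     matching_rep M T H mL (mR(Q i := 0)) \<and> inj_on Q {..i} \<and>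
     (\<forall>i'\<le>i. 1 \<le> par (Q i') \<and> par (Q i') \<le> M \<and> H (par (Q i') - 1) = Q i' \<and>
        (mL (T (par (Q i') - 1)) \<noteq> 0 \<longrightarrow> (\<exists>j<i'. Q j = H (mL (T (par (Q i') - 1)) - 1))))"
  for M i :: nat and T H mL mR par Q :: "nat \<Rightarrow> nat"

lemma augmenting_start:
  assumes "search_inv M T H mL mR st vis par Q qt g" "g \<noteq> 0" "matching_rep M T H mL mR"
  obtains i where "i < qt" "Q i = g - 1" "augmenting M T H mL mR par Q i"
proof -
  obtain i where i: "i < qt" "Q i = g - 1" "mR (g - 1) = 0"
    using assms(1,2) unfolding search_inv_def by auto
  \<comment> \<open>The end of the path is free, so declaring its entry stale changes
    nothing.\<close>
  then have "mR(Q i := 0) = mR" by auto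
  moreover have "inj_on Q {..i}"
    using assms(1) i(1) unfolding search_inv_def search_tree_def
    by (meson atMost_iff inj_on_subset le_less_trans lessThan_iff subsetI)
  ultimately have "augmenting M T H mL mR par Q i"
    using assms i(1) unfolding augmenting_def search_inv_def search_tree_def by simp
  with i that show ?thesis by blast
qed

text \<open>The tail of the parent arc is free, so the flip ends here: the stale entry becomes valid
  and no further arc is displaced.\<close>

lemma augmenting_last:
  assumes A: "augmenting M T H mL mR par Q i" and "a = par (Q i)" "x = T (a - 1)" "mL x = 0"
  shows "matching_rep M T H (mL(x := a)) (mR(Q i := a))"
proof -
  have m: "matching_rep M T H mL (mR(Q i := 0))" using A unfolding augmenting_def by blast
  have ai: "1 \<le> a" "a \<le> M" "H (a - 1) = Q i" using A assms(2) unfolding augmenting_def by auto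
  have L: "mL y \<le> M \<and> T (mL y - 1) = y \<and> mR (H (mL y - 1)) = mL y \<and> H (mL y - 1) \<noteq> Q i"
    if "mL y \<noteq> 0" for y
    using matching_repL[OF m that] that by (auto split: if_splits)
  have R: "mR w \<le> M \<and> H (mR w - 1) = w \<and> mL (T (mR w - 1)) = mR w \<and> T (mR w - 1) \<noteq> x"
    if "mR w \<noteq> 0" "w \<noteq> Q i" for w
  proof -
    have "(mR(Q i := 0)) w \<noteq> 0" using that by simp
    from matching_repR[OF m this] that assms(4) show ?thesis by auto
  qed
  show ?thesis
    unfolding matching_rep_def using ai assms(3) L R by auto
qed

text \<open>The parent arc of \<open>Q i\<close> takes the left vertex \<open>x\<close> away from
  its old arc \<open>b\<close>, and the head of \<open>b\<close> inherits the stale entry. Its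
  position \<open>j\<close> in the queue is smaller than \<open>i\<close>, so the flip
  terminates.\<close>

lemma augmenting_step:
  assumes A: "augmenting M T H mL mR par Q i" and a: "a = par (Q i)" and x: "x = T (a - 1)"
    and b: "b = mL x" "b \<noteq> 0"
  obtains j where "j < i" "Q j = H (b - 1)"
    "augmenting M T H (mL(x := a)) (mR(Q i := a)) par Q j"
proof -
  obtain j where j: "j < i" "Q j = H (b - 1)"
    using A a x b unfolding augmenting_def by (metis order_refl)
  have Qj: "Q j \<noteq> Q i"
    using A j(1) unfolding augmenting_def inj_on_def by (metis atMost_iff less_imp_le nat_neq_iff order_refl)
  have m: "matching_rep M T H mL (mR(Q i := 0))" using A unfolding augmenting_def by blast
  have ai: "1 \<le> a" "a \<le> M" "H (a - 1) = Q i" using A a unfolding augmenting_def by auto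
  have bx: "b \<le> M" "T (b - 1) = x" "mR (Q j) = b"
    using matching_repL[OF m, of x] b j(2) Qj by auto
  have m': "matching_rep M T H (mL(x := a)) ((mR(Q i := a))(Q j := 0))"
    unfolding matching_rep_def
  proof (intro conjI allI impI)
    fix y assume y: "(mL(x := a)) y \<noteq> 0"
    have "mR (H (mL y - 1)) = mL y \<and> mL y \<le> M \<and> T (mL y - 1) = y \<and> H (mL y - 1) \<noteq> Q i \<and> H (mL y - 1) \<noteq> Q j"
      if "y \<noteq> x"
    proof -
      have "mL y \<noteq> 0" using y that by simp
      then have *: "mL y \<le> M" "T (mL y - 1) = y" "(mR(Q i := 0)) (H (mL y - 1)) = mL y"
        using matching_repL[OF m] by blast+
      have "H (mL y - 1) \<noteq> Q i" using * \<open>mL y \<noteq> 0\<close> by auto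
      moreover have "H (mL y - 1) \<noteq> Q j" using * bx that calculation by auto
      ultimately show ?thesis using * by auto
    qed
    then show "(mL(x := a)) y \<le> M" "T ((mL(x := a)) y - 1) = y"
      "((mR(Q i := a))(Q j := 0)) (H ((mL(x := a)) y - 1)) = (mL(x := a)) y"
      using ai x Qj by auto
  next
    fix w assume w: "((mR(Q i := a))(Q j := 0)) w \<noteq> 0"
    have "mR w \<le> M \<and> H (mR w - 1) = w \<and> mL (T (mR w - 1)) = mR w \<and> T (mR w - 1) \<noteq> x"
      if "w \<noteq> Q i"
    proof -
      have wj: "w \<noteq> Q j" "mR w \<noteq> 0" using w that by (auto split: if_splits)
      then have *: "mR w \<le> M" "H (mR w - 1) = w" "mL (T (mR w - 1)) = mR w"
        using matching_repR[OF m, of w] that by auto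
      then have "T (mR w - 1) \<noteq> x" using b j(2) wj by auto
      with * show ?thesis by simp
    qed
    moreover have "w \<noteq> Q j" using w by auto
    ultimately show "((mR(Q i := a))(Q j := 0)) w \<le> M" "H (((mR(Q i := a))(Q j := 0)) w - 1) = w"
      "(mL(x := a)) (T (((mR(Q i := a))(Q j := 0)) w - 1)) = ((mR(Q i := a))(Q j := 0)) w"
      using ai x by auto
  qed
  \<comment> \<open>No vertex up to position \<open>j\<close> was reached through \<open>x\<close>:
    the mate of \<open>x\<close> is \<open>Q j\<close>, which would have to lie strictly before a
    position that is at most \<open>j\<close>. So the change of \<open>mL x\<close> leaves their
    parents intact.\<close>
  have "mL (T (par (Q i') - 1)) \<noteq> 0 \<longrightarrow> (\<exists>j'<i'. Q j' = H (mL (T (par (Q i') - 1)) - 1)) \<and> T (par (Q i') - 1) \<noteq> x"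
    if i': "i' \<le> j" for i'
  proof
    assume "mL (T (par (Q i') - 1)) \<noteq> 0"
    then obtain j' where j': "j' < i'" "Q j' = H (mL (T (par (Q i') - 1)) - 1)"
      using A i' j(1) unfolding augmenting_def by (meson less_or_eq_imp_le order_trans)
    then have "Q j' \<noteq> Q j"
      using A j(1) i' unfolding augmenting_def inj_on_def
      by (metis atMost_iff less_imp_le less_le_trans nat_neq_iff order_trans)
    then have "T (par (Q i') - 1) \<noteq> x" using j' j b by auto
    with j' show "(\<exists>j'<i'. Q j' = H (mL (T (par (Q i') - 1)) - 1)) \<and> T (par (Q i') - 1) \<noteq> x" by blast
  qed
  moreover have "T (par (Q i') - 1) \<noteq> x" if "i' \<le> j" for i'
    using calculation[OF that] b by auto
  moreover have "inj_on Q {..j}" using A j(1) unfolding augmenting_def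
    by (meson atMost_iff inj_on_subset less_imp_le order_trans subsetI)
  ultimately have "augmenting M T H (mL(x := a)) (mR(Q i := a)) par Q j"
    using m' A j(1) unfolding augmenting_def by auto
  with j that show ?thesis by blast
qed

lemma matched_finite: "matching_rep M T H mL mR \<Longrightarrow> finite {x. mL x \<noteq> 0}"
proof (rule finite_subset)
  assume "matching_rep M T H mL mR"
  then show "{x. mL x \<noteq> 0} \<subseteq> (\<lambda>j. T (j - 1)) ` {..M}"
    by (auto intro!: image_eqI[where x = "mL _"] dest: matching_repL)
qed simp

text \<open>A search that is stuck exhibits a vertex cover of the size of the matching.\<close>

lemma search_stuck_maximum:
  assumes m: "matching_rep M T H mL mR" and s: "search_inv M T H mL mR st vis par Q qt 0"
    and free: "\<And>j. j < M \<Longrightarrow> mL (T j) = 0 \<Longrightarrow> vis (H j) = st"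
    and tree: "\<And>i j. i < qt \<Longrightarrow> j < M \<Longrightarrow> T j = T (mR (Q i) - 1) \<Longrightarrow> vis (H j) = st"
  shows "maximum_matching_rep M T H mL mR"
  unfolding maximum_matching_rep_def
proof (intro conjI allI impI m)
  fix N assume N: "N \<subseteq> {..<M}" "inj_on T N" "inj_on H N"
  define R where "R = {w. vis w = st}"
  have R: "R = Q ` {..<qt}"
    using s unfolding R_def search_inv_def search_tree_def by auto
  have matched: "mR w \<noteq> 0" if "w \<in> R" for w
    using s that unfolding R search_inv_def by auto
  have mate: "mL (T (mR w - 1)) = mR w" "H (mR w - 1) = w" if "w \<in> R" for w
    using matching_repR[OF m matched[OF that]] by auto
  let ?D = "{x. mL x \<noteq> 0}"
  define X where "X = (\<lambda>w. T (mR w - 1)) ` R"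
  have XD: "X \<subseteq> ?D" unfolding X_def using mate matched by auto
  have cX: "card X = card R"
    unfolding X_def by (intro card_image inj_onI) (metis mate)
  have fR: "finite R" using R by simp
  have finD: "finite ?D" using matched_finite[OF m] .
  \<comment> \<open>The cover consists of the visited right vertices \<open>R\<close> and the
    matched left vertices outside \<open>X\<close>, the mates of \<open>R\<close>. Arcs with head in
    \<open>R\<close> are counted by their heads, the others by their tails; such a tail is matched
    by \<open>free\<close> and outside \<open>X\<close> by \<open>tree\<close>.\<close>
  let ?N1 = "{j\<in>N. H j \<in> R}" and ?N2 = "{j\<in>N. H j \<notin> R}"
  have fN: "finite N" using N(1) finite_subset by blast
  have "card ?N1 \<le> card R"
    by (intro card_inj_on_le[of H]) (use N(3) fR in \<open>auto simp: inj_on_def\<close>)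
  moreover have "card ?N2 \<le> card (?D - X)"
  proof (intro card_inj_on_le[of T])
    show "T ` ?N2 \<subseteq> ?D - X"
    proof safe
      fix j assume j: "j \<in> N" "H j \<notin> R"
      show "mL (T j) > 0" using free[of j] j N(1) R_def by auto
      assume "T j \<in> X"
      then obtain i where "i < qt" "T j = T (mR (Q i) - 1)"
        unfolding X_def R by auto
      then show False using tree[of i j] j N(1) R_def by auto
    qed
  qed (use N(2) finD in \<open>auto simp: inj_on_def\<close>)
  moreover have "card N = card ?N1 + card ?N2"
    using fN by (subst card_Un_disjoint[symmetric]) (auto intro: arg_cong[of _ _ card])
  moreover have "card (?D - X) = card ?D - card X"
    by (intro card_Diff_subset) (use XD finD finite_subset in auto)
  moreover have "card X \<le> card ?D" by (intro card_mono finD XD)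
  ultimately show "card N \<le> card ?D" using cX by linarith
qed

section \<open>The matching program\<close>

text \<open>
  The arcs at a left vertex form a linked list with heads \<open>F\<close> and links \<open>X\<close>, in descending order and
  again with arc numbers increased by one; so the part of the list that starts at \<open>a\<close> consists of the
  arcs at that vertex with a number below \<open>a\<close>.
\<close>

definition adjacency where
  "adjacency M T F X \<longleftrightarrow>
     (\<forall>x. F x \<le> M \<and> (F x \<noteq> 0 \<longrightarrow> T (F x - 1) = x) \<and> (\<forall>j<M. F x \<le> j \<longrightarrow> T j \<noteq> x)) \<and>
     (\<forall>j<M. X j \<le> j \<and> (X j \<noteq> 0 \<longrightarrow> T (X j - 1) = T j) \<and> (\<forall>i<j. X j \<le> i \<longrightarrow> T i \<noteq> T j))"
  for M :: nat and T F X :: "nat \<Rightarrow> nat"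

lemma adjacency_first:
  assumes "adjacency M T F X"
  shows "F x \<le> M" "F x \<noteq> 0 \<Longrightarrow> T (F x - 1) = x" "j < M \<Longrightarrow> T j = x \<Longrightarrow> j < F x"
  using assms unfolding adjacency_def by (blast, blast, metis not_le)

lemma adjacency_next:
  assumes "adjacency M T F X" "j < M"
  shows "X j \<le> j" "X j \<noteq> 0 \<Longrightarrow> T (X j - 1) = T j" "i < j \<Longrightarrow> T i = T j \<Longrightarrow> i < X j"
  using assms unfolding adjacency_def by (blast, blast, metis not_le)

lemma adjacency_Suc:
  assumes A: "adjacency i T F X"
  shows "adjacency (Suc i) T (F(T i := Suc i)) (X(i := F (T i)))"
  unfolding adjacency_def
proof (intro conjI allI impI)
  fix x
  show "(F(T i := Suc i)) x \<le> Suc i"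
    using adjacency_first(1)[OF A, of x] by simp
  show "T ((F(T i := Suc i)) x - 1) = x" if "(F(T i := Suc i)) x \<noteq> 0"
    using adjacency_first(2)[OF A, of x] that by (cases "x = T i") simp_all
  show "T j \<noteq> x" if "j < Suc i" "(F(T i := Suc i)) x \<le> j" for j
    using adjacency_first(3)[OF A, of j x] that by (cases "x = T i") (auto simp: less_Suc_eq)
next
  fix j assume j: "j < Suc i"
  then consider "j = i" | "j < i" by linarith
  note cases = this
  show "(X(i := F (T i))) j \<le> j"
    by (cases rule: cases) (use adjacency_first(1)[OF A] adjacency_next(1)[OF A] in auto)
  show "T ((X(i := F (T i))) j - 1) = T j" if "(X(i := F (T i))) j \<noteq> 0"
    by (cases rule: cases)
      (use that adjacency_first(2)[OF A, of "T i"] adjacency_next(2)[OF A, of j] in auto)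
  show "T l \<noteq> T j" if "l < j" "(X(i := F (T i))) j \<le> l" for l
    by (cases rule: cases)
      (use that adjacency_first(3)[OF A, of l "T i"] adjacency_next(3)[OF A, of j l] in auto)
qed

text \<open>
  All names of the program start with the character \<open>c\<close>, which allows two instances. Arrays: mates \<open>L\<close>
  and \<open>R\<close>, phase of the last visit \<open>V\<close>, arc of the visit \<open>P\<close>, visited right vertices in order \<open>Q\<close>.
  Registers: phase \<open>s\<close>, end \<open>t\<close> and front \<open>h\<close> of the queue, current arc \<open>a\<close>, and \<open>g\<close>, which is one more than
  a visited free right vertex. Stamping the visits with the phase makes a phase cost \<open>O(M + 1)\<close>,
  without a term for the number of vertices.
\<close>

definition build_adjacency :: "char \<Rightarrow> string \<Rightarrow> string \<Rightarrow> com" where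
  "build_adjacency c tn mn =
    Assign (c # ''j'') (Const 0) ;;
    While (Less (Reg (c # ''j'')) (Reg mn))
     (Put (c # ''X'') (Reg (c # ''j'')) (Get (c # ''F'') (Get tn (Reg (c # ''j'')))) ;;
      Put (c # ''F'') (Get tn (Reg (c # ''j''))) (Add (Reg (c # ''j'')) (Const 1)) ;;
      Assign (c # ''j'') (Add (Reg (c # ''j'')) (Const 1)))"

definition relax :: "char \<Rightarrow> string \<Rightarrow> com" where
  "relax c hn =
    Assign (c # ''w'') (Get hn (Sub (Reg (c # ''a'')) (Const 1))) ;;
    If (Equal (Get (c # ''V'') (Reg (c # ''w''))) (Reg (c # ''s''))) Skip
     (Put (c # ''V'') (Reg (c # ''w'')) (Reg (c # ''s'')) ;;
      Put (c # ''P'') (Reg (c # ''w'')) (Reg (c # ''a'')) ;;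
      Put (c # ''Q'') (Reg (c # ''t'')) (Reg (c # ''w'')) ;;
      Assign (c # ''t'') (Add (Reg (c # ''t'')) (Const 1)) ;;
      If (Equal (Get (c # ''R'') (Reg (c # ''w''))) (Const 0))
        (Assign (c # ''g'') (Add (Reg (c # ''w'')) (Const 1))) Skip)"

definition scan_free :: "char \<Rightarrow> string \<Rightarrow> string \<Rightarrow> string \<Rightarrow> com" where
  "scan_free c tn hn mn =
    While (Less (Reg (c # ''j'')) (Reg mn))
     (Assign (c # ''a'') (Add (Reg (c # ''j'')) (Const 1)) ;;
      If (Equal (Get (c # ''L'') (Get tn (Reg (c # ''j'')))) (Const 0)) (relax c hn) Skip ;;
      Assign (c # ''j'') (Add (Reg (c # ''j'')) (Const 1)))"

text \<open>The nested loops over the queue and over an arc list are flattened into one: a round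
  takes a vertex from the queue if \<open>a\<close> is 0 and relaxes one arc otherwise. The sum in
  the guard expresses a disjunction.\<close>

definition scan_tree :: "char \<Rightarrow> string \<Rightarrow> string \<Rightarrow> com" where
  "scan_tree c tn hn =
    While (And (Equal (Reg (c # ''g'')) (Const 0))
            (Less (Const 0) (Add (Reg (c # ''a'')) (Sub (Reg (c # ''t'')) (Reg (c # ''h''))))))
     (If (Equal (Reg (c # ''a'')) (Const 0))
       (Assign (c # ''a'') (Get (c # ''F'') (Get tn
          (Sub (Get (c # ''R'') (Get (c # ''Q'') (Reg (c # ''h'')))) (Const 1)))) ;;
        Assign (c # ''h'') (Add (Reg (c # ''h'')) (Const 1)))
       (relax c hn ;;
        Assign (c # ''a'') (Get (c # ''X'') (Sub (Reg (c # ''a'')) (Const 1)))))"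

definition augment :: "char \<Rightarrow> string \<Rightarrow> string \<Rightarrow> com" where
  "augment c tn hn =
    While (Less (Const 0) (Reg (c # ''f'')))
     (Assign (c # ''a'') (Get (c # ''P'') (Sub (Reg (c # ''f'')) (Const 1))) ;;
      Assign (c # ''b'') (Get (c # ''L'') (Get tn (Sub (Reg (c # ''a'')) (Const 1)))) ;;
      Put (c # ''L'') (Get tn (Sub (Reg (c # ''a'')) (Const 1))) (Reg (c # ''a'')) ;;
      Put (c # ''R'') (Sub (Reg (c # ''f'')) (Const 1)) (Reg (c # ''a'')) ;;
      If (Equal (Reg (c # ''b'')) (Const 0)) (Assign (c # ''f'') (Const 0))
        (Assign (c # ''f'') (Add (Get hn (Sub (Reg (c # ''b'')) (Const 1))) (Const 1))))"

definition matching_phase :: "char \<Rightarrow> string \<Rightarrow> string \<Rightarrow> string \<Rightarrow> com" where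
  "matching_phase c tn hn mn =
    (Assign (c # ''s'') (Add (Reg (c # ''s'')) (Const 1)) ;;
     Assign (c # ''t'') (Const 0) ;; Assign (c # ''g'') (Const 0) ;;
     Assign (c # ''j'') (Const 0)) ;;
    scan_free c tn hn mn ;;
    (Assign (c # ''h'') (Const 0) ;; Assign (c # ''a'') (Const 0)) ;;
    scan_tree c tn hn ;;
    Assign (c # ''f'') (Reg (c # ''g'')) ;;
    augment c tn hn"

definition matching :: "char \<Rightarrow> string \<Rightarrow> string \<Rightarrow> string \<Rightarrow> com" where
  "matching c tn hn mn =
    build_adjacency c tn mn ;;
    Assign (c # ''g'') (Const 1) ;;
    While (Less (Const 0) (Reg (c # ''g''))) (matching_phase c tn hn mn)"

text \<open>\<open>N\<close> and \<open>K\<close> bound the left and the right vertices. The word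
  bound leaves room for the phase number, which reaches at most \<open>N + 1\<close>, and for right
  vertices increased by one. \<open>names\<close> keeps the input apart from the working
  variables.\<close>

locale matching_program =
  fixes B :: nat and c :: char and tn hn mn :: string
    and M N K :: nat and T H :: "nat \<Rightarrow> nat"
  assumes names: "\<And>x. tn \<noteq> c # x" "\<And>x. hn \<noteq> c # x" "\<And>x. mn \<noteq> c # x"
    and T_less: "\<And>j. j < M \<Longrightarrow> T j < N" and H_less: "\<And>j. j < M \<Longrightarrow> H j < K"
    and word: "M \<le> B" "N + 2 \<le> B" "K \<le> B"
begin

lemmas neqs = names names[THEN not_sym]

definition input where
  "input s \<longleftrightarrow> reg s mn = M \<and> arr s tn = T \<and> arr s hn = H"

text \<open>The invariant is that the lists are right for the first \<open>j\<close> arcs. The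
  numerical constants in this and later time bounds are rounded up from \<open>cost\<close>.\<close>

lemma build_adjacency:
  assumes "input s" "arr s (c # ''F'') = (\<lambda>_. 0)"
  shows "runs B (build_adjacency c tn mn) s (30 * M + 20)
    (\<lambda>s'. adjacency M T (arr s' (c # ''F'')) (arr s' (c # ''X'')))"
proof -
  define I where "I v s \<longleftrightarrow> input s \<and> reg s (c # ''j'') \<le> M \<and> v = M - reg s (c # ''j'') \<and>
    adjacency (reg s (c # ''j'')) T (arr s (c # ''F'')) (arr s (c # ''X''))" for v and s :: store
  show ?thesis
    unfolding build_adjacency_def
  proof (rule runs_Seq[where R = "I M" and ?T1.0 = 9 and ?T2.0 = "30 * M + 10"], goal_cases)
    case 1
    show ?case
      by (rule runs_wpI) (use assms in \<open>auto simp: I_def input_def neqs adjacency_def\<close>)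
  next
    case (2 s)
    show ?case
    proof (rule runs_WhileI[where I = I and v = M and K = 22], goal_cases)
      case (2 v s)
      then have j: "reg s (c # ''j'') < M" by (auto simp: I_def input_def)
      have "arr s (c # ''F'') x \<le> B" for x
        using 2 j word adjacency_first(1)[of "reg s (c # ''j'')" T "arr s (c # ''F'')" "arr s (c # ''X'')" x]
        by (auto simp: I_def)
      then show ?case
        using 2 j word by (intro runs_wpI) (auto simp: I_def input_def neqs adjacency_Suc)
    qed (use 2 in \<open>auto simp: I_def input_def\<close>)
  qed auto
qed


definition search where
  "search s \<longleftrightarrow> search_inv M T H (arr s (c # ''L'')) (arr s (c # ''R'')) (reg s (c # ''s''))
     (arr s (c # ''V'')) (arr s (c # ''P'')) (arr s (c # ''Q'')) (reg s (c # ''t'')) (reg s (c # ''g''))"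

lemma cost_relax: "cost (relax c hn) = 37"
  by (simp add: relax_def)

text \<open>In continuation form, with everything a caller may need about the new store as premises
  of \<open>Q\<close>; thus the scan of the free left vertices and the scan of the tree share one
  symbolic execution.\<close>

lemma wp_relax:
  assumes s: "search s" "arr s hn = H" "reg s (c # ''s'') \<le> B"
    and a: "a = reg s (c # ''a'')" "1 \<le> a" "a \<le> M"
    and tree: "arr s (c # ''L'') (T (a - 1)) \<noteq> 0 \<Longrightarrow>
       arr s (c # ''V'') (H (arr s (c # ''L'') (T (a - 1)) - 1)) = reg s (c # ''s'')"
    and Q: "\<And>s'. search s' \<Longrightarrow> (\<And>x. x \<notin> {c # ''w'', c # ''t'', c # ''g''} \<Longrightarrow> reg s' x = reg s x) \<Longrightarrow>
       (\<And>x. x \<notin> {c # ''V'', c # ''P'', c # ''Q''} \<Longrightarrow> arr s' x = arr s x) \<Longrightarrow>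
       arr s' (c # ''V'') (H (a - 1)) = reg s (c # ''s'') \<Longrightarrow>
       (\<And>w. arr s (c # ''V'') w = reg s (c # ''s'') \<Longrightarrow> arr s' (c # ''V'') w = reg s (c # ''s'')) \<Longrightarrow>
       reg s (c # ''t'') \<le> reg s' (c # ''t'') \<Longrightarrow>
       (\<And>i. i < reg s (c # ''t'') \<Longrightarrow> arr s' (c # ''Q'') i = arr s (c # ''Q'') i) \<Longrightarrow>
       R s'"
  shows "wp B (relax c hn) R s"
proof -
  have w: "H (a - 1) < K" using H_less a by simp
  show ?thesis
  proof (cases "arr s (c # ''V'') (H (a - 1)) = reg s (c # ''s'')")
    case True
    have "search (s\<lparr>reg := (reg s)(c # ''w'' := H (a - 1))\<rparr>)"
      using s(1) by (simp add: search_def)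
    then have "R (s\<lparr>reg := (reg s)(c # ''w'' := H (a - 1))\<rparr>)"
      by (rule Q) (use True in simp_all)
    with True show ?thesis
      using s(2) w a(1) word by (simp add: relax_def)
  next
    case False
    have visited: "\<exists>j<reg s (c # ''t''). arr s (c # ''Q'') j = w" if "arr s (c # ''V'') w = reg s (c # ''s'')" for w
      using s(1) that unfolding search_def search_inv_def search_tree_def by blast
    define s' where "s' = s\<lparr>arr := (arr s)(c # ''V'' := (arr s (c # ''V''))(H (a - 1) := reg s (c # ''s'')),
          c # ''P'' := (arr s (c # ''P''))(H (a - 1) := a),
          c # ''Q'' := (arr s (c # ''Q''))(reg s (c # ''t'') := H (a - 1))),
       reg := (reg s)(c # ''w'' := H (a - 1), c # ''t'' := Suc (reg s (c # ''t'')))\<rparr>"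
    define s'' where "s'' = (if arr s (c # ''R'') (H (a - 1)) = 0
      then s'\<lparr>reg := (reg s')(c # ''g'' := Suc (H (a - 1)))\<rparr> else s')"
    have "search s''"
    proof -
      have "search_inv M T H (arr s (c # ''L'')) (arr s (c # ''R'')) (reg s (c # ''s''))
        ((arr s (c # ''V''))(H (a - 1) := reg s (c # ''s''))) ((arr s (c # ''P''))(H (a - 1) := a))
        ((arr s (c # ''Q''))(reg s (c # ''t'') := H (a - 1))) (Suc (reg s (c # ''t'')))
        (if arr s (c # ''R'') (H (a - 1)) = 0 then Suc (H (a - 1)) else reg s (c # ''g''))"
        using s(1) unfolding search_def
        by (rule search_inv_visit) (use a False visited[OF tree] in auto)
      then show ?thesis
        unfolding search_def s''_def s'_def by (simp split: if_splits)
    qed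
    then have R: "R s''"
      by (rule Q) (simp_all add: s''_def s'_def)
    \<comment> \<open>\<open>search_tree_le\<close> is applied to the store after the visit, where
      the queue is longer by one; the word bound for the new end of the queue needs this.\<close>
    have t: "reg s (c # ''t'') < M"
    proof -
      have "reg s'' (c # ''t'') \<le> M"
        using \<open>search s''\<close> unfolding search_def search_inv_def by (blast dest: search_tree_le)
      moreover have "reg s'' (c # ''t'') = Suc (reg s (c # ''t''))"
        by (simp add: s''_def s'_def)
      ultimately show ?thesis by simp
    qed
    show ?thesis
      using False s(2,3) a w word t R unfolding relax_def s''_def s'_def
      by (cases "arr s (c # ''R'') (H (a - 1)) = 0") simp_all
  qed
qed


definition base where
  "base s \<longleftrightarrow> input s \<and> adjacency M T (arr s (c # ''F'')) (arr s (c # ''X'')) \<and>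
     matching_rep M T H (arr s (c # ''L'')) (arr s (c # ''R''))"

definition free_scanned where
  "free_scanned s i \<longleftrightarrow>
     (\<forall>j<i. arr s (c # ''L'') (T j) = 0 \<longrightarrow> arr s (c # ''V'') (H j) = reg s (c # ''s''))"

lemma scan_free:
  assumes "base s" "search s" "reg s (c # ''j'') = 0" "reg s (c # ''s'') \<le> B"
  shows "runs B (scan_free c tn hn mn) s (80 * M + 20)
    (\<lambda>s'. base s' \<and> search s' \<and> free_scanned s' M)"
proof -
  define I where "I v s \<longleftrightarrow> base s \<and> search s \<and> reg s (c # ''s'') \<le> B \<and>
    reg s (c # ''j'') \<le> M \<and> v = M - reg s (c # ''j'') \<and> free_scanned s (reg s (c # ''j''))"
    for v and s :: store
  show ?thesis
    unfolding scan_free_def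
  proof (rule runs_WhileI[where I = I and v = M and K = 70], goal_cases)
    case (2 v s)
    then have j: "reg s (c # ''j'') < M" by (auto simp: I_def base_def input_def)
    let ?j = "reg s (c # ''j'')"
    let ?s = "s\<lparr>reg := (reg s)(c # ''a'' := Suc ?j)\<rparr>"
    have s: "search ?s" "arr ?s hn = H" "arr s tn = T"
      using 2 by (auto simp: I_def search_def base_def input_def)
    have "wp B (If (Equal (Get (c # ''L'') (Get tn (Reg (c # ''j'')))) (Const 0)) (relax c hn) Skip ;;
      Assign (c # ''j'') (Add (Reg (c # ''j'')) (Const 1))) (\<lambda>s'. \<exists>v'<v. I v' s') ?s"
    proof (cases "arr s (c # ''L'') (T ?j) = 0")
      case True
      have "wp B (relax c hn) (wp B (Assign (c # ''j'') (Add (Reg (c # ''j'')) (Const 1))) (\<lambda>s'. \<exists>v'<v. I v' s')) ?s"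
      proof (rule wp_relax[OF s(1,2), where a = "Suc ?j"], goal_cases)
        case (6 s')
        have "arr s' tn = T" "arr s' hn = H" "reg s' mn = M"
          using 2(1) 6(2)[of mn] 6(3)[of tn] 6(3)[of hn] by (simp_all add: I_def base_def input_def neqs)
        with 6 2(1) j word show ?case
          by (auto simp: I_def base_def input_def search_def free_scanned_def less_Suc_eq neqs)
      qed (use 2 j True in \<open>auto simp: I_def\<close>)
      then show ?thesis using True s(3) by (simp add: neqs)
    next
      case False
      then show ?thesis
        using 2(1) s(3) j word
        by (auto simp: I_def base_def input_def search_def free_scanned_def less_Suc_eq neqs)
    qed
    then show ?case
      by (intro runs_wpI) (use j word in \<open>simp_all add: relax_def\<close>)
  qed (use assms in \<open>auto simp: I_def base_def input_def free_scanned_def\<close>)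
qed

text \<open>The arcs still to be relaxed: those at left vertices that are not the mate of a dequeued
  vertex, and the rest of the current list. Their number is the first half of the potential of
  \<open>scan_tree\<close>.\<close>

definition unscanned where
  "unscanned mR Q h a = {j. j < M \<and> ((\<forall>i<h. T j \<noteq> T (mR (Q i) - 1)) \<or>
     (j < a \<and> T j = T (mR (Q (h - 1)) - 1)))}"

text \<open>The last clause says that arcs at mates of dequeued vertices lead to visited vertices,
  except in the unread part of the current list. For \<open>a = 0\<close> and \<open>h = qt\<close>
  it becomes the premise \<open>tree\<close> of \<open>search_stuck_maximum\<close>.\<close>

definition scan_front where
  "scan_front mR st vis Q qt h a \<longleftrightarrow> h \<le> qt \<and> a \<le> M \<and>
     (a \<noteq> 0 \<longrightarrow> 0 < h \<and> T (a - 1) = T (mR (Q (h - 1)) - 1)) \<and>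
     (\<forall>i<h. mR (Q i) \<noteq> 0) \<and>
     (\<forall>i<h. \<forall>j<M. T j = T (mR (Q i) - 1) \<longrightarrow> vis (H j) = st \<or> Suc i = h \<and> j < a)"
  for mR vis Q :: "nat \<Rightarrow> nat" and st qt h a :: nat

lemma finite_unscanned: "finite (unscanned mR Q h a)"
  unfolding unscanned_def by (rule finite_subset[of _ "{..<M}"]) auto

lemma card_unscanned: "card (unscanned mR Q h a) \<le> M"
  using card_mono[of "{..<M}" "unscanned mR Q h a"] by (auto simp: unscanned_def)

text \<open>Distinct queue entries have distinct mates, so the tail of the newly opened list is not
  among the earlier ones and its arcs were counted as unscanned before.\<close>

lemma scan_front_pop:
  assumes f: "scan_front mR st vis Q qt h 0" and h: "h < qt" "\<forall>i<qt. mR (Q i) \<noteq> 0"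
    and inj: "inj_on Q {..<qt}" and m: "matching_rep M T H mL mR" and ad: "adjacency M T F X"
    and x: "x = T (mR (Q h) - 1)"
  shows "scan_front mR st vis Q qt (Suc h) (F x)"
    "unscanned mR Q (Suc h) (F x) \<subseteq> unscanned mR Q h 0"
proof -
  show "scan_front mR st vis Q qt (Suc h) (F x)"
    using f h adjacency_first[OF ad] x unfolding scan_front_def by (auto simp: less_Suc_eq)
  have "T (mR (Q i) - 1) \<noteq> x" if "i < h" for i
  proof
    assume "T (mR (Q i) - 1) = x"
    then have "mR (Q i) = mR (Q h)"
      using matching_repR(3)[OF m] h that x by (metis order_less_trans)
    then have "Q i = Q h"
      using matching_repR(2)[OF m] h that by (metis order_less_trans)
    then show False using inj h(1) that unfolding inj_on_def by (metis lessThan_iff nat_neq_iff order_less_trans)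
  qed
  then show "unscanned mR Q (Suc h) (F x) \<subseteq> unscanned mR Q h 0"
    unfolding unscanned_def x by (auto simp: less_Suc_eq)
qed

text \<open>The inclusion is strict because the relaxed arc \<open>a - 1\<close> itself leaves the
  set.\<close>

lemma scan_front_step:
  assumes f: "scan_front mR st vis Q qt h a" and a: "a \<noteq> 0" and ad: "adjacency M T F X"
    and v: "vis' (H (a - 1)) = st" "\<And>w. vis w = st \<Longrightarrow> vis' w = st"
    and Q: "\<And>i. i < qt \<Longrightarrow> Q' i = Q i" and qt: "qt \<le> qt'"
  shows "scan_front mR st vis' Q' qt' h (X (a - 1))"
    "unscanned mR Q' h (X (a - 1)) \<subset> unscanned mR Q h a"
proof -
  have *: "0 < h" "h \<le> qt" "T (a - 1) = T (mR (Q (h - 1)) - 1)" "a - 1 < M"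
    using f a unfolding scan_front_def by auto
  note nxt = adjacency_next[OF ad *(4)]
  have Q': "Q' i = Q i" if "i < h" for i using Q that *(2) by simp
  then have Qh: "Q' (h - 1) = Q (h - 1)" using * by simp
  show "scan_front mR st vis' Q' qt' h (X (a - 1))"
    unfolding scan_front_def
  proof (intro conjI allI impI)
    fix i j assume ij: "i < h" "j < M" "T j = T (mR (Q' i) - 1)"
    then have "vis (H j) = st \<or> Suc i = h \<and> j < a"
      using f Q' unfolding scan_front_def by auto
    then consider "vis (H j) = st" | "Suc i = h" "j < a - 1" | "Suc i = h" "j = a - 1" by linarith
    then show "vis' (H j) = st \<or> Suc i = h \<and> j < X (a - 1)"
    proof cases
      case 2
      then have "T j = T (a - 1)" using ij *(3) Q' by (metis diff_Suc_1)
      with 2 nxt(3)[of j] show ?thesis by simp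
    qed (use v in auto)
  qed (use f * nxt Q' Qh qt in \<open>auto simp: scan_front_def\<close>)
  have "T (a - 1) = T (mR (Q' (h - 1)) - 1)" "h - 1 < h" using * Qh by auto
  then have "\<not> (\<forall>i<h. T (a - 1) \<noteq> T (mR (Q' i) - 1))" by blast
  then have "a - 1 \<notin> unscanned mR Q' h (X (a - 1))"
    using nxt(1) unfolding unscanned_def by auto
  moreover have "a - 1 \<in> unscanned mR Q h a"
    using * a unfolding unscanned_def by force
  moreover have "unscanned mR Q' h (X (a - 1)) \<subseteq> unscanned mR Q h a"
    using nxt(1) Q' Qh unfolding unscanned_def by fastforce
  ultimately show "unscanned mR Q' h (X (a - 1)) \<subset> unscanned mR Q h a" by blast
qed


text \<open>The potential is the number of unscanned arcs plus \<open>M - h\<close>, at most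
  \<open>2 * M\<close> at the start: relaxing lowers the first summand, dequeuing lowers the second
  without raising the first. If the loop stops with \<open>g = 0\<close>, the queue and the list are
  exhausted.\<close>

lemma scan_tree:
  assumes "base s" "search s" "free_scanned s M" "reg s (c # ''h'') = 0" "reg s (c # ''a'') = 0"
    "reg s (c # ''s'') \<le> B"
  shows "runs B (scan_tree c tn hn) s (200 * M + 20)
    (\<lambda>s'. base s' \<and> search s' \<and>
      (reg s' (c # ''g'') = 0 \<longrightarrow> maximum_matching_rep M T H (arr s' (c # ''L'')) (arr s' (c # ''R''))))"
proof -
  define front where "front s \<longleftrightarrow> scan_front (arr s (c # ''R'')) (reg s (c # ''s'')) (arr s (c # ''V''))
     (arr s (c # ''Q'')) (reg s (c # ''t'')) (reg s (c # ''h'')) (reg s (c # ''a''))" for s :: store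
  define rest where "rest s = unscanned (arr s (c # ''R'')) (arr s (c # ''Q'')) (reg s (c # ''h'')) (reg s (c # ''a''))"
    for s :: store
  define I where "I v s \<longleftrightarrow> base s \<and> search s \<and> reg s (c # ''s'') \<le> B \<and> free_scanned s M \<and> front s \<and>
    v = card (rest s) + (M - reg s (c # ''h''))" for v and s :: store
  show ?thesis
    unfolding scan_tree_def
  proof (rule runs_WhileI[where I = I and v = "card (rest s) + M" and K = 80], goal_cases)
    case (2 v s)
    let ?a = "reg s (c # ''a'')" and ?h = "reg s (c # ''h'')" and ?t = "reg s (c # ''t'')"
      and ?R = "arr s (c # ''R'')" and ?Q = "arr s (c # ''Q'')" and ?F = "arr s (c # ''F'')"
      and ?X = "arr s (c # ''X'')" and ?V = "arr s (c # ''V'')" and ?L = "arr s (c # ''L'')"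
    have g: "reg s (c # ''g'') = 0" and r: "0 < ?a \<or> ?h < ?t" using 2(2) by auto
    have s: "base s" "search s" "reg s (c # ''s'') \<le> B" "free_scanned s M" "front s"
      and v: "v = card (rest s) + (M - ?h)" using 2(1) unfolding I_def by blast+
    have in_s: "arr s tn = T" "arr s hn = H" "reg s mn = M" using s(1) by (auto simp: base_def input_def)
    have ad: "adjacency M T ?F ?X" and m: "matching_rep M T H ?L ?R" using s(1) by (auto simp: base_def)
    have tM: "?t \<le> M" using s(2) unfolding search_def search_inv_def by (blast dest: search_tree_le)
    have matched: "\<forall>i<?t. ?R (?Q i) \<noteq> 0" and inj: "inj_on ?Q {..<?t}"
      and visited: "?V w = reg s (c # ''s'') \<longleftrightarrow> (\<exists>i<?t. ?Q i = w)" for w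
      using s(2) g unfolding search_def search_inv_def search_tree_def by auto
    show ?case
    proof (cases "?a = 0")
      case True
      then have h: "?h < ?t" using r by simp
      let ?x = "T (?R (?Q ?h) - 1)"
      let ?s = "s\<lparr>reg := (reg s)(c # ''a'' := ?F ?x, c # ''h'' := Suc ?h)\<rparr>"
      have f: "scan_front ?R (reg s (c # ''s'')) ?V ?Q ?t ?h 0" using s(5) True by (simp add: front_def)
      note pop = scan_front_pop[OF f h matched inj m ad refl]
      have "card (rest ?s) \<le> card (rest s)"
        using card_mono[OF finite_unscanned pop(2)] by (simp add: rest_def True)
      then have "I (card (rest ?s) + (M - Suc ?h)) ?s" "card (rest ?s) + (M - Suc ?h) < v"
        using s pop(1) v h tM
        by (auto simp: I_def base_def input_def search_def free_scanned_def front_def neqs)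
      then have "\<exists>v'<v. I v' ?s" by blast
      moreover have "?F ?x \<le> B" "Suc ?h \<le> B"
        using adjacency_first(1)[OF ad, of ?x] word h tM by linarith+
      ultimately show ?thesis
        by (intro runs_wpI) (simp_all add: True in_s neqs relax_def)
    next
      case False
      then have a: "1 \<le> ?a" "?a \<le> M" and h: "0 < ?h" "?h \<le> ?t"
        and Ta: "T (?a - 1) = T (?R (?Q (?h - 1)) - 1)"
        using s(5) unfolding front_def scan_front_def by auto
      have "?R (?Q (?h - 1)) \<noteq> 0" using matched h by simp
      then have "?L (T (?a - 1)) = ?R (?Q (?h - 1))" "H (?R (?Q (?h - 1)) - 1) = ?Q (?h - 1)"
        using matching_repR[OF m] Ta by auto
      then have tree: "?V (H (?L (T (?a - 1)) - 1)) = reg s (c # ''s'')"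
        using visited h by (metis One_nat_def Suc_pred less_le_trans lessI)
      have "wp B (relax c hn) (wp B (Assign (c # ''a'') (Get (c # ''X'') (Sub (Reg (c # ''a'')) (Const 1))))
        (\<lambda>s'. \<exists>v'<v. I v' s')) s"
      proof (rule wp_relax[OF s(2) in_s(2) s(3) refl a tree], goal_cases)
        case (1 s')
        let ?s = "s'\<lparr>reg := (reg s')(c # ''a'' := ?X (?a - 1))\<rparr>"
        have eq: "arr s' tn = T" "arr s' hn = H" "reg s' mn = M" "arr s' (c # ''X'') = ?X"
          "arr s' (c # ''F'') = ?F" "arr s' (c # ''L'') = ?L" "arr s' (c # ''R'') = ?R"
          "reg s' (c # ''a'') = ?a" "reg s' (c # ''h'') = ?h" "reg s' (c # ''s'') = reg s (c # ''s'')"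
          using 1(2,3) in_s by (simp_all add: neqs)
        have f: "scan_front ?R (reg s (c # ''s'')) ?V ?Q ?t ?h ?a" using s(5) by (simp add: front_def)
        have "?a \<noteq> 0" using a by simp
        note step = scan_front_step[where vis' = "arr s' (c # ''V'')" and Q' = "arr s' (c # ''Q'')",
            OF f this ad 1(4,5,7,6)]
        have "card (rest ?s) < card (rest s)"
          using psubset_card_mono[OF finite_unscanned step(2)] by (simp add: rest_def eq)
        then have "card (rest ?s) + (M - ?h) < v" using v by simp
        moreover have "free_scanned ?s M"
          using s(4) 1(5) unfolding free_scanned_def by (simp add: eq)
        moreover have "base ?s" "front ?s" "search ?s"
          using s(1) 1(1) step(1) by (simp_all add: base_def input_def front_def search_def eq neqs)
        ultimately have "\<exists>v'<v. I v' ?s"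
          unfolding I_def using s(3) by (simp add: eq)
        moreover have "?X (?a - 1) \<le> B"
          using adjacency_next(1)[OF ad, of "?a - 1"] a word by linarith
        ultimately show ?case by (simp add: eq)
      qed
      then show ?thesis
        using False by (intro runs_wpI) (simp_all add: cost_relax)
    qed
  next
    case 1
    then show ?case using assms by (simp add: I_def front_def scan_front_def rest_def)
  next
    case 3
    have "card (rest s) \<le> M" unfolding rest_def by (rule card_unscanned)
    then show ?case by simp
  next
    case (4 v s)
    let ?a = "reg s (c # ''a'')" and ?h = "reg s (c # ''h'')" and ?t = "reg s (c # ''t'')"
      and ?R = "arr s (c # ''R'')" and ?Q = "arr s (c # ''Q'')"
      and ?V = "arr s (c # ''V'')" and ?L = "arr s (c # ''L'')"
    have s: "base s" "search s" "free_scanned s M" "front s" using 4(1) unfolding I_def by blast+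
    moreover have "maximum_matching_rep M T H ?L ?R" if g: "reg s (c # ''g'') = 0"
    proof (rule search_stuck_maximum)
      show "matching_rep M T H ?L ?R" using s(1) unfolding base_def by blast
      show "search_inv M T H ?L ?R (reg s (c # ''s'')) ?V (arr s (c # ''P'')) ?Q ?t 0"
        using s(2) g by (simp add: search_def)
      show "?V (H j) = reg s (c # ''s'')" if "j < M" "?L (T j) = 0" for j
        using s(3) that unfolding free_scanned_def by blast
      have "?a = 0" "?h = ?t" using 4(2) g s(4) unfolding front_def scan_front_def by auto
      then show "?V (H j) = reg s (c # ''s'')" if "i < ?t" "j < M" "T j = T (?R (?Q i) - 1)" for i j
        using s(4) that unfolding front_def scan_front_def by auto
    qed
    ultimately show ?case by blast
  qed
qed

text \<open>The potential is the queue position of the stale vertex plus one. Every step but the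
  last replaces an arc at a matched left vertex, so the size stays one below its final value
  \<open>z\<close> until a free left vertex is reached.\<close>

lemma augment:
  assumes "base s" "search s" "reg s (c # ''f'') = reg s (c # ''g'')"
  shows "runs B (augment c tn hn) s (60 * M + 70)
    (\<lambda>s'. base s' \<and> card {x. arr s' (c # ''L'') x \<noteq> 0} =
       card {x. arr s (c # ''L'') x \<noteq> 0} + (if reg s (c # ''g'') = 0 then 0 else 1))"
proof -
  define z where "z = card {x. arr s (c # ''L'') x \<noteq> 0} + (if reg s (c # ''g'') = 0 then 0 else 1)"
  define I where "I v s \<longleftrightarrow> input s \<and> adjacency M T (arr s (c # ''F'')) (arr s (c # ''X'')) \<and>
     (if reg s (c # ''f'') = 0 then matching_rep M T H (arr s (c # ''L'')) (arr s (c # ''R'')) \<and>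
         card {x. arr s (c # ''L'') x \<noteq> 0} = z
      else \<exists>i. v = Suc i \<and> reg s (c # ''f'') = Suc (arr s (c # ''Q'') i) \<and>
         augmenting M T H (arr s (c # ''L'')) (arr s (c # ''R'')) (arr s (c # ''P'')) (arr s (c # ''Q'')) i \<and>
         Suc (card {x. arr s (c # ''L'') x \<noteq> 0}) = z)" for v and s :: store
  have tM: "reg s (c # ''t'') \<le> M"
    using assms(2) unfolding search_def search_inv_def by (blast dest: search_tree_le)
  have "\<exists>v\<le>Suc M. I v s"
  proof (cases "reg s (c # ''g'') = 0")
    case True
    then show ?thesis using assms by (auto simp: I_def base_def z_def)
  next
    case False
    obtain i where "i < reg s (c # ''t'')" "arr s (c # ''Q'') i = reg s (c # ''g'') - 1"
      "augmenting M T H (arr s (c # ''L'')) (arr s (c # ''R'')) (arr s (c # ''P'')) (arr s (c # ''Q'')) i"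
      by (rule augmenting_start[OF assms(2)[unfolded search_def] False])
        (use assms(1) in \<open>simp add: base_def\<close>)
    then have "I (Suc i) s" using False assms by (auto simp: I_def base_def z_def)
    with \<open>i < _\<close> tM show ?thesis by (intro exI[of _ "Suc i"]) auto
  qed
  then obtain v where v: "v \<le> Suc M" "I v s" by blast
  show ?thesis
    unfolding augment_def z_def[symmetric]
  proof (rule runs_WhileI[where I = I and v = v and K = 50], goal_cases)
    case (2 v s)
    let ?R = "arr s (c # ''R'')" and ?Q = "arr s (c # ''Q'')" and ?F = "arr s (c # ''F'')"
      and ?X = "arr s (c # ''X'')" and ?P = "arr s (c # ''P'')" and ?L = "arr s (c # ''L'')"
    have f0: "reg s (c # ''f'') \<noteq> 0" using 2(2) by auto
    have in_s: "arr s tn = T" "arr s hn = H" "reg s mn = M" and ad: "adjacency M T ?F ?X"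
      using 2(1) by (auto simp: I_def input_def)
    obtain i where i: "v = Suc i" "reg s (c # ''f'') = Suc (?Q i)" "augmenting M T H ?L ?R ?P ?Q i"
      "Suc (card {x. ?L x \<noteq> 0}) = z"
    proof -
      have "\<exists>i. v = Suc i \<and> reg s (c # ''f'') = Suc (?Q i) \<and> augmenting M T H ?L ?R ?P ?Q i \<and>
        Suc (card {x. ?L x \<noteq> 0}) = z"
        using 2(1) f0 unfolding I_def by (simp only: if_False)
      then show ?thesis using that by blast
    qed
    define a where "a = ?P (?Q i)"
    define x where "x = T (a - 1)"
    define b where "b = ?L x"
    have m: "matching_rep M T H ?L (?R(?Q i := 0))" and a: "1 \<le> a" "a \<le> M"
      using i(3) unfolding augmenting_def a_def by auto
    have b_le: "b \<le> M" using matching_repL(1)[OF m, of x] by (cases "b = 0") (auto simp: b_def)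
    have fin: "finite {x. ?L x \<noteq> 0}" using matched_finite[OF m] .
    show ?case
    proof (cases "b = 0")
      case True
      then have "matching_rep M T H (?L(x := a)) (?R(?Q i := a))"
        using augmenting_last[OF i(3) a_def x_def] b_def by simp
      moreover have "{y. (?L(x := a)) y \<noteq> 0} = insert x {x. ?L x \<noteq> 0}" "x \<notin> {x. ?L x \<noteq> 0}"
        using a True b_def by auto
      then have "card {y. (?L(x := a)) y \<noteq> 0} = z" using fin i(4) by simp
      moreover have "0 < v" using i by simp
      ultimately show ?thesis
        using in_s ad i(2) a word True a_def x_def b_def
        by (intro runs_wpI) (auto simp: I_def input_def neqs)
    next
      case False
      obtain j where j: "j < i" "?Q j = H (b - 1)"
        "augmenting M T H (?L(x := a)) (?R(?Q i := a)) ?P ?Q j"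
        using augmenting_step[OF i(3) a_def x_def b_def False] by blast
      have "{y. (?L(x := a)) y \<noteq> 0} = {x. ?L x \<noteq> 0}" using False a b_def by auto
      then have z: "Suc (card {y. (?L(x := a)) y \<noteq> 0}) = z" using i(4) by simp
      have "H (b - 1) < K" using H_less[of "b - 1"] b_le False by simp
      then have "Suc (H (b - 1)) \<le> B" using word by simp
      moreover define s1 where "s1 = s\<lparr>arr := (arr s)(c # ''L'' := ?L(x := a), c # ''R'' := ?R(?Q i := a)),
         reg := (reg s)(c # ''a'' := a, c # ''b'' := b, c # ''f'' := Suc (H (b - 1)))\<rparr>"
      have "I (Suc j) s1"
        using in_s ad j z unfolding I_def s1_def by (auto simp: input_def neqs)
      then have "\<exists>v'<v. I v' s1" using i(1) j(1) by (intro exI[of _ "Suc j"]) auto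
      moreover have "T (a - Suc 0) = x" by (simp add: x_def)
      ultimately show ?thesis
        using in_s i(2) a b_le word False unfolding s1_def
        by (intro runs_wpI) (simp_all add: neqs a_def[symmetric] b_def[symmetric])
    qed
  next
    case 3
    have "v * (1 + bcost (Less (Const 0) (Reg (c # ''f''))) + 50) \<le> Suc M * (1 + bcost (Less (Const 0) (Reg (c # ''f''))) + 50)"
      using v(1) by (intro mult_le_mono1)
    then show ?case by simp
  qed (use v in \<open>auto simp: I_def base_def\<close>)
qed


section \<open>Phases and their number\<close>

lemma maximum_matching_rep_cong:
  "maximum_matching_rep M T H mL mR \<Longrightarrow> matching_rep M T H mL' mR' \<Longrightarrow>
    card {x. mL' x \<noteq> 0} = card {x. mL x \<noteq> 0} \<Longrightarrow> maximum_matching_rep M T H mL' mR'"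
  unfolding maximum_matching_rep_def by simp

lemma card_matched_le:
  assumes "matching_rep M T H mL mR"
  shows "card {x. mL x \<noteq> 0} \<le> N"
proof -
  have "{x. mL x \<noteq> 0} \<subseteq> {..<N}"
  proof
    fix x assume "x \<in> {x. mL x \<noteq> 0}"
    then have x: "mL x \<noteq> 0" by simp
    from matching_repL(1,2)[OF assms x] T_less[of "mL x - 1"] x show "x \<in> {..<N}" by simp
  qed
  from card_mono[OF _ this] show ?thesis by simp
qed

lemma matching_phase:
  assumes "base s" "\<forall>w. arr s (c # ''V'') w \<le> reg s (c # ''s'')" "reg s (c # ''s'') < B"
  shows "runs B (matching_phase c tn hn mn) s (400 * M + 200)
    (\<lambda>s'. base s' \<and> (\<forall>w. arr s' (c # ''V'') w \<le> reg s' (c # ''s'')) \<and>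
      reg s' (c # ''s'') = Suc (reg s (c # ''s'')) \<and>
      (reg s' (c # ''g'') = 0 \<longrightarrow> maximum_matching_rep M T H (arr s' (c # ''L'')) (arr s' (c # ''R''))) \<and>
      card {x. arr s' (c # ''L'') x \<noteq> 0} =
        card {x. arr s (c # ''L'') x \<noteq> 0} + (if reg s' (c # ''g'') = 0 then 0 else 1))"
proof -
  define st where "st = Suc (reg s (c # ''s''))"
  define L where "L = arr s (c # ''L'')"
  let ?keep = "\<lambda>s'. reg s' (c # ''s'') = st \<and> arr s' (c # ''L'') = L"
  show ?thesis
    unfolding matching_phase_def L_def[symmetric] st_def[symmetric]
  proof (rule runs_Seq[where ?T1.0 = 20 and ?T2.0 = "400 * M + 170" and
        R = "\<lambda>s'. base s' \<and> search s' \<and> reg s' (c # ''j'') = 0 \<and> ?keep s'"], goal_cases)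
    case 1
    \<comment> \<open>All stamps are below the new phase number, so nothing counts as visited and
      the empty forest is a valid start.\<close>
    have ne: "arr s (c # ''V'') w \<noteq> st" "arr s (c # ''V'') w \<le> st" for w
      using assms(2) unfolding st_def by (metis le_imp_less_Suc less_irrefl, metis le_SucI)
    show ?case
      using assms(1,3)
      by (intro runs_wpI)
        (auto simp: base_def input_def search_def search_inv_def search_tree_def neqs ne[unfolded st_def] st_def L_def)
  next
    case (2 s)
    then have s: "base s" "search s" "reg s (c # ''j'') = 0" "?keep s" "reg s (c # ''s'') \<le> B"
      using assms(3) by (auto simp: st_def)
    show ?case
    proof (rule runs_Seq[where ?T1.0 = "80 * M + 20" and ?T2.0 = "300 * M + 140" and
          R = "\<lambda>s'. base s' \<and> search s' \<and> free_scanned s' M \<and> ?keep s'"], goal_cases)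
      case 1
      show ?case
        by (rule runs_mono[OF runs_frame[OF scan_free[OF s(1-3,5)]]])
          (use s(4) in \<open>auto simp: scan_free_def relax_def\<close>)
    next
      case (2 s)
      show ?case
      proof (rule runs_Seq[where ?T1.0 = 5 and ?T2.0 = "300 * M + 130" and
            R = "\<lambda>s'. base s' \<and> search s' \<and> free_scanned s' M \<and> reg s' (c # ''h'') = 0 \<and>
              reg s' (c # ''a'') = 0 \<and> ?keep s'"], goal_cases)
        case 1
        show ?case
          using 2 by (intro runs_wpI) (auto simp: base_def input_def search_def free_scanned_def neqs)
      next
        case (2 s)
        then have s: "base s" "search s" "free_scanned s M" "reg s (c # ''h'') = 0" "reg s (c # ''a'') = 0"
          "?keep s" "reg s (c # ''s'') \<le> B"
          using assms(3) by (auto simp: st_def)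
        show ?case
        proof (rule runs_Seq[where ?T1.0 = "200 * M + 20" and ?T2.0 = "60 * M + 100" and
              R = "\<lambda>s'. base s' \<and> search s' \<and> ?keep s' \<and> (reg s' (c # ''g'') = 0 \<longrightarrow>
                maximum_matching_rep M T H (arr s' (c # ''L'')) (arr s' (c # ''R'')))"], goal_cases)
          case 1
          show ?case
            by (rule runs_mono[OF runs_frame[OF scan_tree[OF s(1-5,7)]]])
              (use s(6) in \<open>auto simp: scan_tree_def relax_def\<close>)
        next
          case (2 s)
          let ?max = "\<lambda>s'. reg s' (c # ''g'') = 0 \<longrightarrow>
                maximum_matching_rep M T H (arr s' (c # ''L'')) (arr s' (c # ''R''))"
          show ?case
          proof (rule runs_Seq[where ?T1.0 = 5 and ?T2.0 = "60 * M + 70" and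
              R = "\<lambda>s'. base s' \<and> search s' \<and> ?keep s' \<and> ?max s' \<and> reg s' (c # ''f'') = reg s' (c # ''g'')"],
              goal_cases)
            case 1
            \<comment> \<open>\<open>g - 1\<close> is the head of its parent arc and therefore below
              \<open>K\<close>.\<close>
            have "reg s (c # ''g'') \<le> B"
            proof (cases "reg s (c # ''g'') = 0")
              case False
              with 2 obtain i where i: "i < reg s (c # ''t'')" "arr s (c # ''Q'') i = reg s (c # ''g'') - 1"
                unfolding search_def search_inv_def by auto
              with 2 have "H (arr s (c # ''P'') (reg s (c # ''g'') - 1) - 1) = reg s (c # ''g'') - 1"
                "arr s (c # ''P'') (reg s (c # ''g'') - 1) - 1 < M"
                unfolding search_def search_inv_def search_tree_def
                by (metis, metis One_nat_def Suc_le_lessD Suc_pred' less_eq_Suc_le)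
              with H_less[of "arr s (c # ''P'') (reg s (c # ''g'') - 1) - 1"] word show ?thesis by linarith
            qed simp
            then show ?case
              using 2 by (intro runs_wpI) (auto simp: base_def input_def search_def neqs)
          next
            case (2 s)
            then have s: "base s" "search s" "reg s (c # ''f'') = reg s (c # ''g'')" by blast+
            show ?case
            proof (rule runs_mono[OF runs_frame[OF augment[OF s]]], goal_cases)
              case (2 s')
              then have eq: "reg s' (c # ''s'') = st" "reg s' (c # ''g'') = reg s (c # ''g'')"
                "arr s' (c # ''V'') = arr s (c # ''V'')"
                using \<open>base s \<and> _\<close> by (simp_all add: augment_def)
              have "\<forall>w. arr s (c # ''V'') w \<le> st"
                using \<open>base s \<and> _\<close> unfolding search_def search_inv_def by metis
              moreover have "maximum_matching_rep M T H (arr s' (c # ''L'')) (arr s' (c # ''R''))"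
                if "reg s (c # ''g'') = 0"
                by (rule maximum_matching_rep_cong[of "arr s (c # ''L'')" "arr s (c # ''R'')"])
                  (use 2 that \<open>base s \<and> _\<close> in \<open>auto simp: base_def\<close>)
              ultimately show ?case
                using 2(1) \<open>base s \<and> _\<close> by (simp add: eq)
            qed simp
          qed simp
        qed simp
      qed simp
    qed simp
  qed simp
qed

text \<open>At most \<open>N\<close> phases enlarge the matching and one more certifies maximality.
  The potential counts the missing arcs plus one for a nonzero \<open>g\<close>; its sum with the
  phase number never exceeds \<open>N + 1\<close>, which keeps the stamps within a word.\<close>

lemma matching:
  assumes "input s" "arr s (c # ''F'') = (\<lambda>_. 0)" "arr s (c # ''L'') = (\<lambda>_. 0)"
    "arr s (c # ''R'') = (\<lambda>_. 0)" "arr s (c # ''V'') = (\<lambda>_. 0)" "reg s (c # ''s'') = 0"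
  shows "runs B (matching c tn hn mn) s (1000 * (N + 1) * (M + 1))
    (\<lambda>s'. maximum_matching_rep M T H (arr s' (c # ''L'')) (arr s' (c # ''R'')))"
proof -
  define I where "I v s \<longleftrightarrow> base s \<and> (\<forall>w. arr s (c # ''V'') w \<le> reg s (c # ''s'')) \<and>
     v = N - card {x. arr s (c # ''L'') x \<noteq> 0} + (if reg s (c # ''g'') = 0 then 0 else 1) \<and>
     reg s (c # ''s'') + v \<le> N + 1 \<and>
     (reg s (c # ''g'') = 0 \<longrightarrow> maximum_matching_rep M T H (arr s (c # ''L'')) (arr s (c # ''R'')))"
    for v and s :: store
  show ?thesis
    unfolding matching_def
  proof (rule runs_Seq[where ?T1.0 = "30 * M + 20" and ?T2.0 = "(N + 1) * (400 * M + 205) + 20" and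
        R = "\<lambda>s'. base s' \<and> arr s' (c # ''L'') = (\<lambda>_. 0) \<and> arr s' (c # ''V'') = (\<lambda>_. 0) \<and>
          reg s' (c # ''s'') = 0"], goal_cases)
    case 1
    show ?case
    proof (rule runs_mono[OF runs_frame[OF build_adjacency[OF assms(1,2)]]], goal_cases)
      case (2 s')
      then show ?case
        using assms by (simp add: base_def input_def build_adjacency_def neqs matching_rep_def)
    qed simp
  next
    case (2 s)
    show ?case
    proof (rule runs_Seq[where ?T1.0 = 5 and ?T2.0 = "(N + 1) * (400 * M + 205) + 10" and R = "I (N + 1)"], goal_cases)
      case 1
      show ?case
        using 2 word by (intro runs_wpI) (auto simp: I_def base_def input_def neqs)
    next
      case (2 s)
      show ?case
      proof (rule runs_WhileI[where I = I and v = "N + 1" and K = "400 * M + 200"], goal_cases)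
        case (2 v s)
        have g: "reg s (c # ''g'') \<noteq> 0" using 2(2) by simp
        have s: "base s" "\<forall>w. arr s (c # ''V'') w \<le> reg s (c # ''s'')" "reg s (c # ''s'') < B"
          and v: "v = Suc (N - card {x. arr s (c # ''L'') x \<noteq> 0})" "reg s (c # ''s'') + v \<le> N + 1"
          using 2(1) g word unfolding I_def by auto
        show ?case
        proof (rule runs_mono[OF matching_phase[OF s]], goal_cases)
          case (2 s')
          define v' where "v' = N - card {x. arr s' (c # ''L'') x \<noteq> 0} + (if reg s' (c # ''g'') = 0 then 0 else 1)"
          have "card {x. arr s' (c # ''L'') x \<noteq> 0} \<le> N"
            using 2 by (intro card_matched_le) (auto simp: base_def)
          then have "v' < v" using v(1) 2 by (simp add: v'_def)
          moreover have "I v' s'"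
            using 2 v(2) \<open>v' < v\<close> unfolding I_def v'_def[symmetric] by auto
          ultimately show ?case by blast
        qed simp
      next
        case 3
        have "(N + 1) * (1 + bcost (Less (Const 0) (Reg (c # ''g''))) + (400 * M + 200)) = (N + 1) * (400 * M + 204)"
          by simp
        also have "\<dots> \<le> (N + 1) * (400 * M + 205)" by (intro mult_le_mono2) simp
        finally show ?case by simp
      next
        case 1
        show ?case using 2 .
      next
        case (4 v s)
        then show ?case by (auto simp: I_def)
      qed
    qed simp
  next
    case 3
    show ?case by (simp add: algebra_simps)
  qed
qed

end

section \<open>Attaching 2-cycles\<close>

text \<open>A component of a digraph with in- and outdegrees at most one, in walking order: a cycle
  if an arc leads from the last vertex back to the first, otherwise a maximal path.\<close>

definition comp_of :: "('a \<times> 'a) set \<Rightarrow> 'a list \<Rightarrow> bool" where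
  "comp_of S z \<longleftrightarrow> z \<noteq> [] \<and> distinct z \<and> (\<forall>i. Suc i < length z \<longrightarrow> (z ! i, z ! Suc i) \<in> S) \<and>
     ((last z, hd z) \<in> S \<or> (\<forall>x. (x, hd z) \<notin> S) \<and> (\<forall>y. (last z, y) \<notin> S))"

text \<open>The ceiling of \<open>L / k\<close> for positive \<open>k\<close>: the number of paths
  obtained by cutting off \<open>k\<close> vertices at a time.\<close>

definition pieces :: "nat \<Rightarrow> nat \<Rightarrow> nat" where
  "pieces k L = (L + k - 1) div k"

text \<open>The second bound is where \<open>k \<ge> 7\<close> is needed: for \<open>k = 6\<close> it fails at \<open>L = 7\<close>.\<close>

lemma three_pieces:
  assumes "k \<ge> 7"
  shows "L \<le> 5 \<Longrightarrow> 3 * pieces k L \<le> 3" "L \<ge> 5 \<Longrightarrow> 3 * pieces k L + 2 \<le> L"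
proof -
  have small: "pieces k L \<le> 1" if "L \<le> k" for L
  proof -
    have "L + k - 1 < 2 * k" using that assms by simp
    then have "(L + k - 1) div k < 2" using assms by (subst div_less_iff_less_mult) auto
    then show ?thesis by (simp add: pieces_def)
  qed
  show "L \<le> 5 \<Longrightarrow> 3 * pieces k L \<le> 3" using small[of L] assms by simp
  assume L: "L \<ge> 5"
  show "3 * pieces k L + 2 \<le> L"
  proof (cases "L \<le> k")
    case True
    with small[of L] L show ?thesis by simp
  next
    case False
    define q where "q = pieces k L"
    \<comment> \<open>With \<open>k = 7 + j\<close> and \<open>L = k + 1 + l\<close> the negated
      claim becomes an inequality between polynomials in \<open>j\<close> and \<open>l\<close> whose
      larger side already has the constant term 49, against 42 on the other side.\<close>
    obtain j where j: "k = 7 + j" using assms by (metis le_iff_add)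
    obtain l where l: "L = k + 1 + l" using False by (metis Suc_eq_plus1 less_eq_Suc_le le_iff_add not_le)
    have "q * k \<le> L + k - 1" unfolding q_def pieces_def by (rule div_times_less_eq_dividend)
    then have 1: "q * (7 + j) \<le> 14 + 2 * j + l" using j l by simp
    have "\<not> 3 * q > L - 2"
    proof
      assume "3 * q > L - 2"
      then have "7 + j + l \<le> 3 * q" using j l by simp
      then have "(7 + j + l) * (7 + j) \<le> 3 * (q * (7 + j))" by (metis mult.assoc mult_le_mono1)
      also have "\<dots> \<le> 3 * (14 + 2 * j + l)" using 1 by simp
      finally show False by (simp add: algebra_simps)
    qed
    then show ?thesis using L unfolding q_def by simp
  qed
qed

text \<open>
  \<open>M\<close> is the path-cycle cover, \<open>rep\<close> numbers its 2-cycles (0 outside of them), and the 2-cycle \<open>r \<in> A\<close>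
  is attached by the arc from \<open>s r\<close> to \<open>d r\<close>, which either leaves or enters it.
\<close>

locale attachments =
  fixes V :: "'a set" and M :: "('a \<times> 'a) set" and rep :: "'a \<Rightarrow> nat"
    and A :: "nat set" and s d :: "nat \<Rightarrow> 'a"
  assumes finite_V: "finite V" and M_sub: "M \<subseteq> V \<times> V"
    and M_right: "\<And>x y y'. (x, y) \<in> M \<Longrightarrow> (x, y') \<in> M \<Longrightarrow> y = y'"
    and M_left: "\<And>x x' y. (x, y) \<in> M \<Longrightarrow> (x', y) \<in> M \<Longrightarrow> x = x'"
    and M_irrefl: "\<And>x. (x, x) \<notin> M"
    and rep_nonzero: "\<And>x. rep x \<noteq> 0 \<longleftrightarrow> (\<exists>y. (x, y) \<in> M \<and> (y, x) \<in> M)"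
    and rep_eq: "\<And>x y. rep x \<noteq> 0 \<Longrightarrow> rep x = rep y \<longleftrightarrow> x = y \<or> (x, y) \<in> M"
    and A: "finite A" "0 \<notin> A"
    and arc_V: "\<And>r. r \<in> A \<Longrightarrow> s r \<in> V \<and> d r \<in> V"
    and arc: "\<And>r. r \<in> A \<Longrightarrow> rep (s r) = r \<and> rep (d r) \<notin> A \<or> rep (d r) = r \<and> rep (s r) \<notin> A"
    and inj_d: "\<And>r r'. r \<in> A \<Longrightarrow> r' \<in> A \<Longrightarrow> rep (s r) = r \<Longrightarrow> rep (s r') = r' \<Longrightarrow> d r = d r' \<Longrightarrow> r = r'"
    and inj_s: "\<And>r r'. r \<in> A \<Longrightarrow> r' \<in> A \<Longrightarrow> rep (d r) = r \<Longrightarrow> rep (d r') = r' \<Longrightarrow> s r = s r' \<Longrightarrow> r = r'"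
begin

text \<open>Reversing all arcs exchanges leaving and entering attachments, so each fact about
  leaving ones yields its mirror image.\<close>

lemma dual: "attachments V (M\<inverse>) rep A d s"
proof
  show "M\<inverse> \<subseteq> V \<times> V" using M_sub by auto
  show "rep x \<noteq> 0 \<longleftrightarrow> (\<exists>y. (x, y) \<in> M\<inverse> \<and> (y, x) \<in> M\<inverse>)" for x using rep_nonzero by blast
  show "rep x = rep y \<longleftrightarrow> x = y \<or> (x, y) \<in> M\<inverse>" if nz: "rep x \<noteq> 0" for x y
  proof -
    obtain z where z: "(x, z) \<in> M" "(z, x) \<in> M" using nz rep_nonzero[of x] by auto
    have "(x, y) \<in> M \<longleftrightarrow> (y, x) \<in> M" using z M_left[of y x z] M_right[of x y z] by blast
    then show ?thesis using rep_eq[OF nz, of y] by simp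
  qed
  show "rep (d r) = r \<and> rep (s r) \<notin> A \<or> rep (s r) = r \<and> rep (d r) \<notin> A" if "r \<in> A" for r
    using arc[OF that] by argo
  show "d r \<in> V \<and> s r \<in> V" if "r \<in> A" for r using arc_V[OF that] by simp
  show "(x, x) \<notin> M\<inverse>" for x using M_irrefl by simp
  show "y = y'" if "(x, y) \<in> M\<inverse>" "(x, y') \<in> M\<inverse>" for x y y' using M_left that by simp
  show "x = x'" if "(x, y) \<in> M\<inverse>" "(x', y) \<in> M\<inverse>" for x x' y using M_right that by simp
  show "r = r'" if "r \<in> A" "r' \<in> A" "rep (d r) = r" "rep (d r') = r'" "s r = s r'" for r r'
    using inj_s that by simp
  show "r = r'" if "r \<in> A" "r' \<in> A" "rep (s r) = r" "rep (s r') = r'" "d r = d r'" for r r'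
    using inj_d that by simp
qed (use finite_V A in simp_all)

text \<open>The forced arcs displace exactly those arcs of \<open>M\<close> that share a tail or a
  head with one of them.\<close>

definition S where "S = {(s r, d r) | r. r \<in> A} \<union> {(x, y) \<in> M. x \<notin> s ` A \<and> y \<notin> d ` A}"

definition partner where "partner x = (SOME y. (x, y) \<in> M \<and> (y, x) \<in> M)"

text \<open>The number of the 2-cycle at the outer end of the forced arc, or 0 if that end is on no
  2-cycle.\<close>

definition host where "host r = (if rep (s r) = r then rep (d r) else rep (s r))"

lemma partner:
  assumes "rep x \<noteq> 0"
  shows "(x, partner x) \<in> M" "(partner x, x) \<in> M" "rep (partner x) = rep x" "partner x \<noteq> x"
proof -
  have "\<exists>y. (x, y) \<in> M \<and> (y, x) \<in> M" using assms rep_nonzero[of x] by simp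
  then have *: "(x, partner x) \<in> M \<and> (partner x, x) \<in> M"
    unfolding partner_def by (rule someI_ex)
  then show "(x, partner x) \<in> M" "(partner x, x) \<in> M" by simp_all
  have "rep x = rep (partner x)"
    unfolding rep_eq[OF assms, of "partner x"] using * by simp
  then show "rep (partner x) = rep x" by (rule sym)
  show "partner x \<noteq> x" using * M_irrefl[of x] by auto
qed

lemma A_pos: "r \<in> A \<Longrightarrow> 0 < r"
  using A by (cases r) auto

text \<open>Consequently an attached 2-cycle touches no forced arc except its own, and that one in a
  single vertex.\<close>

lemma s_in_A: "r \<in> A \<Longrightarrow> rep (s r) \<in> A \<Longrightarrow> rep (s r) = r \<and> rep (d r) \<notin> A"
  and d_in_A: "r \<in> A \<Longrightarrow> rep (d r) \<in> A \<Longrightarrow> rep (d r) = r \<and> rep (s r) \<notin> A"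
  using arc[of r] by argo+

text \<open>Either the common tail lies on an attached 2-cycle, whose number determines
  \<open>r\<close>, or both arcs enter their 2-cycles and \<open>inj_s\<close> applies.\<close>

lemma inj_on_s: "inj_on s A"
proof (rule inj_onI)
  fix r r' assume r: "r \<in> A" "r' \<in> A" "s r = s r'"
  show "r = r'"
  proof (cases "rep (s r) \<in> A")
    case True
    then show ?thesis using s_in_A[of r] s_in_A[of r'] r by simp
  next
    case False
    then have "rep (d r) = r" "rep (d r') = r'" using arc[of r] arc[of r'] r by auto
    then show ?thesis using inj_s r by simp
  qed
qed

lemma inj_on_d: "inj_on d A"
proof (rule inj_onI)
  fix r r' assume r: "r \<in> A" "r' \<in> A" "d r = d r'"
  show "r = r'"
  proof (cases "rep (d r) \<in> A")
    case True
    then show ?thesis using d_in_A[of r] d_in_A[of r'] r by simp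
  next
    case False
    then have "rep (s r) = r" "rep (s r') = r'" using arc[of r] arc[of r'] r by auto
    then show ?thesis using inj_d r by simp
  qed
qed

lemma arc_in_S: "r \<in> A \<Longrightarrow> (s r, d r) \<in> S"
  unfolding S_def by blast

lemma S_sub: "S \<subseteq> V \<times> V"
  using M_sub arc_V unfolding S_def by auto

lemma S_right:
  assumes "(x, y) \<in> S" "(x, y') \<in> S"
  shows "y = y'"
proof (cases "x \<in> s ` A")
  case True
  then obtain r r' where "r \<in> A" "x = s r" "y = d r" "r' \<in> A" "x = s r'" "y' = d r'"
    using assms unfolding S_def by auto
  then show ?thesis using inj_onD[OF inj_on_s, of r r'] by simp
next
  case False
  then have "(x, y) \<in> M" "(x, y') \<in> M" using assms unfolding S_def by auto
  then show ?thesis by (rule M_right)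
qed

lemma S_left:
  assumes "(x, y) \<in> S" "(x', y) \<in> S"
  shows "x = x'"
proof (cases "y \<in> d ` A")
  case True
  then obtain r r' where "r \<in> A" "x = s r" "y = d r" "r' \<in> A" "x' = s r'" "y = d r'"
    using assms unfolding S_def by auto
  then show ?thesis using inj_onD[OF inj_on_d, of r r'] by simp
next
  case False
  then have "(x, y) \<in> M" "(x', y) \<in> M" using assms unfolding S_def by auto
  then show ?thesis by (rule M_left)
qed

lemma S_irrefl: "(x, x) \<notin> S"
proof
  assume "(x, x) \<in> S"
  then obtain r where "r \<in> A" "x = s r" "x = d r"
    unfolding S_def using M_irrefl by auto
  then show False using arc[of r] by auto
qed

text \<open>The arc from \<open>s r\<close> to its partner gives way to the forced arc, whereas the
  reverse arc stays, as no other forced arc touches this 2-cycle. The partner thereby loses its only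
  predecessor and becomes the first vertex of a path.\<close>

lemma leaving:
  assumes r: "r \<in> A" "rep (s r) = r"
  shows "(partner (s r), s r) \<in> S" "(x, partner (s r)) \<notin> S"
proof -
  have r0: "rep (s r) \<noteq> 0" using r A_pos by simp
  note p = partner[OF r0]
  have d: "rep (d r) \<notin> A" using r s_in_A by auto
  have 1: "partner (s r) \<notin> s ` A"
    using p(3,4) r s_in_A by (metis imageE)
  have 2: "y \<notin> d ` A" if "rep y = r" for y
    using that r d_in_A by (metis imageE)
  show "(partner (s r), s r) \<in> S"
    using p(2) 1 2[of "s r"] r unfolding S_def by blast
  show "(x, partner (s r)) \<notin> S"
  proof
    assume "(x, partner (s r)) \<in> S"
    moreover have "partner (s r) \<notin> d ` A" using 2 p(3) r by simp
    ultimately have "(x, partner (s r)) \<in> M" "x \<notin> s ` A" unfolding S_def by auto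
    then show False using M_left[OF _ p(1)] r(1) by blast
  qed
qed

text \<open>With a single guest, the host is opened at one arc only: the forced arc displaces the
  one into \<open>d r\<close>, and the path continues from \<open>d r\<close> to its partner and
  ends there.\<close>

lemma special_leaving:
  assumes r: "r \<in> A" "rep (s r) = r" and h: "rep (d r) \<noteq> 0"
    and only: "\<And>r'. r' \<in> A \<Longrightarrow> host r' = rep (d r) \<Longrightarrow> r' = r"
  shows "(d r, partner (d r)) \<in> S" "(partner (d r), y) \<notin> S"
proof -
  note p = partner[OF h]
  have hA: "rep (d r) \<notin> A" using r s_in_A by auto
  have 1: "x \<notin> s ` A" if "rep x = rep (d r)" for x
  proof
    assume "x \<in> s ` A"
    then obtain r' where r': "r' \<in> A" "x = s r'" by blast
    then have "host r' = rep (d r)" unfolding host_def using that hA by auto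
    then show False using only[OF r'(1)] that r' r hA by auto
  qed
  have 2: "partner (d r) \<notin> d ` A"
  proof
    assume "partner (d r) \<in> d ` A"
    then obtain r' where r': "r' \<in> A" "partner (d r) = d r'" by blast
    then have "rep (d r') = rep (d r)" using p(3) by simp
    then have "host r' = rep (d r)" unfolding host_def using arc[OF r'(1)] r'(1) hA by auto
    then show False using only[OF r'(1)] r' p(4) by auto
  qed
  show "(d r, partner (d r)) \<in> S" using p(1) 1 2 unfolding S_def by blast
  show "(partner (d r), y) \<notin> S"
  proof
    assume "(partner (d r), y) \<in> S"
    then have "(partner (d r), y) \<in> M" "y \<notin> d ` A" using 1[OF p(3)] unfolding S_def by auto
    then show False using M_right[OF _ p(2)] r(1) by blast
  qed
qed

lemma S_dual: "attachments.S (M\<inverse>) A d s = S\<inverse>"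
  unfolding attachments.S_def[OF dual] S_def by auto

lemma partner_dual: "attachments.partner (M\<inverse>) = partner"
  unfolding attachments.partner_def[OF dual, abs_def] partner_def[abs_def] by (simp add: conj_commute)

lemma host_dual: "r \<in> A \<Longrightarrow> attachments.host rep d s r = host r"
  unfolding attachments.host_def[OF dual] host_def using arc by auto

lemma entering:
  assumes "r \<in> A" "rep (d r) = r"
  shows "(d r, partner (d r)) \<in> S" "(partner (d r), x) \<notin> S"
  using attachments.leaving[OF dual, of r, OF assms] unfolding S_dual partner_dual by auto

lemma special_entering:
  assumes "r \<in> A" "rep (d r) = r" "rep (s r) \<noteq> 0"
    "\<And>r'. r' \<in> A \<Longrightarrow> host r' = rep (s r) \<Longrightarrow> r' = r"
  shows "(partner (s r), s r) \<in> S" "(y, partner (s r)) \<notin> S"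
  using attachments.special_leaving[OF dual, of r] assms unfolding S_dual partner_dual
  by (auto simp: host_dual)

text \<open>The reverse of a forced arc is never in \<open>S\<close>: the end on the attached
  2-cycle already has its partner as its other neighbour, by \<open>leaving\<close> or
  \<open>entering\<close>.\<close>

lemma two_cycle_aux:
  assumes "(x, y) \<in> S" "(y, x) \<in> S"
  shows "(x, y) \<in> M"
proof (rule ccontr)
  assume "(x, y) \<notin> M"
  then obtain r where r: "r \<in> A" "x = s r" "y = d r" using assms(1) unfolding S_def by auto
  from arc[OF r(1)] show False
  proof
    assume l: "rep (s r) = r \<and> rep (d r) \<notin> A"
    then have "y = partner x" using S_left[OF assms(2)] leaving(1)[OF r(1)] l r by simp
    then show False using partner(3)[of x] l r A_pos[OF r(1)] by auto
  next
    assume e: "rep (d r) = r \<and> rep (s r) \<notin> A"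
    then have "x = partner y" using S_right[OF assms(2)] entering(1)[OF r(1)] e r by simp
    then show False using partner(3)[of y] e r A_pos[OF r(1)] by auto
  qed
qed

text \<open>A forced arc that touches a 2-cycle of \<open>S\<close> would be one of its two arcs,
  since in- and outdegrees are at most one. Both its ends would then have the same number, contrary
  to \<open>arc\<close>.\<close>

lemma two_cycle:
  assumes xy: "(x, y) \<in> S" "(y, x) \<in> S"
  shows "rep x \<noteq> 0" "rep x = rep y" "rep x \<notin> A" "rep x \<notin> host ` A"
proof -
  have M: "(x, y) \<in> M" "(y, x) \<in> M" using two_cycle_aux xy by blast+
  then show nz: "rep x \<noteq> 0" using rep_nonzero by blast
  then show eq: "rep x = rep y" using rep_eq M by blast
  have in_xy: "u = x \<or> u = y" if "rep u = rep x" for u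
    using rep_eq[OF nz, of u] that M M_right by metis
  have same: "rep (s r) = rep (d r)" if r: "r \<in> A" and rx: "rep (s r) = rep x \<or> rep (d r) = rep x" for r
  proof -
    note a = arc_in_S[OF r]
    consider "s r = x" | "s r = y" | "d r = x" | "d r = y" using rx in_xy by blast
    then show ?thesis
    proof cases
      case 1
      then have "d r = y" using S_right[OF a] xy by simp
      with 1 eq show ?thesis by simp
    next
      case 2
      then have "d r = x" using S_right[OF a] xy by simp
      with 2 eq show ?thesis by simp
    next
      case 3
      then have "s r = y" using S_left[OF a] xy by simp
      with 3 eq show ?thesis by simp
    next
      case 4
      then have "s r = x" using S_left[OF a] xy by simp
      with 4 eq show ?thesis by simp
    qed
  qed
  show "rep x \<notin> A"
  proof
    assume "rep x \<in> A"
    from this arc[OF this] same[OF this] show False by auto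
  qed
  show "rep x \<notin> host ` A"
  proof
    assume "rep x \<in> host ` A"
    then obtain r where "r \<in> A" "host r = rep x" by auto
    from this(1) arc[OF this(1)] same[OF this(1)] this(2) show False
      by (cases "rep (s r) = r") (simp_all add: host_def)
  qed
qed

text \<open>Each forced arc displaces at most one arc at its tail and one at its head, and replaces
  them by itself.\<close>

lemma card_S: "card M \<le> card S + card A"
proof -
  have fM: "finite M" by (rule finite_subset[OF M_sub]) (simp add: finite_V)
  let ?F = "(\<lambda>r. (s r, d r)) ` A" and ?R = "{e \<in> M. fst e \<notin> s ` A \<and> snd e \<notin> d ` A}"
  have S: "S = ?F \<union> ?R" unfolding S_def by auto
  have "card ?F = card A"
    by (rule card_image) (use inj_on_s in \<open>auto simp: inj_on_def\<close>)
  moreover have "card S = card ?F + card ?R"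
    unfolding S
  proof (rule card_Un_disjoint)
    show "?F \<inter> ?R = {}" by auto
  qed (use A fM in simp_all)
  moreover have "card M \<le> card ?R + card {e \<in> M. fst e \<in> s ` A} + card {e \<in> M. snd e \<in> d ` A}"
  proof -
    have "card M = card (?R \<union> {e \<in> M. fst e \<in> s ` A} \<union> {e \<in> M. snd e \<in> d ` A})"
      by (rule arg_cong[of _ _ card], rule set_eqI) (simp, satx)
    then show ?thesis
      using card_Un_le[of "?R \<union> {e \<in> M. fst e \<in> s ` A}" "{e \<in> M. snd e \<in> d ` A}"]
        card_Un_le[of ?R "{e \<in> M. fst e \<in> s ` A}"] by linarith
  qed
  moreover have "card {e \<in> M. fst e \<in> s ` A} \<le> card (s ` A)"
    by (rule card_inj_on_le[of fst]) (use A M_right in \<open>fastforce simp: inj_on_def\<close>)+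
  moreover have "card {e \<in> M. snd e \<in> d ` A} \<le> card (d ` A)"
    by (rule card_inj_on_le[of snd]) (use A M_left in \<open>auto simp: inj_on_def\<close>)
  moreover have "card (s ` A) \<le> card A" "card (d ` A) \<le> card A" using A card_image_le by auto
  ultimately show ?thesis by linarith
qed


section \<open>Where attached 2-cycles lie within the components\<close>

definition open_comp where
  "open_comp z \<longleftrightarrow> (\<forall>x. (x, hd z) \<notin> S) \<and> (\<forall>y. (last z, y) \<notin> S)"

lemma comp_arc: "comp_of S z \<Longrightarrow> Suc i < length z \<Longrightarrow> (z ! i, z ! Suc i) \<in> S"
  unfolding comp_of_def by blast

lemma comp_next:
  assumes z: "comp_of S z" "open_comp z" and i: "i < length z" "(z ! i, y) \<in> S"
  shows "Suc i < length z" "z ! Suc i = y"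
proof -
  have "z \<noteq> []" using z(1) unfolding comp_of_def by blast
  show 1: "Suc i < length z"
  proof (rule ccontr)
    assume "\<not> Suc i < length z"
    then have "i = length z - 1" using i(1) by simp
    then have "z ! i = last z" using \<open>z \<noteq> []\<close> by (simp add: last_conv_nth)
    then show False using i(2) z(2) unfolding open_comp_def by simp
  qed
  show "z ! Suc i = y" using S_right[OF comp_arc[OF z(1) 1] i(2)] .
qed

lemma comp_previous:
  assumes z: "comp_of S z" "open_comp z" and i: "i < length z" "(y, z ! i) \<in> S"
  shows "0 < i" "z ! (i - 1) = y"
proof -
  have "z \<noteq> []" using z(1) unfolding comp_of_def by blast
  show 1: "0 < i"
  proof (rule ccontr)
    assume "\<not> 0 < i"
    then have "z ! i = hd z" using \<open>z \<noteq> []\<close> by (simp add: hd_conv_nth)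
    then show False using i(2) z(2) unfolding open_comp_def by simp
  qed
  show "z ! (i - 1) = y" using S_left[OF comp_arc[OF z(1), of "i - 1"]] 1 i by simp
qed

definition starts_with where
  "starts_with z r \<longleftrightarrow> r \<in> A \<and> rep (s r) = r \<and> open_comp z \<and> hd z = partner (s r)"

definition ends_with where
  "ends_with z r \<longleftrightarrow> r \<in> A \<and> rep (d r) = r \<and> open_comp z \<and> last z = partner (d r)"

text \<open>Successors are unique, so the component has to follow the surviving arc of the 2-cycle
  and then the forced arc.\<close>

lemma starts_with:
  assumes z: "comp_of S z" and r: "starts_with z r"
  shows "2 < length z" "z ! 0 = partner (s r)" "z ! 1 = s r" "z ! 2 = d r" "rep (hd z) = r"
proof -
  have r': "r \<in> A" "rep (s r) = r" "open_comp z" "hd z = partner (s r)"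
    using r unfolding starts_with_def by blast+
  have z0: "z \<noteq> []" using z unfolding comp_of_def by blast
  show 0: "z ! 0 = partner (s r)" using r'(4) z0 by (simp add: hd_conv_nth)
  have l0: "0 < length z" using z0 by simp
  note c = comp_next[OF z r'(3)]
  have "(z ! 0, s r) \<in> S" using leaving(1)[OF r'(1,2)] 0 by simp
  note 1 = c[OF l0 this]
  then show z1: "z ! 1 = s r" by simp
  have "(z ! Suc 0, d r) \<in> S" using arc_in_S[OF r'(1)] z1 by simp
  note 2 = c[OF 1(1) this]
  then show "2 < length z" "z ! 2 = d r" by (simp_all add: numeral_2_eq_2)
  have "rep (s r) \<noteq> 0" using A_pos[OF r'(1)] r'(2) by simp
  from partner(3)[OF this] show "rep (hd z) = r" using r' by simp
qed

lemma ends_with: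
  assumes z: "comp_of S z" and r: "ends_with z r"
  shows "2 < length z" "z ! (length z - 1) = partner (d r)" "z ! (length z - 2) = d r"
    "z ! (length z - 3) = s r" "rep (last z) = r"
proof -
  have r': "r \<in> A" "rep (d r) = r" "open_comp z" "last z = partner (d r)"
    using r unfolding ends_with_def by blast+
  have z0: "z \<noteq> []" using z unfolding comp_of_def by blast
  show 0: "z ! (length z - 1) = partner (d r)" using r'(4) z0 by (simp add: last_conv_nth)
  have l0: "length z - 1 < length z" using z0 by simp
  note c = comp_previous[OF z r'(3)]
  have "(d r, z ! (length z - 1)) \<in> S" using entering(1)[OF r'(1,2)] 0 by simp
  note 1 = c[OF l0 this]
  then show z1: "z ! (length z - 2) = d r" by (simp add: numeral_2_eq_2)
  have "(s r, z ! (length z - 2)) \<in> S" using arc_in_S[OF r'(1)] z1 by simp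
  moreover have "length z - 2 < length z" using z0 by simp
  ultimately have 2: "0 < length z - 2" "z ! (length z - 2 - 1) = s r" using c by blast+
  then show "2 < length z" "z ! (length z - 3) = s r" by (simp_all add: numeral_3_eq_3 numeral_2_eq_2)
  have "rep (d r) \<noteq> 0" using A_pos[OF r'(1)] r'(2) by simp
  from partner(3)[OF this] show "rep (last z) = r" using r' by simp
qed

text \<open>With three vertices the middle one would belong to both 2-cycles; with four, the two
  middle ones would be joined by an arc forced for both. Either way a forced arc would have both
  ends on attached 2-cycles.\<close>

lemma starts_and_ends:
  assumes z: "comp_of S z" and "starts_with z r" "ends_with z r'"
  shows "5 \<le> length z"
proof (rule ccontr)
  note a = starts_with[OF z assms(2)] and b = ends_with[OF z assms(3)]
  have r: "r \<in> A" "rep (s r) = r" "r' \<in> A" "rep (d r') = r'"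
    using assms unfolding starts_with_def ends_with_def by blast+
  assume "\<not> 5 \<le> length z"
  with a(1) have "length z = 3 \<or> length z = 4" by linarith
  then show False
  proof
    assume "length z = 3"
    then have "s r = d r'" using a(3) b(3) by simp
    then have "r = r'" "rep (d r) \<in> A" using r by auto
    then show False using s_in_A[of r] r by simp
  next
    assume "length z = 4"
    then have "s r = s r'" using a(3) b(4) by simp
    then show False using d_in_A[of r'] r by simp
  qed
qed

text \<open>After the guest and the vertex \<open>d r\<close> only the partner of \<open>d r\<close>
  follows. Such a path costs 3 units while \<open>4 + 2 - 2\<close> are at its disposal; this
  surplus of 1 is counted by \<open>Sp\<close> in \<open>pieces_bound\<close>.\<close>

lemma special_starts:
  assumes z: "comp_of S z" and r: "starts_with z r" and h: "host r \<noteq> 0"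
    and only: "\<And>r'. r' \<in> A \<Longrightarrow> host r' = host r \<Longrightarrow> r' = r"
  shows "length z = 4"
proof -
  have r': "r \<in> A" "rep (s r) = r" "open_comp z"
    using r unfolding starts_with_def by blast+
  have hr: "host r = rep (d r)" using r' unfolding host_def by simp
  note a = starts_with[OF z r]
  note sp = special_leaving[OF r'(1,2) h[unfolded hr] only[unfolded hr]]
  have "(z ! 2, partner (d r)) \<in> S" using sp(1) a(4) by simp
  from comp_next[OF z r'(3) a(1) this]
  have 3: "3 < length z" "z ! 3 = partner (d r)" by (simp_all add: numeral_3_eq_3 numeral_2_eq_2)
  have "\<not> Suc 3 < length z"
  proof
    assume "Suc 3 < length z"
    from comp_arc[OF z this] sp(2) 3 show False by simp
  qed
  with 3 show ?thesis by simp
qed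

lemma special_ends:
  assumes z: "comp_of S z" and r: "ends_with z r" and h: "host r \<noteq> 0"
    and only: "\<And>r'. r' \<in> A \<Longrightarrow> host r' = host r \<Longrightarrow> r' = r"
  shows "length z = 4"
proof -
  have r': "r \<in> A" "rep (d r) = r" "open_comp z"
    using r unfolding ends_with_def by blast+
  have hr: "host r = rep (s r)" using r' d_in_A[of r] s_in_A[of r] unfolding host_def by auto
  note a = ends_with[OF z r]
  note sp = special_entering[OF r'(1,2) h[unfolded hr] only[unfolded hr]]
  have "(partner (s r), z ! (length z - 3)) \<in> S" using sp(1) a(4) by simp
  moreover have "length z - 3 < length z" using a(1) by simp
  ultimately have 3: "0 < length z - 3" "z ! (length z - 3 - 1) = partner (s r)"
    using comp_previous[OF z r'(3)] by blast+
  have "\<not> 0 < length z - 4"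
  proof
    assume l: "0 < length z - 4"
    then have "Suc (length z - 5) < length z" "Suc (length z - 5) = length z - 3 - 1" by auto
    then have "(z ! (length z - 5), partner (s r)) \<in> S" using comp_arc[OF z, of "length z - 5"] 3 by simp
    then show False using sp(2) by blast
  qed
  with 3 show ?thesis by simp
qed


section \<open>Summation over all components\<close>

lemma sum_indicator: "finite Z \<Longrightarrow> X \<subseteq> Z \<Longrightarrow> (\<Sum>z\<in>Z. if z \<in> X then c else 0) = c * card X"
  for c :: nat
  by (simp add: sum.inter_restrict[symmetric] inf.absorb2)

lemma comp_starting_at:
  assumes Z: "\<And>z. z \<in> Z \<Longrightarrow> comp_of S z" "(\<Union>z\<in>Z. set z) = V"
    and v: "v \<in> V" "\<And>x. (x, v) \<notin> S"
  obtains z where "z \<in> Z" "open_comp z" "hd z = v"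
proof -
  obtain z where z: "z \<in> Z" "v \<in> set z" using Z(2) v(1) by blast
  then obtain i where i: "i < length z" "z ! i = v" by (auto simp: in_set_conv_nth)
  have c: "comp_of S z" using Z(1) z(1) .
  have "i = 0"
  proof (rule ccontr)
    assume "i \<noteq> 0"
    then show False using comp_arc[OF c, of "i - 1"] i v(2) by simp
  qed
  then have hd: "hd z = v" using i by (simp add: hd_conv_nth)
  moreover have "open_comp z"
    using c v(2) hd unfolding comp_of_def open_comp_def by blast
  ultimately show ?thesis using that z(1) by blast
qed

lemma comp_ending_at:
  assumes Z: "\<And>z. z \<in> Z \<Longrightarrow> comp_of S z" "(\<Union>z\<in>Z. set z) = V"
    and v: "v \<in> V" "\<And>x. (v, x) \<notin> S"
  obtains z where "z \<in> Z" "open_comp z" "last z = v"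
proof -
  obtain z where z: "z \<in> Z" "v \<in> set z" using Z(2) v(1) by blast
  then obtain i where i: "i < length z" "z ! i = v" by (auto simp: in_set_conv_nth)
  have c: "comp_of S z" using Z(1) z(1) .
  have "\<not> Suc i < length z" using comp_arc[OF c, of i] i v(2) by auto
  then have "i = length z - 1" using i by simp
  moreover have "z \<noteq> []" using i(1) by auto
  ultimately have last: "last z = v" using i(2) by (simp add: last_conv_nth)
  moreover have "open_comp z"
    using c v(2) last unfolding comp_of_def open_comp_def by blast
  ultimately show ?thesis using that z(1) by blast
qed

text \<open>
  An attached 2-cycle lies at the beginning or at the end of an open component; hence a component has
  order at least 3 with one attached 2-cycle and at least 5 with two, which compensates for the term 2 per 2-cycle.
\<close>

lemma comp_bound:
  assumes k: "k \<ge> 7" and z: "comp_of S z"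
  shows "3 * pieces k (length z) + (if \<exists>r. starts_with z r then 2 else 0) +
      (if \<exists>r. ends_with z r then 2 else 0) +
      (if length z = 4 \<and> ((\<exists>r. starts_with z r) \<or> (\<exists>r. ends_with z r)) then 1 else 0)
    \<le> length z + (if open_comp z then 2 else 0) + (if \<not> open_comp z \<and> length z = 2 then 1 else 0)"
proof -
  note p = three_pieces[OF k, of "length z"]
  have z0: "z \<noteq> []" using z unfolding comp_of_def by blast
  show ?thesis
  proof (cases "open_comp z")
    case True
    show ?thesis
    \<comment> \<open>The tight cases of a path with attached ends: order 3 with one such end
      (\<open>3 + 2 = 3 + 2\<close>), order 4 with one (\<open>3 + 2 + 1 = 4 + 2\<close>) and order
      5 with two (\<open>3 + 2 + 2 = 5 + 2\<close>).\<close>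
    proof (cases "length z \<ge> 5")
      case True
      then show ?thesis using p(2) \<open>open_comp z\<close> by simp
    next
      case False
      then have p3: "3 * pieces k (length z) \<le> 3" using p(1) by simp
      show ?thesis
      proof (cases "(\<exists>r. starts_with z r) \<or> (\<exists>r. ends_with z r)")
        case True
        then have "2 < length z" using starts_with(1)[OF z] ends_with(1)[OF z] by blast
        then have "length z = 3 \<or> length z = 4" using False by linarith
        moreover have "\<not> ((\<exists>r. starts_with z r) \<and> (\<exists>r. ends_with z r))"
          using starts_and_ends[OF z] False by blast
        moreover define b c where "b = (\<exists>r. starts_with z r)" and "c = (\<exists>r. ends_with z r)"
        ultimately show ?thesis using p3 \<open>open_comp z\<close> True
          unfolding b_def[symmetric] c_def[symmetric] by (cases b; cases c) auto
      next
        case False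
        then show ?thesis using p3 \<open>open_comp z\<close> z0 by (cases z) auto
      qed
    qed
  next
    case False
    then have no: "\<not> starts_with z r" "\<not> ends_with z r" for r
      unfolding starts_with_def ends_with_def by blast+
    have "(last z, hd z) \<in> S" using False z unfolding comp_of_def open_comp_def by blast
    then have "length z \<noteq> 1" using S_irrefl by (cases z) auto
    moreover have "length z \<noteq> 0" using z0 by simp
    ultimately have "length z = 2 \<or> 3 \<le> length z \<and> length z \<le> 5 \<or> 5 \<le> length z"
      by linarith
    then show ?thesis using p False no by auto
  qed
qed

text \<open>Summing \<open>comp_bound\<close> leaves \<open>2 * card P\<close> on the right and a
  refund of at least \<open>2 * card A\<close> on the left. Since
  \<open>card P <= card V - card S\<close> and \<open>card_S\<close> loses at most
  \<open>card A\<close> arcs, the two occurrences of \<open>2 * card A\<close> cancel.\<close>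

lemma pieces_bound:
  assumes k: "k \<ge> 7" and fin: "finite Z" and Z: "\<And>z. z \<in> Z \<Longrightarrow> comp_of S z" "(\<Union>z\<in>Z. set z) = V"
    and disj: "\<And>z z' x. z \<in> Z \<Longrightarrow> z' \<in> Z \<Longrightarrow> x \<in> set z \<Longrightarrow> x \<in> set z' \<Longrightarrow> z = z'"
    and Sp: "Sp \<subseteq> A" "\<And>r. r \<in> Sp \<Longrightarrow> host r \<noteq> 0"
      "\<And>r r'. r \<in> Sp \<Longrightarrow> r' \<in> A \<Longrightarrow> host r' = host r \<Longrightarrow> r' = r"
    and U: "finite U" "\<And>x. rep x \<noteq> 0 \<Longrightarrow> rep x \<notin> A \<Longrightarrow> rep x \<notin> host ` A \<Longrightarrow> rep x \<in> U"
  shows "3 * (\<Sum>z\<in>Z. pieces k (length z)) + card Sp + 2 * card M \<le> 3 * card V + card U"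
proof -
  have ne: "z \<noteq> []" and dz: "distinct z" if "z \<in> Z" for z using Z(1)[OF that] unfolding comp_of_def by blast+
  define P where "P = {z \<in> Z. open_comp z}"
  define Y where "Y = {z \<in> Z. \<not> open_comp z \<and> length z = 2}"
  define Gi where "Gi = {z \<in> Z. \<exists>r. starts_with z r}"
  define Go where "Go = {z \<in> Z. \<exists>r. ends_with z r}"
  define T where "T = {z \<in> Z. length z = 4 \<and> ((\<exists>r. starts_with z r) \<or> (\<exists>r. ends_with z r))}"
  have finites: "finite P" "finite Y" "finite Gi" "finite Go" "finite T"
    using fin unfolding P_def Y_def Gi_def Go_def T_def by simp_all
  have "(\<Sum>z\<in>Z. 3 * pieces k (length z) + (if z \<in> Gi then 2 else 0) + (if z \<in> Go then 2 else 0) + (if z \<in> T then 1 else 0))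
    \<le> (\<Sum>z\<in>Z. length z + (if z \<in> P then 2 else 0) + (if z \<in> Y then 1 else 0))"
  proof (rule sum_mono)
    fix z assume z: "z \<in> Z"
    show "3 * pieces k (length z) + (if z \<in> Gi then 2 else 0) + (if z \<in> Go then 2 else 0) + (if z \<in> T then 1 else 0)
       \<le> length z + (if z \<in> P then 2 else 0) + (if z \<in> Y then 1 else 0)"
      using comp_bound[OF k Z(1)[OF z]] z unfolding P_def Y_def Gi_def Go_def T_def by simp
  qed
  moreover have "Gi \<subseteq> Z" "Go \<subseteq> Z" "T \<subseteq> Z" "P \<subseteq> Z" "Y \<subseteq> Z"
    unfolding P_def Y_def Gi_def Go_def T_def by auto
  moreover have "(\<Sum>z\<in>Z. length z) = card V"
  proof -
    have "card V = (\<Sum>z\<in>Z. card (set z))"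
      unfolding Z(2)[symmetric] by (rule card_UN_disjoint) (use fin disj in auto)
    also have "\<dots> = (\<Sum>z\<in>Z. length z)" by (intro sum.cong refl distinct_card dz)
    finally show ?thesis ..
  qed
  ultimately have main: "3 * (\<Sum>z\<in>Z. pieces k (length z)) + 2 * card Gi + 2 * card Go + card T
      \<le> card V + 2 * card P + card Y"
    by (simp only: sum.distrib sum_distrib_left[symmetric] sum_indicator[OF fin] mult_1)
  have start: "\<exists>z\<in>Gi. starts_with z r" if r: "r \<in> A" "rep (s r) = r" for r
  proof -
    have "partner (s r) \<in> V" using S_sub leaving(1)[OF r] by blast
    then obtain z where "z \<in> Z" "open_comp z" "hd z = partner (s r)"
      using comp_starting_at[of Z "partner (s r)", OF Z _ leaving(2)[OF r]] by blast
    then show ?thesis using r unfolding Gi_def starts_with_def by blast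
  qed
  have "finish": "\<exists>z\<in>Go. ends_with z r" if r: "r \<in> A" "rep (d r) = r" for r
  proof -
    have "partner (d r) \<in> V" using S_sub entering(1)[OF r] by blast
    then obtain z where "z \<in> Z" "open_comp z" "last z = partner (d r)"
      using comp_ending_at[of Z "partner (d r)", OF Z _ entering(2)[OF r]] by blast
    then show ?thesis using r unfolding Go_def ends_with_def by blast
  qed
  have "{r \<in> A. rep (s r) = r} \<subseteq> (\<lambda>z. rep (hd z)) ` Gi"
  proof
    fix r assume "r \<in> {r \<in> A. rep (s r) = r}"
    then obtain z where z: "z \<in> Gi" "starts_with z r" using start by blast
    then have "rep (hd z) = r" using starts_with(5)[OF Z(1)] unfolding Gi_def by blast
    with z(1) show "r \<in> (\<lambda>z. rep (hd z)) ` Gi" by blast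
  qed
  then have Gi: "card {r \<in> A. rep (s r) = r} \<le> card Gi" using surj_card_le finites by blast
  have "{r \<in> A. rep (d r) = r} \<subseteq> (\<lambda>z. rep (last z)) ` Go"
  proof
    fix r assume "r \<in> {r \<in> A. rep (d r) = r}"
    then obtain z where z: "z \<in> Go" "ends_with z r" using "finish" by blast
    then have "rep (last z) = r" using ends_with(5)[OF Z(1)] unfolding Go_def by blast
    with z(1) show "r \<in> (\<lambda>z. rep (last z)) ` Go" by blast
  qed
  then have Go: "card {r \<in> A. rep (d r) = r} \<le> card Go" using surj_card_le finites by blast
  have "card A = card ({r \<in> A. rep (s r) = r} \<union> {r \<in> A. rep (d r) = r})"
    by (rule arg_cong[of _ _ card]) (use arc in blast)
  then have AG: "card A \<le> card Gi + card Go"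
    using card_Un_le[of "{r \<in> A. rep (s r) = r}" "{r \<in> A. rep (d r) = r}"] Gi Go by linarith
  \<comment> \<open>A component of order 4 cannot have attached 2-cycles at both ends, so the
    attached 2-cycle can be read off from the component, and different members of \<open>Sp\<close>
    need different components.\<close>
  have "Sp \<subseteq> (\<lambda>z. if \<exists>r. starts_with z r then rep (hd z) else rep (last z)) ` T"
  proof
    fix r assume r: "r \<in> Sp"
    then have rA: "r \<in> A" using Sp(1) by blast
    show "r \<in> (\<lambda>z. if \<exists>r. starts_with z r then rep (hd z) else rep (last z)) ` T"
    proof (cases "rep (s r) = r")
      case True
      then obtain z where z: "z \<in> Z" "starts_with z r" using start[OF rA] unfolding Gi_def by blast
      then have "z \<in> T" using special_starts[OF Z(1) z(2) Sp(2)[OF r] Sp(3)[OF r]] unfolding T_def by blast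
      moreover have "rep (hd z) = r" using starts_with(5)[OF Z(1) z(2)] z(1) by blast
      ultimately show ?thesis using z(2) by (intro image_eqI[of _ _ z]) auto
    next
      case False
      then have "rep (d r) = r" using arc[OF rA] by blast
      then obtain z where z: "z \<in> Z" "ends_with z r" using "finish"[OF rA] unfolding Go_def by blast
      then have 4: "length z = 4" using special_ends[OF Z(1) z(2) Sp(2)[OF r] Sp(3)[OF r]] by blast
      then have "z \<in> T" using z unfolding T_def by blast
      moreover have "\<not> starts_with z r'" for r' using starts_and_ends[OF Z(1)[OF z(1)] _ z(2), of r'] 4 by auto
      moreover have "rep (last z) = r" using ends_with(5)[OF Z(1) z(2)] z(1) by blast
      ultimately show ?thesis by (intro image_eqI[of _ _ z]) auto
    qed
  qed
  then have ST: "card Sp \<le> card T" using surj_card_le finites by blast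
  \<comment> \<open>The first vertices of the path components have no predecessor, whereas the heads
    of the arcs of \<open>S\<close> have one.\<close>
  have PS: "card P + card S \<le> card V"
  proof -
    have "inj_on hd P"
    proof (rule inj_onI)
      fix z z' assume "z \<in> P" "z' \<in> P" "hd z = hd z'"
      then show "z = z'"
        using disj[of z z' "hd z"] hd_in_set[OF ne[of z]] hd_in_set[OF ne[of z']] unfolding P_def by simp
    qed
    then have "card P = card (hd ` P)" by (simp add: card_image)
    moreover have "card S = card (snd ` S)"
      by (rule card_image[symmetric], rule inj_onI) (metis S_left prod.collapse)
    moreover have "card (hd ` P) + card (snd ` S) = card (hd ` P \<union> snd ` S)"
    proof (rule card_Un_disjoint[symmetric])
      show "finite (snd ` S)" by (rule finite_subset[of _ V]) (use S_sub finite_V in auto)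
      show "hd ` P \<inter> snd ` S = {}" unfolding P_def open_comp_def by force
    qed (use finites in simp)
    moreover have "card (hd ` P \<union> snd ` S) \<le> card V"
    proof (rule card_mono[OF finite_V])
      have "hd ` P \<subseteq> V" using Z(2) ne unfolding P_def by fastforce
      then show "hd ` P \<union> snd ` S \<subseteq> V" using S_sub by auto
    qed
    ultimately show ?thesis by simp
  qed
  \<comment> \<open>The number of a surviving 2-cycle identifies it, as both its arcs belong to
    \<open>M\<close>.\<close>
  have YU: "card Y \<le> card U"
  proof (rule card_inj_on_le[of "\<lambda>z. rep (hd z)"])
    have arcs: "(hd z, last z) \<in> S" "(last z, hd z) \<in> S" "set z = {hd z, last z}" if z: "z \<in> Y" for z
    proof -
      have c: "comp_of S z" "\<not> open_comp z" "length z = 2" using z Z(1) unfolding Y_def by blast+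
      then obtain x y where xy: "z = [x, y]" by (auto simp: numeral_2_eq_2 length_Suc_conv)
      then show "(hd z, last z) \<in> S" "set z = {hd z, last z}" using comp_arc[OF c(1), of 0] by simp_all
      show "(last z, hd z) \<in> S" using c unfolding comp_of_def open_comp_def by blast
    qed
    show "inj_on (\<lambda>z. rep (hd z)) Y"
    proof (rule inj_onI)
      fix z z' assume z: "z \<in> Y" "z' \<in> Y" and eq: "rep (hd z) = rep (hd z')"
      have "(hd z, last z) \<in> M" by (rule two_cycle_aux[OF arcs(1,2)[OF z(1)]])
      moreover have "hd z = hd z' \<or> (hd z, hd z') \<in> M"
        using rep_eq[OF two_cycle(1)[OF arcs(1,2)[OF z(1)]], of "hd z'"] eq by simp
      ultimately have "hd z' = hd z \<or> hd z' = last z" using M_right[of "hd z" "hd z'" "last z"] by auto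
      then have "hd z' \<in> set z" unfolding arcs(3)[OF z(1)] by blast
      moreover have "hd z' \<in> set z'" unfolding arcs(3)[OF z(2)] by blast
      moreover have "z \<in> Z" "z' \<in> Z" using z unfolding Y_def by blast+
      ultimately show "z = z'" using disj by blast
    qed
    show "(\<lambda>z. rep (hd z)) ` Y \<subseteq> U"
    proof
      fix r assume "r \<in> (\<lambda>z. rep (hd z)) ` Y"
      then obtain z where "z \<in> Y" "r = rep (hd z)" by blast
      then show "r \<in> U" using U(2)[of "hd z"] two_cycle[OF arcs(1,2)[of z]] by simp
    qed
  qed (rule U(1))
  show ?thesis using main AG ST PS YU card_S by linarith
qed

end

section \<open>Lower bounds on an optimal partition\<close>

text \<open>A \<open>k\<close>-path partition in terms of bare vertex and arc sets, which separates
  the counting from the graph library.\<close>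

locale path_system =
  fixes V :: "'a set" and E :: "('a \<times> 'a) set" and k :: nat and Q :: "'a list set"
  assumes finite_V: "finite V"
    and path: "\<And>p. p \<in> Q \<Longrightarrow> p \<noteq> [] \<and> distinct p \<and> length p \<le> k"
    and path_arc: "\<And>p i. p \<in> Q \<Longrightarrow> Suc i < length p \<Longrightarrow> (p ! i, p ! Suc i) \<in> E"
    and disjoint: "\<And>p p' x. p \<in> Q \<Longrightarrow> p' \<in> Q \<Longrightarrow> x \<in> set p \<Longrightarrow> x \<in> set p' \<Longrightarrow> p = p'"
    and cover: "(\<Union>p\<in>Q. set p) = V"
begin

lemma finite_Q: "finite Q"
proof (rule finite_subset)
  show "Q \<subseteq> {p. set p \<subseteq> V \<and> length p \<le> k}" using path cover by blast
qed (rule finite_lists_length_le[OF finite_V])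

definition arcs where "arcs = {(p ! i, p ! Suc i) | p i. p \<in> Q \<and> Suc i < length p}"

lemma arcs_sub: "arcs \<subseteq> E"
  unfolding arcs_def using path_arc by blast

lemma arcs_V: "arcs \<subseteq> V \<times> V"
proof
  fix e assume "e \<in> arcs"
  then obtain p i where "p \<in> Q" "Suc i < length p" "e = (p ! i, p ! Suc i)" unfolding arcs_def by blast
  then show "e \<in> V \<times> V" using cover nth_mem[of i p] nth_mem[of "Suc i" p] by auto
qed

lemma arcs_right:
  assumes "(x, y) \<in> arcs" "(x, y') \<in> arcs"
  shows "y = y'"
proof -
  obtain p i where 1: "p \<in> Q" "Suc i < length p" "x = p ! i" "y = p ! Suc i"
    using assms(1) unfolding arcs_def by blast
  obtain p' i' where 2: "p' \<in> Q" "Suc i' < length p'" "x = p' ! i'" "y' = p' ! Suc i'"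
    using assms(2) unfolding arcs_def by blast
  have "p = p'" using disjoint[OF 1(1) 2(1), of x] 1 2 nth_mem[of i p] nth_mem[of i' p'] by simp
  then have "i = i'" using nth_eq_iff_index_eq[of p i i'] path[OF 1(1)] 1 2 by simp
  with \<open>p = p'\<close> 1 2 show ?thesis by simp
qed

lemma arcs_left:
  assumes "(x, y) \<in> arcs" "(x', y) \<in> arcs"
  shows "x = x'"
proof -
  obtain p i where 1: "p \<in> Q" "Suc i < length p" "x = p ! i" "y = p ! Suc i"
    using assms(1) unfolding arcs_def by blast
  obtain p' i' where 2: "p' \<in> Q" "Suc i' < length p'" "x' = p' ! i'" "y = p' ! Suc i'"
    using assms(2) unfolding arcs_def by blast
  have "p = p'" using disjoint[OF 1(1) 2(1), of y] 1 2 nth_mem[of "Suc i" p] nth_mem[of "Suc i'" p'] by simp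
  then have "Suc i = Suc i'" using nth_eq_iff_index_eq[of p "Suc i" "Suc i'"] path[OF 1(1)] 1 2 by simp
  with \<open>p = p'\<close> 1 2 show ?thesis by simp
qed

text \<open>Every vertex is the first one of its path or the head of an arc of that path.\<close>

lemma card_V_le: "card V \<le> card arcs + card Q"
proof -
  have fin: "finite arcs" by (rule finite_subset[OF arcs_V]) (simp add: finite_V)
  have "V \<subseteq> hd ` Q \<union> snd ` arcs"
  proof
    fix v assume "v \<in> V"
    then obtain p i where p: "p \<in> Q" "i < length p" "v = p ! i"
      using cover by (metis UN_E in_set_conv_nth)
    show "v \<in> hd ` Q \<union> snd ` arcs"
    proof (cases i)
      case 0
      then have "v = hd p" using p by (simp add: hd_conv_nth)
      with p show ?thesis by blast
    next
      case (Suc j)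
      then have "(p ! j, v) \<in> arcs" using p unfolding arcs_def by blast
      then show ?thesis by force
    qed
  qed
  then have "card V \<le> card (hd ` Q \<union> snd ` arcs)" by (rule card_mono[rotated]) (simp add: finite_Q fin)
  also have "\<dots> \<le> card (hd ` Q) + card (snd ` arcs)" by (rule card_Un_le)
  also have "\<dots> \<le> card Q + card arcs" by (intro add_mono card_image_le finite_Q fin)
  finally show ?thesis by simp
qed

lemma maximum_matching_bound:
  fixes m c :: nat
  assumes E: "E = (\<lambda>j. (T j, H j)) ` {..<m}" and inj: "inj_on (\<lambda>j. (T j, H j)) {..<m}"
    and max: "\<And>N. N \<subseteq> {..<m} \<Longrightarrow> inj_on T N \<Longrightarrow> inj_on H N \<Longrightarrow> card N \<le> c"
  shows "card V \<le> c + card Q"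
proof -
  let ?N = "{j. j < m \<and> (T j, H j) \<in> arcs}"
  have "inj_on T ?N"
  proof (rule inj_onI)
    fix i j assume ij: "i \<in> ?N" "j \<in> ?N" "T i = T j"
    then have "H i = H j" using arcs_right[of "T i" "H i" "H j"] by simp
    with ij show "i = j" using inj_onD[OF inj, of i j] by simp
  qed
  moreover have "inj_on H ?N"
  proof (rule inj_onI)
    fix i j assume ij: "i \<in> ?N" "j \<in> ?N" "H i = H j"
    then have "T i = T j" using arcs_left[of "T i" "H i" "T j"] by simp
    with ij show "i = j" using inj_onD[OF inj, of i j] by simp
  qed
  ultimately have c: "card ?N \<le> c" using max[of ?N] by auto
  have "arcs = (\<lambda>j. (T j, H j)) ` ?N" using arcs_sub unfolding E by auto
  moreover have "finite ?N" by (rule finite_subset[of _ "{..<m}"]) auto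
  ultimately have "card arcs \<le> card ?N" using card_image_le[of ?N "\<lambda>j. (T j, H j)"] by metis
  with c show ?thesis using card_V_le by simp
qed

definition isolated :: "('a \<Rightarrow> nat) \<Rightarrow> nat set" where
  "isolated rep = {r. r \<noteq> 0 \<and> (\<exists>p\<in>Q. \<forall>x\<in>set p. rep x = r)}"

text \<open>\<open>pair\<close> says that at most two vertices share a nonzero number, so a path
  whose vertices all have the same nonzero number has order at most 2. Different numbers come from
  different paths.\<close>

lemma isolated_bound:
  assumes k: "2 \<le> k" and pair: "\<And>x y z. rep x \<noteq> 0 \<Longrightarrow> rep x = rep y \<Longrightarrow> rep x = rep z \<Longrightarrow> x = y \<or> x = z \<or> y = z"
  shows "card V + (k - 2) * card (isolated rep) \<le> k * card Q" "finite (isolated rep)"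
proof -
  define R where "R = {p \<in> Q. \<exists>r\<in>isolated rep. \<forall>x\<in>set p. rep x = r}"
  have RQ: "R \<subseteq> Q" unfolding R_def by blast
  have finR: "finite R" using finite_subset[OF RQ finite_Q] .
  have sub: "isolated rep \<subseteq> (\<lambda>p. rep (hd p)) ` R"
  proof
    fix r assume r: "r \<in> isolated rep"
    then obtain p where p: "p \<in> Q" "\<forall>x\<in>set p. rep x = r" unfolding isolated_def by blast
    then have "rep (hd p) = r" using path[OF p(1)] by simp
    moreover have "p \<in> R" unfolding R_def using p r by blast
    ultimately show "r \<in> (\<lambda>p. rep (hd p)) ` R" by blast
  qed
  then show "finite (isolated rep)" using finR finite_surj by blast
  have cR: "card (isolated rep) \<le> card R" using surj_card_le[OF finR sub] .
  have small: "length p \<le> 2" if p: "p \<in> R" for p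
  proof (rule ccontr)
    assume "\<not> length p \<le> 2"
    then obtain x y z q where xyz: "p = x # y # z # q"
      by (metis One_nat_def Suc_1 Suc_le_length_iff not_less_eq_eq)
    obtain r where r: "r \<noteq> 0" "\<forall>x\<in>set p. rep x = r" using p unfolding R_def isolated_def by blast
    have "distinct p" using path p unfolding R_def by blast
    then show False using pair[of x y z] r xyz by auto
  qed
  have "card V = (\<Sum>p\<in>Q. card (set p))"
    unfolding cover[symmetric] by (rule card_UN_disjoint) (use finite_Q disjoint in auto)
  also have "\<dots> = (\<Sum>p\<in>Q. length p)" by (intro sum.cong refl distinct_card) (use path in blast)
  finally have "card V = (\<Sum>p\<in>Q. length p)" .
  moreover have "(\<Sum>p\<in>Q. length p + (if p \<in> R then k - 2 else 0)) \<le> (\<Sum>p\<in>Q. k)"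
    by (rule sum_mono) (use path small k in fastforce)
  then have "(\<Sum>p\<in>Q. length p) + (k - 2) * card R \<le> k * card Q"
    using RQ finite_Q by (simp add: sum.distrib sum.inter_restrict[symmetric] inf.absorb2 mult.commute)
  moreover have "(k - 2) * card (isolated rep) \<le> (k - 2) * card R" using cR by simp
  ultimately show "card V + (k - 2) * card (isolated rep) \<le> k * card Q" by linarith
qed

text \<open>A path through a 2-cycle that does not stay inside has two consecutive vertices of which
  exactly one lies on it.\<close>

lemma crossing:
  assumes r: "rep x = r" "x \<in> V" "r \<noteq> 0" "r \<notin> isolated rep"
  obtains y z where "(y, z) \<in> arcs" "rep y = r" "rep z \<noteq> r" | y z where "(y, z) \<in> arcs" "rep y \<noteq> r" "rep z = r"
proof -
  obtain p where p: "p \<in> Q" "x \<in> set p" using cover r(2) by blast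
  have "\<exists>i. Suc i < length p \<and> (rep (p ! i) = r) \<noteq> (rep (p ! Suc i) = r)"
  proof (rule ccontr)
    assume "\<not> ?thesis"
    then have step: "(rep (p ! Suc i) = r) = (rep (p ! i) = r)" if "Suc i < length p" for i using that by blast
    have all: "(rep (p ! i) = r) = (rep (p ! 0) = r)" if "i < length p" for i
      using that by (induction i) (simp_all add: step)
    then have "rep y = r" if "y \<in> set p" for y
      using p(2) r(1) that by (metis in_set_conv_nth)
    then show False using r p(1) unfolding isolated_def by blast
  qed
  then obtain i where i: "Suc i < length p" "(rep (p ! i) = r) \<noteq> (rep (p ! Suc i) = r)" by blast
  moreover from i p have "(p ! i, p ! Suc i) \<in> arcs" unfolding arcs_def by blast
  ultimately show ?thesis using that by metis
qed

end

text \<open>Choosing a crossing arc of \<open>Q\<close> for each non-isolated number gives a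
  matching of the side graph: arcs of \<open>Q\<close> with a common head or a common tail coincide,
  and \<open>f\<close> and \<open>g\<close> keep leaving and entering arcs apart.\<close>

lemma (in path_system) matching_sides_bound:
  fixes rep :: "'a \<Rightarrow> nat" and m c :: nat
  assumes lft: "\<And>x y. (x, y) \<in> E \<Longrightarrow> rep x \<noteq> 0 \<Longrightarrow> rep x \<noteq> rep y \<Longrightarrow> \<exists>j<m. T j = rep x \<and> H j = f y"
    and rgt: "\<And>x y. (x, y) \<in> E \<Longrightarrow> rep y \<noteq> 0 \<Longrightarrow> rep x \<noteq> rep y \<Longrightarrow> \<exists>j<m. T j = rep y \<and> H j = g x"
    and fg: "inj_on f V" "inj_on g V" "f ` V \<inter> g ` V = {}"
    and max: "\<And>N. N \<subseteq> {..<m} \<Longrightarrow> inj_on T N \<Longrightarrow> inj_on H N \<Longrightarrow> card N \<le> c"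
    and R: "\<And>r. r \<in> R \<Longrightarrow> r \<noteq> 0 \<and> (\<exists>x\<in>V. rep x = r)" and fin: "finite R" "finite (isolated rep)"
  shows "card R \<le> c + card (isolated rep)"
proof -
  define ok where "ok r j \<longleftrightarrow> j < m \<and> T j = r \<and>
    (\<exists>x y. (x, y) \<in> arcs \<and> (rep x = r \<and> H j = f y \<or> rep y = r \<and> H j = g x))" for r j
  have "\<exists>j. ok r j" if r: "r \<in> R - isolated rep" for r
  proof -
    obtain x where x: "r \<noteq> 0" "x \<in> V" "rep x = r" using R r by blast
    show ?thesis
    proof (rule crossing[of rep x r, OF x(3,2,1)])
      show "r \<notin> isolated rep" using r by blast
    next
      fix y z assume 1: "(y, z) \<in> arcs" "rep y = r" "rep z \<noteq> r"
      then obtain j where "j < m" "T j = r" "H j = f z" using lft[of y z] arcs_sub x(1) by auto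
      with 1 show ?thesis unfolding ok_def by blast
    next
      fix y z assume 1: "(y, z) \<in> arcs" "rep y \<noteq> r" "rep z = r"
      then obtain j where "j < m" "T j = r" "H j = g y" using rgt[of y z] arcs_sub x(1) by auto
      with 1 show ?thesis unfolding ok_def by blast
    qed
  qed
  then obtain j where j: "\<And>r. r \<in> R - isolated rep \<Longrightarrow> ok r (j r)" by metis
  have injj: "inj_on j (R - isolated rep)"
    by (rule inj_onI) (use j in \<open>metis ok_def\<close>)
  have "inj_on H (j ` (R - isolated rep))"
  proof (rule inj_onI, safe)
    fix r r' assume r: "r \<in> R" "r \<notin> isolated rep" "r' \<in> R" "r' \<notin> isolated rep" "H (j r) = H (j r')"
    obtain x y where 1: "(x, y) \<in> arcs" "rep x = r \<and> H (j r) = f y \<or> rep y = r \<and> H (j r) = g x"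
      using j[of r] r unfolding ok_def by blast
    obtain x' y' where 2: "(x', y') \<in> arcs" "rep x' = r' \<and> H (j r') = f y' \<or> rep y' = r' \<and> H (j r') = g x'"
      using j[of r'] r unfolding ok_def by blast
    have V: "x \<in> V" "y \<in> V" "x' \<in> V" "y' \<in> V" using 1(1) 2(1) arcs_V by blast+
    have "f y \<noteq> g x'" "f y' \<noteq> g x" using fg(3) V by blast+
    then consider "rep x = r" "rep x' = r'" "f y = f y'" | "rep y = r" "rep y' = r'" "g x = g x'"
      using 1(2) 2(2) r(5) by metis
    then have "r = r'"
    proof cases
      case 1
      then have "y = y'" using inj_onD[OF fg(1)] V by blast
      then show ?thesis using arcs_left[of x y x'] \<open>(x, y) \<in> arcs\<close> 2(1) 1 by simp
    next
      case c: 2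
      then have "x = x'" using inj_onD[OF fg(2)] V by blast
      then show ?thesis using arcs_right[of x y y'] \<open>(x, y) \<in> arcs\<close> 2(1) c by simp
    qed
    then show "j r = j r'" by simp
  qed
  moreover have "inj_on T (j ` (R - isolated rep))"
    by (rule inj_onI) (use j in \<open>auto simp: ok_def\<close>)
  moreover have "j ` (R - isolated rep) \<subseteq> {..<m}" using j unfolding ok_def by auto
  ultimately have "card (j ` (R - isolated rep)) \<le> c" using max by blast
  then have "card (R - isolated rep) \<le> c" using card_image[OF injj] by simp
  moreover have "card R \<le> card (R - isolated rep) + card (isolated rep)"
  proof -
    have "card R \<le> card ((R - isolated rep) \<union> isolated rep)"
      by (rule card_mono) (use fin in auto)
    then show ?thesis using card_Un_le[of "R - isolated rep" "isolated rep"] by linarith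
  qed
  ultimately show ?thesis by simp
qed

section \<open>Splitting the functional graph into stars\<close>

text \<open>\<open>h\<close> points from a 2-cycle to the 2-cycle at the outer end of its matched
  arc; the numbers start at 1, so 0 is free to say that there is none.\<close>

locale labelling =
  fixes R :: "nat set" and h :: "nat \<Rightarrow> nat" and n :: nat
  assumes R_sub: "R \<subseteq> {1..n}" and h_R: "\<And>r. r \<in> R \<Longrightarrow> h r \<noteq> 0 \<Longrightarrow> h r \<in> R"
    and h_irrefl: "\<And>r. r \<in> R \<Longrightarrow> h r \<noteq> r"
begin

lemma R_pos: "r \<in> R \<Longrightarrow> 0 < r" and R_le: "r \<in> R \<Longrightarrow> r \<le> n"
  using R_sub by auto

lemma finite_R: "finite R"
  using R_sub finite_subset by blast

definition waiting where "waiting lab r = {d \<in> R. h d = r \<and> lab d = (0::nat)}"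

lemma finite_waiting: "finite (waiting lab r)"
  unfolding waiting_def using finite_R by simp

text \<open>
  The situation of the guest \<open>r\<close> at which an odd cycle of the functional graph closes: \<open>r\<close> is the only
  guest of its host, and at most one lost 2-cycle points to \<open>r\<close>.
\<close>

definition sole_guest where
  "sole_guest lab r \<longleftrightarrow> h r \<in> R \<and> lab (h r) = (2::nat) \<and>
     (\<forall>d\<in>R. h d = h r \<longrightarrow> lab d \<noteq> 2 \<longrightarrow> d = r) \<and>
     (\<forall>d\<in>R. \<forall>d'\<in>R. h d = r \<longrightarrow> lab d \<noteq> 2 \<longrightarrow> h d' = r \<longrightarrow> lab d' \<noteq> 2 \<longrightarrow> d = d')"

text \<open>Labels: 0 undecided, 1 guest, 2 host of at least one guest.\<close>

definition consistent where
  "consistent lab \<longleftrightarrow> (\<forall>r\<in>R. lab r \<le> 2) \<and>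
     (\<forall>r\<in>R. lab r = 2 \<longrightarrow> (\<exists>d\<in>R. h d = r \<and> lab d = (1::nat))) \<and>
     (\<forall>r\<in>R. lab r = 1 \<longrightarrow> h r \<noteq> 0 \<longrightarrow> lab (h r) \<noteq> 0) \<and>
     (\<forall>r\<in>R. lab r = 1 \<longrightarrow> (\<forall>d\<in>R. h d = r \<longrightarrow> lab d = 2) \<or> sole_guest lab r)"

definition counted where
  "counted lab cnt \<longleftrightarrow> (\<forall>r\<in>R. lab r = 0 \<longrightarrow> cnt r = card (waiting lab r))"

text \<open>The condition for making \<open>c\<close> a guest although another 2-cycle may still
  wait for it. It guarantees \<open>sole_guest\<close> for \<open>c\<close> afterwards, which
  compensates for the possible loss of the one that waits.\<close>

definition forced where
  "forced lab c \<longleftrightarrow> h c \<in> R \<and> lab (h c) = 0 \<and> waiting lab (h c) = {c} \<and> card (waiting lab c) \<le> 1"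

text \<open>The counter \<open>i\<close> passes over the numbers twice. Below it, in the first pass,
  everything undecided is waited for; in the second pass everything is decided. \<open>c\<close> is
  a candidate under way and is exempt from both.\<close>

definition labelling_inv where
  "labelling_inv lab cnt c i \<longleftrightarrow> consistent lab \<and> counted lab cnt \<and>
     (c \<noteq> 0 \<longrightarrow> c \<in> R \<and> lab c = 0 \<and> (cnt c = 0 \<or> forced lab c)) \<and>
     (\<forall>r\<in>R. r \<le> i \<longrightarrow> lab r = 0 \<longrightarrow> r \<noteq> c \<longrightarrow> 1 \<le> cnt r) \<and>
     (\<forall>r\<in>R. n + r \<le> i \<longrightarrow> lab r \<noteq> 0 \<or> r = c)"

text \<open>
  If every undecided 2-cycle is waited for by another one, then counting shows that the undecided ones
  form disjoint directed cycles, so that the labelling can be started anywhere.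
\<close>

lemma all_forced:
  assumes all: "\<And>r. r \<in> R \<Longrightarrow> lab r = 0 \<Longrightarrow> 1 \<le> card (waiting lab r)" and c: "c \<in> R" "lab c = 0"
  shows "forced lab c"
proof -
  define U where "U = {r \<in> R. lab r = 0}"
  have finU: "finite U" unfolding U_def using finite_R by simp
  let ?W = "\<Union>u\<in>U. waiting lab u"
  have sub: "?W \<subseteq> U" unfolding waiting_def U_def by auto
  have card_W: "card ?W = (\<Sum>u\<in>U. card (waiting lab u))"
    by (rule card_UN_disjoint) (use finU finite_waiting in \<open>auto simp: waiting_def\<close>)
  have ge: "(\<Sum>u\<in>U. 1) \<le> (\<Sum>u\<in>U. card (waiting lab u))"
    by (rule sum_mono) (use all in \<open>simp add: U_def\<close>)
  have "card ?W \<le> card U" using card_mono[OF finU sub] .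
  then have eq: "card ?W = card U" using ge card_W by simp
  then have WU: "?W = U" using card_subset_eq[OF finU sub] by simp
  have one: "card (waiting lab u) = 1" if u: "u \<in> U" for u
  proof (rule ccontr)
    assume "card (waiting lab u) \<noteq> 1"
    then have "1 < card (waiting lab u)" using all[of u] u unfolding U_def by simp
    then have "(\<Sum>u\<in>U. 1) < (\<Sum>u\<in>U. card (waiting lab u))"
      by (intro sum_strict_mono_ex1[OF finU]) (use all u in \<open>auto simp: U_def\<close>)
    then show False using eq card_W by simp
  qed
  have "c \<in> ?W" unfolding WU using c unfolding U_def by simp
  then have hc: "h c \<in> U" "c \<in> waiting lab (h c)" unfolding waiting_def by auto
  then obtain x where "waiting lab (h c) = {x}" using one card_1_singletonE by metis
  then have "waiting lab (h c) = {c}" using hc by simp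
  moreover have "card (waiting lab c) \<le> 1" using one[of c] c unfolding U_def by simp
  ultimately show ?thesis using hc unfolding forced_def U_def by blast
qed

text \<open>In the first pass only numbers nobody waits for become candidates. Once
  \<open>n <= i\<close>, every undecided number is waited for, so \<open>all_forced\<close> permits
  any of them.\<close>

lemma start_step:
  assumes I: "labelling_inv lab cnt 0 i" and r: "r = (if i < n then Suc i else Suc i - n)"
    and c: "c = (if r \<in> R \<and> lab r = 0 \<and> (cnt r = 0 \<or> n \<le> i) then r else 0)"
  shows "labelling_inv lab cnt c (Suc i)"
proof -
  have con: "consistent lab" "counted lab cnt"
    and low: "\<And>r. r \<in> R \<Longrightarrow> r \<le> i \<Longrightarrow> lab r = 0 \<Longrightarrow> 1 \<le> cnt r"
    and old: "\<And>r. r \<in> R \<Longrightarrow> n + r \<le> i \<Longrightarrow> lab r \<noteq> 0"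
    using I R_pos unfolding labelling_inv_def by auto
  have "cnt c = 0 \<or> forced lab c" if c0: "c \<noteq> 0"
  proof (cases "i < n")
    case True
    then show ?thesis using c c0 by (auto split: if_splits)
  next
    case False
    have "forced lab r" if "r \<in> R" "lab r = 0"
    proof (rule all_forced[of lab r, OF _ that])
      fix u assume u: "u \<in> R" "lab u = 0"
      then have "u \<le> i" using R_le[of u] False by simp
      then show "1 \<le> card (waiting lab u)" using low[of u] con(2) u unfolding counted_def by simp
    qed
    then show ?thesis using c c0 by (auto split: if_splits)
  qed
  moreover have "1 \<le> cnt u" if "u \<in> R" "u \<le> Suc i" "lab u = 0" "u \<noteq> c" for u
  proof (cases "u \<le> i")
    case True
    then show ?thesis using low that by simp
  next
    case False
    then have "u = r" using that R_le[of u] r by auto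
    then show ?thesis using that c by (cases "cnt r = 0") auto
  qed
  moreover have "lab u \<noteq> 0 \<or> u = c" if "u \<in> R" "n + u \<le> Suc i" for u
  proof (cases "n + u \<le> i")
    case True
    then show ?thesis using old that by simp
  next
    case False
    then have "u = r" "n \<le> i" using that R_pos[of u] r by auto
    then show ?thesis using c that by auto
  qed
  ultimately show ?thesis
    using con c unfolding labelling_inv_def by (auto split: if_splits)
qed

lemma sole_guest_mono:
  assumes "sole_guest lab r" "\<And>d. d \<in> R \<Longrightarrow> lab d = 2 \<Longrightarrow> lab' d = 2"
  shows "sole_guest lab' r"
  using assms unfolding sole_guest_def by meson

text \<open>When \<open>h c\<close> turns into a host it stops waiting for \<open>h (h c)\<close>,
  whose count drops by one. If nobody waits for that one any more, it is the next candidate;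
  following such chains preserves the lower bound on \<open>cnt\<close> for the numbers already
  passed.\<close>

lemma guest_step:
  assumes I: "labelling_inv lab cnt c i" and c0: "c \<noteq> 0"
    and lab': "lab' = (if h c \<noteq> 0 \<and> lab (h c) = 0 then lab(c := 1, h c := 2) else lab(c := 1))"
    and cnt': "cnt' = (if h c \<noteq> 0 \<and> lab (h c) = 0 \<and> h (h c) \<noteq> 0 then cnt(h (h c) := cnt (h (h c)) - 1) else cnt)"
    and c': "c' = (if h c \<noteq> 0 \<and> lab (h c) = 0 \<and> h (h c) \<noteq> 0 \<and> lab' (h (h c)) = 0 \<and> cnt' (h (h c)) = 0
      then h (h c) else 0)"
  shows "labelling_inv lab' cnt' c' i" "{r \<in> R. lab' r = 0} \<subset> {r \<in> R. lab r = 0}"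
proof -
  have con: "consistent lab" "counted lab cnt" and c: "c \<in> R" "lab c = 0" "cnt c = 0 \<or> forced lab c"
    and low: "\<And>r. r \<in> R \<Longrightarrow> r \<le> i \<Longrightarrow> lab r = 0 \<Longrightarrow> r \<noteq> c \<Longrightarrow> 1 \<le> cnt r"
    and old: "\<And>r. r \<in> R \<Longrightarrow> n + r \<le> i \<Longrightarrow> lab r \<noteq> 0 \<or> r = c"
    using I c0 unfolding labelling_inv_def by blast+
  have con1: "\<And>r. r \<in> R \<Longrightarrow> lab r \<le> 2"
    and con2: "\<And>r. r \<in> R \<Longrightarrow> lab r = 2 \<Longrightarrow> \<exists>d\<in>R. h d = r \<and> lab d = 1"
    and con3: "\<And>r. r \<in> R \<Longrightarrow> lab r = 1 \<Longrightarrow> h r \<noteq> 0 \<Longrightarrow> lab (h r) \<noteq> 0"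
    and con4: "\<And>r. r \<in> R \<Longrightarrow> lab r = 1 \<Longrightarrow> (\<forall>d\<in>R. h d = r \<longrightarrow> lab d = 2) \<or> sole_guest lab r"
    using con(1) unfolding consistent_def by blast+
  have hc: "h c \<noteq> c" "h c \<noteq> 0 \<Longrightarrow> h c \<in> R" using h_irrefl h_R c(1) by auto
  define promote where "promote \<longleftrightarrow> h c \<noteq> 0 \<and> lab (h c) = 0"
  have lab'_c: "lab' c = 1" unfolding lab' using hc by auto
  have lab'_h: "lab' (h c) = 2" if promote unfolding lab' using that promote_def by auto
  have lab'_other: "lab' r = lab r" if "r \<noteq> c" "promote \<Longrightarrow> r \<noteq> h c" for r
    unfolding lab' using that promote_def by auto
  have keep: "lab' r = lab r" if "lab r \<noteq> 0" for r
  proof (rule lab'_other)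
    show "r \<noteq> c" using that c(2) by auto
    show "r \<noteq> h c" if promote using \<open>lab r \<noteq> 0\<close> that promote_def by auto
  qed
  have zero: "lab' r = 0 \<longleftrightarrow> lab r = 0 \<and> r \<noteq> c \<and> (promote \<longrightarrow> r \<noteq> h c)" for r
    using lab'_c lab'_h lab'_other[of r] by (cases "r = c"; cases "promote \<and> r = h c") auto
  have no_guest: "lab d \<noteq> 1" if "d \<in> R" "h d = r" "r \<in> R" "lab r = 0" for d r
    using con3[OF that(1)] that R_pos by auto
  have two: "lab d = 2" if "d \<in> R" "h d = r" "r \<in> R" "lab r = 0" "lab d \<noteq> 0" for d r
    using con1[OF that(1)] no_guest[OF that(1-4)] that(5) by simp
  \<comment> \<open>If nobody waits for \<open>c\<close>, all that point to it are hosts already.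
    Otherwise \<open>c\<close> was \<open>forced\<close>: it becomes the only guest of
    \<open>h c\<close>, and at most one 2-cycle that is not a host points to it.\<close>
  have guest_c: "(\<forall>d\<in>R. h d = c \<longrightarrow> lab' d = 2) \<or> sole_guest lab' c"
  proof (cases "cnt c = 0")
    case True
    then have empty: "waiting lab c = {}" using con(2) c finite_waiting[of lab c] unfolding counted_def by simp
    have "lab' d = 2" if d: "d \<in> R" "h d = c" for d
    proof -
      have nz: "lab d \<noteq> 0"
      proof
        assume "lab d = 0"
        then have "d \<in> waiting lab c" using d unfolding waiting_def by simp
        then show False using empty by simp
      qed
      show ?thesis unfolding keep[OF nz] by (rule two[OF d c(1,2) nz])
    qed
    then show ?thesis by blast
  next
    case False
    then have f: "h c \<in> R" "lab (h c) = 0" "waiting lab (h c) = {c}" "card (waiting lab c) \<le> 1"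
      using c(3) unfolding forced_def by auto
    then have pr: promote using R_pos[of "h c"] unfolding promote_def by simp
    have "d = c" if "d \<in> R" "h d = h c" "lab' d \<noteq> 2" for d
    proof -
      have "lab d = 0" using two[OF that(1,2) f(1,2)] keep[of d] that(3) by (cases "lab d = 0") simp_all
      then show ?thesis using f(3) that unfolding waiting_def by blast
    qed
    moreover have "d = d'" if "d \<in> R" "d' \<in> R" "h d = c" "lab' d \<noteq> 2" "h d' = c" "lab' d' \<noteq> 2" for d d'
    proof -
      have "lab d = 0" "lab d' = 0"
        using two[OF that(1,3) c(1,2)] two[OF that(2,5) c(1,2)] keep[of d] keep[of d'] that(4,6)
        by (cases "lab d = 0"; cases "lab d' = 0"; simp)+
      then have "d \<in> waiting lab c" "d' \<in> waiting lab c" using that unfolding waiting_def by blast+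
      then show ?thesis using f(4) finite_waiting by (metis card_le_Suc0_iff_eq One_nat_def)
    qed
    ultimately have "sole_guest lab' c" using f(1) lab'_h[OF pr] unfolding sole_guest_def by blast
    then show ?thesis ..
  qed
  have con': "consistent lab'"
    unfolding consistent_def
  proof (intro conjI ballI impI)
    fix r assume r: "r \<in> R"
    show "lab' r \<le> 2" unfolding lab' using con1[OF r] by auto
    show "\<exists>d\<in>R. h d = r \<and> lab' d = 1" if r2: "lab' r = 2"
    proof (cases "lab r = 0")
      case True
      then have "r = h c" using lab'_other[of r] lab'_c r2 by fastforce
      then show ?thesis using c(1) lab'_c by blast
    next
      case False
      then obtain d where "d \<in> R" "h d = r" "lab d = 1" using con2[OF r] keep[OF False] r2 by auto
      then show ?thesis using keep[of d] by auto
    qed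
    show "lab' (h r) \<noteq> 0" if "lab' r = 1" "h r \<noteq> 0"
    proof (cases "r = c")
      case True
      then show ?thesis using zero[of "h c"] that promote_def by auto
    next
      case False
      then have "lab r = 1" using that lab'_other[of r] lab'_h by (cases "r = h c \<and> promote") auto
      then show ?thesis using con3[OF r] that keep by auto
    qed
    show "(\<forall>d\<in>R. h d = r \<longrightarrow> lab' d = 2) \<or> sole_guest lab' r" if "lab' r = 1"
    proof (cases "r = c")
      case True
      then show ?thesis using guest_c by simp
    next
      case False
      then have "lab r = 1" using that lab'_other[of r] lab'_h by (cases "r = h c \<and> promote") auto
      from con4[OF r this] show ?thesis
      proof
        assume "\<forall>d\<in>R. h d = r \<longrightarrow> lab d = 2"
        then show ?thesis using keep by auto
      next
        assume "sole_guest lab r"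
        then have "sole_guest lab' r" by (rule sole_guest_mono) (use keep in auto)
        then show ?thesis ..
      qed
    qed
  qed
  \<comment> \<open>The set that loses \<open>c\<close> belongs to \<open>h c\<close>, which is no
    longer undecided; among the remaining ones only the set of \<open>h (h c)\<close> can lose a
    member, namely \<open>h c\<close>.\<close>
  have cnt'_r: "cnt' r = card (waiting lab' r)" if r: "r \<in> R" "lab' r = 0" for r
  proof -
    have r0: "lab r = 0" "r \<noteq> c" "promote \<Longrightarrow> r \<noteq> h c" using zero[of r] r by auto
    have cr: "h c \<noteq> r" using r0 r R_pos[OF r(1)] unfolding promote_def by auto
    have cnt_r: "cnt r = card (waiting lab r)" using con(2) r r0 unfolding counted_def by blast
    show ?thesis
    proof (cases "promote \<and> h (h c) = r")
      case True
      then have "waiting lab' r = waiting lab r - {h c}"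
        unfolding waiting_def using zero cr by auto
      moreover have "h c \<in> waiting lab r" unfolding waiting_def using True hc promote_def by auto
      ultimately show ?thesis
        using cnt_r finite_waiting True R_pos[OF r(1)] unfolding cnt' promote_def by auto
    next
      case False
      then have "waiting lab' r = waiting lab r"
        unfolding waiting_def using zero cr by auto
      moreover have "cnt' r = cnt r" using False unfolding cnt' promote_def by auto
      ultimately show ?thesis using cnt_r by simp
    qed
  qed
  show "labelling_inv lab' cnt' c' i"
    unfolding labelling_inv_def
  proof (intro conjI ballI impI)
    show "consistent lab'" by (rule con')
    show "counted lab' cnt'" unfolding counted_def using cnt'_r by blast
    show "c' \<in> R" "lab' c' = 0" "cnt' c' = 0 \<or> forced lab' c'" if "c' \<noteq> 0"
      using that hc h_R[of "h c"] unfolding c' by (auto split: if_splits)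
    fix r assume r: "r \<in> R"
    show "1 \<le> cnt' r" if "r \<le> i" "lab' r = 0" "r \<noteq> c'"
    proof (cases "promote \<and> h (h c) = r")
      case True
      then have "cnt' r \<noteq> 0" using that R_pos[OF r] unfolding c' promote_def by (auto split: if_splits)
      then show ?thesis by simp
    next
      case False
      then have "cnt' r = cnt r" unfolding cnt' promote_def by auto
      then show ?thesis using low[OF r that(1)] zero[of r] that by auto
    qed
    show "lab' r \<noteq> 0 \<or> r = c'" if "n + r \<le> i"
      using old[OF r that] zero[of r] by auto
  qed
  show "{r \<in> R. lab' r = 0} \<subset> {r \<in> R. lab r = 0}"
    using zero c by auto
qed

lemma labelling_final:
  assumes "labelling_inv lab cnt 0 (2 * n)"
  shows "consistent lab" "r \<in> R \<Longrightarrow> lab r = 1 \<or> lab r = 2"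
proof -
  show con: "consistent lab" using assms unfolding labelling_inv_def by blast
  assume r: "r \<in> R"
  then have "n + r \<le> 2 * n" using R_le by auto
  then have "lab r \<noteq> 0" using assms r R_pos[OF r] unfolding labelling_inv_def by auto
  moreover have "lab r \<le> 2" using con r unfolding consistent_def by blast
  ultimately show "lab r = 1 \<or> lab r = 2" by linarith
qed

end

text \<open>The 2-cycle with number \<open>r\<close> has \<open>r - 1\<close> as its smaller vertex,
  so \<open>rep[r - 1] = r\<close> tests whether the number is in use. The negated conjunction says
  that the count is 0 or the second pass has begun.\<close>

definition label_start :: com where
  "label_start =
    If (Less (Reg ''i'') (Reg ''n'')) (Assign ''r'' (Add (Reg ''i'') (Const 1)))
      (Assign ''r'' (Sub (Add (Reg ''i'') (Const 1)) (Reg ''n''))) ;;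
    If (And (And (Equal (Get ''rep'' (Sub (Reg ''r'') (Const 1))) (Reg ''r''))
              (Equal (Get ''lab'' (Reg ''r'')) (Const 0)))
          (Not (And (Not (Equal (Get ''cnt'' (Reg ''r'')) (Const 0))) (Less (Reg ''i'') (Reg ''n'')))))
      (Assign ''c'' (Reg ''r'')) Skip ;;
    Assign ''i'' (Add (Reg ''i'') (Const 1))"

definition label_guest :: com where
  "label_guest =
    Put ''lab'' (Reg ''c'') (Const 1) ;; Assign ''h'' (Get ''hs'' (Reg ''c'')) ;; Assign ''c'' (Const 0) ;;
    If (And (Not (Equal (Reg ''h'') (Const 0))) (Equal (Get ''lab'' (Reg ''h'')) (Const 0)))
     (Put ''lab'' (Reg ''h'') (Const 2) ;; Assign ''h'' (Get ''hs'' (Reg ''h'')) ;;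
      If (Equal (Reg ''h'') (Const 0)) Skip
       (Put ''cnt'' (Reg ''h'') (Sub (Get ''cnt'' (Reg ''h'')) (Const 1)) ;;
        If (And (Equal (Get ''lab'' (Reg ''h'')) (Const 0)) (Equal (Get ''cnt'' (Reg ''h'')) (Const 0)))
          (Assign ''c'' (Reg ''h'')) Skip))
     Skip"

definition label_hosts :: com where
  "label_hosts =
    (Assign ''i'' (Const 0) ;; Assign ''c'' (Const 0)) ;;
    While (Less (Const 0) (Add (Reg ''c'') (Sub (Add (Reg ''n'') (Reg ''n'')) (Reg ''i''))))
      (If (Equal (Reg ''c'') (Const 0)) label_start label_guest)"

lemma cost_label: "cost label_start \<le> 60" "cost label_guest \<le> 60"
  by (simp_all add: label_start_def label_guest_def)

text \<open>A round either labels the candidate or advances the counter, so undecided numbers plus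
  remaining counter values form a potential of at most \<open>3 * n\<close>.\<close>

lemma (in labelling) label_hosts:
  assumes n: "reg s ''n'' = n" and rep: "\<And>r. 1 \<le> r \<Longrightarrow> r \<le> n \<Longrightarrow> arr s ''rep'' (r - 1) = r \<longleftrightarrow> r \<in> R"
    and hs: "\<And>r. r \<in> R \<Longrightarrow> arr s ''hs'' r = h r"
    and cnt: "counted (\<lambda>_. 0) (arr s ''cnt'')" "\<And>r. arr s ''cnt'' r \<le> B"
    and lab: "arr s ''lab'' = (\<lambda>_. 0)" and B: "2 * n + 2 \<le> B"
  shows "runs B label_hosts s (300 * n + 100)
    (\<lambda>s'. consistent (arr s' ''lab'') \<and> (\<forall>r\<in>R. arr s' ''lab'' r = 1 \<or> arr s' ''lab'' r = 2))"
proof -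
  define todo where "todo s = card {r \<in> R. arr s ''lab'' r = 0}" for s :: store
  define I where "I v s' \<longleftrightarrow> reg s' ''n'' = n \<and> arr s' ''rep'' = arr s ''rep'' \<and> arr s' ''hs'' = arr s ''hs'' \<and>
    (\<forall>r. arr s' ''cnt'' r \<le> B) \<and> reg s' ''i'' \<le> 2 * n \<and> v = todo s' + (2 * n - reg s' ''i'') \<and>
    labelling_inv (arr s' ''lab'') (arr s' ''cnt'') (reg s' ''c'') (reg s' ''i'')" for v and s' :: store
  have fin: "finite {r \<in> R. P r}" for P using finite_R by simp
  show ?thesis
    unfolding label_hosts_def
  proof (rule runs_Seq[where ?T1.0 = 9 and ?T2.0 = "300 * n + 90" and R = "I (card R + 2 * n)"], goal_cases)
    case 1
    have "consistent (\<lambda>_. 0)" unfolding consistent_def by simp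
    then have "labelling_inv (\<lambda>_. 0) (arr s ''cnt'') 0 0"
      using cnt(1) R_pos unfolding labelling_inv_def by auto
    then show ?case
      using n cnt(2) lab by (intro runs_wpI) (simp_all add: I_def todo_def)
  next
    case (2 s0)
    show ?case
    proof (rule runs_WhileI[where I = I and v = "card R + 2 * n" and K = 80], goal_cases)
      case 1
      show ?case by (rule 2)
    next
      case (2 v s')
      let ?c = "reg s' ''c''" and ?i = "reg s' ''i''" and ?lab = "arr s' ''lab''" and ?cnt = "arr s' ''cnt''"
      have s': "reg s' ''n'' = n" "arr s' ''rep'' = arr s ''rep''" "arr s' ''hs'' = arr s ''hs''"
        "\<And>r. ?cnt r \<le> B" "?i \<le> 2 * n" and v: "v = todo s' + (2 * n - ?i)"
        and inv: "labelling_inv ?lab ?cnt ?c ?i"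
        using 2(1) unfolding I_def by blast+
      show ?case
      proof (cases "?c = 0")
        case True
        have i: "?i < 2 * n" using 2(2) True s' by simp
        define r where "r = (if ?i < n then Suc ?i else Suc ?i - n)"
        define c where "c = (if r \<in> R \<and> ?lab r = 0 \<and> (?cnt r = 0 \<or> n \<le> ?i) then r else 0)"
        have r: "1 \<le> r" "r \<le> n" using i unfolding r_def by auto
        have step: "labelling_inv ?lab ?cnt c (Suc ?i)"
          by (rule start_step[OF inv[unfolded True] r_def c_def])
        define s1 where "s1 = s'\<lparr>reg := (reg s')(''r'' := r, ''c'' := c, ''i'' := Suc ?i)\<rparr>"
        have "I (v - 1) s1" "v - 1 < v"
          using s' v i step unfolding I_def s1_def todo_def by auto
        then have I1: "\<exists>v'<v. I v' s1" by blast
        have rep': "arr s ''rep'' (r - Suc 0) = r \<longleftrightarrow> r \<in> R" using rep[OF r] by simp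
        have "wp B label_start (\<lambda>s'. \<exists>v'<v. I v' s') s'"
        proof (cases "r \<in> R \<and> ?lab r = 0 \<and> (?cnt r = 0 \<or> n \<le> ?i)")
          case t: True
          then have "s1 = s'\<lparr>reg := (reg s')(''r'' := r, ''c'' := r, ''i'' := Suc ?i)\<rparr>"
            unfolding s1_def c_def by simp
          then show ?thesis
            using I1 t s'(1,2) B i r rep' r_def
            by (cases "?i < n"; cases "?cnt r = 0") (simp_all add: label_start_def)
        next
          case t: False
          have "c = 0" unfolding c_def by (rule if_not_P[OF t])
          moreover have "(reg s')(''r'' := r, ''c'' := 0, ''i'' := Suc ?i) = (reg s')(''r'' := r, ''i'' := Suc ?i)"
            using True by (auto simp: fun_eq_iff)
          ultimately have s1: "s1 = s'\<lparr>reg := (reg s')(''r'' := r, ''i'' := Suc ?i)\<rparr>"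
            unfolding s1_def by simp
          have rs: "?i < n \<Longrightarrow> Suc ?i = r" "\<not> ?i < n \<Longrightarrow> Suc ?i - n = r" unfolding r_def by simp_all
          from t consider "r \<notin> R" | "?lab r \<noteq> 0" | "?cnt r \<noteq> 0" "?i < n" by force
          then show ?thesis
            by cases (use I1 s'(1,2) B i r rep' in \<open>cases "?i < n"; simp add: label_start_def rs s1\<close>)+
        qed
        then show ?thesis using True cost_label by (intro runs_wpI) simp_all
      next
        case False
        define lab' where "lab' = (if h ?c \<noteq> 0 \<and> ?lab (h ?c) = 0 then ?lab(?c := 1, h ?c := 2) else ?lab(?c := 1))"
        define cnt' where "cnt' = (if h ?c \<noteq> 0 \<and> ?lab (h ?c) = 0 \<and> h (h ?c) \<noteq> 0
          then ?cnt(h (h ?c) := ?cnt (h (h ?c)) - 1) else ?cnt)"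
        define c' where "c' = (if h ?c \<noteq> 0 \<and> ?lab (h ?c) = 0 \<and> h (h ?c) \<noteq> 0 \<and> lab' (h (h ?c)) = 0 \<and> cnt' (h (h ?c)) = 0
          then h (h ?c) else 0)"
        have c: "?c \<in> R" using inv False unfolding labelling_inv_def by blast
        note step = guest_step[OF inv False lab'_def cnt'_def c'_def]
        have hc: "arr s ''hs'' ?c = h ?c" "h ?c \<noteq> ?c" "h ?c \<noteq> 0 \<Longrightarrow> arr s ''hs'' (h ?c) = h (h ?c)"
          using hs h_irrefl h_R c by auto
        have le: "h r \<le> B" if "r \<in> R" for r
          using h_R[OF that] R_le[of "h r"] B by (cases "h r = 0") auto
        have le': "h ?c \<le> B" "h ?c \<noteq> 0 \<Longrightarrow> h (h ?c) \<le> B" using le h_R c by auto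
        have less: "card {r \<in> R. lab' r = 0} < todo s'"
          unfolding todo_def by (rule psubset_card_mono[OF fin step(2)])
        have goal: "\<exists>v'<v. I v' s1" if "reg s1 ''n'' = n" "arr s1 ''rep'' = arr s ''rep''"
          "arr s1 ''hs'' = arr s ''hs''" "arr s1 ''lab'' = lab'" "arr s1 ''cnt'' = cnt'" "reg s1 ''c'' = c'"
          "reg s1 ''i'' = ?i" for s1
        proof -
          have "cnt' r \<le> B" for r using s'(4)[of r] unfolding cnt'_def by auto
          then have "I (card {r \<in> R. lab' r = 0} + (2 * n - ?i)) s1"
            using that step(1) s'(5) unfolding I_def todo_def by simp
          moreover have "card {r \<in> R. lab' r = 0} + (2 * n - ?i) < v" using less v by simp
          ultimately show ?thesis by blast
        qed
        have "wp B label_guest (\<lambda>s'. \<exists>v'<v. I v' s') s'"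
        proof (cases "h ?c \<noteq> 0 \<and> ?lab (h ?c) = 0")
          case pr: True
          show ?thesis
          proof (cases "h (h ?c) = 0")
            case True
            then show ?thesis
              using False pr hc le' s' B
              by (simp add: label_guest_def goal lab'_def cnt'_def c'_def)
          next
            case h2: False
            have "?cnt (h (h ?c)) - Suc 0 \<le> B" using s'(4)[of "h (h ?c)"] by linarith
            then show ?thesis
              using False pr hc le' s' B h2
              by (cases "lab' (h (h ?c)) = 0 \<and> cnt' (h (h ?c)) = 0")
                (simp_all add: label_guest_def goal lab'_def cnt'_def c'_def)
          qed
        next
          case np: False
          then show ?thesis
            using False hc le' s' B
            by (cases "h ?c = 0") (simp_all add: label_guest_def goal lab'_def cnt'_def c'_def)
        qed
        then show ?thesis using False cost_label by (intro runs_wpI) simp_all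
      qed
    next
      case 3
      have "card R \<le> n" using card_mono[of "{1..n}" R] R_sub by simp
      then show ?case by simp
    next
      case (4 v s')
      then have "reg s' ''c'' = 0" "2 * n \<le> reg s' ''i''" "reg s' ''i'' \<le> 2 * n"
        unfolding I_def by auto
      then have "labelling_inv (arr s' ''lab'') (arr s' ''cnt'') 0 (2 * n)"
        using 4(1) unfolding I_def by simp
      then show ?case using labelling_final by blast
    qed
  qed simp
qed

section \<open>Walking along the components\<close>

definition succ_rep where
  "succ_rep n S su pr \<longleftrightarrow> (\<forall>x y. (x, y) \<in> S \<longleftrightarrow> x < n \<and> su x = Suc y) \<and>
     (\<forall>x y. (x, y) \<in> S \<longleftrightarrow> y < n \<and> pr y = Suc x)" for n :: nat and su pr :: "nat \<Rightarrow> nat"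

text \<open>\<open>start\<close> also holds the end of the last list; appending a vertex to that
  list therefore rewrites a single entry.\<close>

definition out_rep :: "(nat \<Rightarrow> nat) \<Rightarrow> (nat \<Rightarrow> nat) \<Rightarrow> nat list list \<Rightarrow> bool" where
  "out_rep path start outs \<longleftrightarrow>
     (\<forall>i\<le>length outs. start i = length (concat (take i outs))) \<and>
     (\<forall>i<length (concat outs). path i = concat outs ! i)"

lemma output_paths_out_rep:
  assumes "out_rep (arr s ''path'') (arr s ''start'') outs" "reg s ''q'' = length outs"
  shows "output_paths s = outs"
proof (rule nth_equalityI)
  show "length (output_paths s) = length outs" using assms(2) by (simp add: output_paths_def)
  fix i assume "i < length (output_paths s)"
  then have i: "i < length outs" using assms(2) by (simp add: output_paths_def)
  let ?a = "length (concat (take i outs))"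
  have split: "concat outs = concat (take i outs) @ outs ! i @ concat (drop (Suc i) outs)"
    using id_take_nth_drop[OF i] by (metis concat.simps(2) concat_append)
  have start: "arr s ''start'' i = ?a" "arr s ''start'' (Suc i) = ?a + length (outs ! i)"
    using assms(1) i unfolding out_rep_def by (simp_all add: take_Suc_conv_app_nth)
  have "map (arr s ''path'') [?a ..< ?a + length (outs ! i)] = outs ! i"
  proof (rule nth_equalityI)
    fix j assume "j < length (map (arr s ''path'') [?a ..< ?a + length (outs ! i)])"
    then have j: "j < length (outs ! i)" by simp
    have "?a + j < length (concat outs)" using j by (subst split) simp
    then have "arr s ''path'' (?a + j) = concat outs ! (?a + j)"
      using assms(1) unfolding out_rep_def by blast
    also have "\<dots> = outs ! i ! j"
      by (subst split) (simp only: nth_append_length_plus, simp add: nth_append j)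
    finally show "map (arr s ''path'') [?a ..< ?a + length (outs ! i)] ! j = outs ! i ! j" using j by simp
  qed simp
  then show "output_paths s ! i = outs ! i"
    using i assms(2) start by (simp add: output_paths_def)
qed

lemma out_rep_new:
  assumes "out_rep path start outs" "p = length (concat outs)"
  shows "out_rep (path(p := v)) (start(Suc (length outs) := Suc p)) (outs @ [[v]])"
  using assms unfolding out_rep_def by (auto simp: le_Suc_eq nth_append)

lemma out_rep_extend:
  assumes o: "out_rep path start outs" "p = length (concat outs)" and ne: "outs \<noteq> []"
  shows "out_rep (path(p := v)) (start(length outs := Suc p)) (butlast outs @ [last outs @ [v]])"
proof -
  obtain os l where outs: "outs = os @ [l]" using ne by (metis append_butlast_last_id)
  show ?thesis
    using o unfolding out_rep_def outs by (auto simp: le_Suc_eq nth_append)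
qed

lemma pieces_Suc:
  assumes "0 < k"
  shows "pieces k (Suc L) = pieces k L + (if L mod k = 0 then 1 else 0)"
proof -
  have "Suc (L + k - 1) = L + k" using assms by simp
  then show ?thesis using div_Suc[of "L + k - 1" k] unfolding pieces_def by simp
qed

lemma pieces_0: "0 < k \<Longrightarrow> pieces k 0 = 0"
  by (simp add: pieces_def)

locale walking =
  fixes n :: nat and S :: "(nat \<times> nat) set" and su pr :: "nat \<Rightarrow> nat" and k :: nat
  assumes succ: "succ_rep n S su pr" and pr_0: "\<And>i. n \<le> i \<Longrightarrow> pr i = 0" and k: "0 < k"
begin

lemma S_su: "(x, y) \<in> S \<longleftrightarrow> x < n \<and> su x = Suc y"
  and S_pr: "(x, y) \<in> S \<longleftrightarrow> y < n \<and> pr y = Suc x"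
  using succ unfolding succ_rep_def by blast+

text \<open>Neighbours are unique, and at the two ends either the closing arc or no arc at all is
  present. Hence a later walk cannot run into a finished component.\<close>

lemma comp_closed:
  assumes c: "comp_of S d"
  shows "x \<in> set d \<Longrightarrow> (x, y) \<in> S \<Longrightarrow> y \<in> set d" "y \<in> set d \<Longrightarrow> (x, y) \<in> S \<Longrightarrow> x \<in> set d"
proof -
  have ne: "d \<noteq> []" using c unfolding comp_of_def by blast
  have arc: "(d ! i, d ! Suc i) \<in> S" if "Suc i < length d" for i
    using c that unfolding comp_of_def by blast
  have ends: "(last d, hd d) \<in> S \<or> (\<forall>x. (x, hd d) \<notin> S) \<and> (\<forall>y. (last d, y) \<notin> S)"
    using c unfolding comp_of_def by blast
  show "y \<in> set d" if x: "x \<in> set d" "(x, y) \<in> S"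
  proof -
    obtain i where i: "i < length d" "d ! i = x" using x(1) by (auto simp: in_set_conv_nth)
    show ?thesis
    proof (cases "Suc i < length d")
      case True
      then have "d ! Suc i = y" using arc[OF True] x(2) i S_su by simp
      then show ?thesis using True by auto
    next
      case False
      then have "i = length d - 1" using i by simp
      then have "last d = x" using i ne by (simp add: last_conv_nth)
      then have "hd d = y" using ends x(2) S_su by auto
      then show ?thesis using ne by auto
    qed
  qed
  show "x \<in> set d" if y: "y \<in> set d" "(x, y) \<in> S"
  proof -
    obtain i where i: "i < length d" "d ! i = y" using y(1) by (auto simp: in_set_conv_nth)
    show ?thesis
    proof (cases i)
      case (Suc j)
      then have "(d ! j, y) \<in> S" using arc[of j] i by simp
      then have "d ! j = x" using y(2) S_pr by simp
      then show ?thesis using i Suc by auto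
    next
      case 0
      then have "hd d = y" using i ne by (simp add: hd_conv_nth)
      then have "last d = x" using ends y(2) S_pr by auto
      then show ?thesis using ne by auto
    qed
  qed
qed

definition cyclic_outside where
  "cyclic_outside ds \<longleftrightarrow> (\<forall>v<n. v \<notin> set (concat ds) \<longrightarrow> (\<exists>x. (x, v) \<in> S) \<and> (\<exists>y. (v, y) \<in> S))"

text \<open>On the remaining vertices the predecessor map is an injective self-map of a finite set,
  hence surjective; so each of them has a successor too and lies on a cycle.\<close>

lemma cyclic_outside:
  assumes comps: "\<forall>d\<in>set ds. comp_of S d" and all: "\<And>v. v < n \<Longrightarrow> pr v = 0 \<Longrightarrow> v \<in> set (concat ds)"
  shows "cyclic_outside ds"
proof -
  define X where "X = {v. v < n \<and> v \<notin> set (concat ds)}"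
  define f where "f v = pr v - 1" for v
  have f: "(f v, v) \<in> S" "f v \<in> X" if v: "v \<in> X" for v
  proof -
    have "pr v \<noteq> 0" "v < n" using all v unfolding X_def by auto
    then show fv: "(f v, v) \<in> S" using S_pr unfolding f_def by simp
    have "f v \<notin> set (concat ds)"
    proof
      assume "f v \<in> set (concat ds)"
      then obtain d where "d \<in> set ds" "f v \<in> set d" by auto
      then have "v \<in> set d" using comp_closed(1) comps fv by blast
      then show False using v \<open>d \<in> set ds\<close> unfolding X_def by auto
    qed
    then show "f v \<in> X" using fv S_su unfolding X_def by blast
  qed
  have "finite X" unfolding X_def by simp
  moreover have "f ` X \<subseteq> X" using f(2) by blast
  moreover have "inj_on f X"
  proof (rule inj_onI)
    fix x y assume "x \<in> X" "y \<in> X" "f x = f y"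
    then have "(f x, x) \<in> S" "(f x, y) \<in> S" using f(1) by metis+
    then show "x = y" using S_su by simp
  qed
  ultimately have "f ` X = X" by (rule endo_inj_surj)
  then have "\<exists>y. (v, y) \<in> S" if "v \<in> X" for v using that f(1) by (metis imageE)
  then show ?thesis using f(1) unfolding cyclic_outside_def X_def by blast
qed

text \<open>\<open>ds\<close> are the finished components, \<open>z\<close> is the walk so far and
  \<open>u - 1\<close> its next vertex, with \<open>u = 0\<close> between walks. The two clauses on
  \<open>i\<close> describe the two rounds: vertices without predecessor first, then all
  vertices.\<close>

definition walk_inv where
  "walk_inv i u vis ds z \<longleftrightarrow> (\<forall>d\<in>set ds. comp_of S d) \<and> distinct (concat ds @ z) \<and>
     (\<forall>v. vis v = (if v \<in> set (concat ds @ z) then 1 else 0)) \<and> set (concat ds @ z) \<subseteq> {..<n} \<and>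
     (if u = 0 then z = []
      else u - 1 < n \<and> u - 1 \<notin> set (concat ds @ z) \<and> successively (\<lambda>x y. (x, y) \<in> S) (z @ [u - 1]) \<and>
        (pr (hd (z @ [u - 1])) = 0 \<or> cyclic_outside ds)) \<and>
     (\<forall>v<n. v < i \<longrightarrow> pr v = 0 \<longrightarrow> v \<in> set (concat ds @ z) \<or> u = Suc v) \<and>
     (\<forall>v<n. n + v < i \<longrightarrow> v \<in> set (concat ds @ z) \<or> u = Suc v)"
  for i u :: nat and vis :: "nat \<Rightarrow> nat"

lemma walk_start:
  assumes I: "walk_inv i 0 vis ds z" and i: "i < 2 * n"
    and v: "v = (if i < n then i else i - n)"
    and u: "u = (if pr i = 0 \<and> vis v = 0 then Suc v else 0)"
  shows "walk_inv (Suc i) u vis ds z" "z = []"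
proof -
  have z: "z = []" and comps: "\<forall>d\<in>set ds. comp_of S d" and dist: "distinct (concat ds)"
    and vis: "\<And>v. vis v = (if v \<in> set (concat ds) then 1 else 0)" and sub: "set (concat ds) \<subseteq> {..<n}"
    and low: "\<And>v. v < n \<Longrightarrow> v < i \<Longrightarrow> pr v = 0 \<Longrightarrow> v \<in> set (concat ds)"
    and low': "\<And>v. v < n \<Longrightarrow> n + v < i \<Longrightarrow> v \<in> set (concat ds)"
    using I unfolding walk_inv_def by auto
  show "z = []" by (rule z)
  have vn: "v < n" using i v by auto
  have vis_v: "vis v = 0 \<longleftrightarrow> v \<notin> set (concat ds)" using vis by simp
  have start: "v \<notin> set (concat ds) \<and> (pr v = 0 \<or> cyclic_outside ds)" if "u \<noteq> 0"
  proof (cases "i < n")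
    case True
    then show ?thesis using that u v vis_v by (auto split: if_splits)
  next
    case False
    have "cyclic_outside ds" by (rule cyclic_outside[OF comps]) (use low False in auto)
    then show ?thesis using that u vis_v by (auto split: if_splits)
  qed
  have 5: "w \<in> set (concat ds) \<or> u = Suc w" if w: "w < n" "w < Suc i" "pr w = 0" for w
  proof (cases "w < i")
    case True
    then show ?thesis using low w by blast
  next
    case False
    then have "w = i" using w by simp
    then show ?thesis using w u v vis_v by (cases "vis v = 0") auto
  qed
  have 6: "w \<in> set (concat ds) \<or> u = Suc w" if w: "w < n" "n + w < Suc i" for w
  proof (cases "n + w < i")
    case True
    then show ?thesis using low' w by blast
  next
    case False
    then have "i = n + w" using w by simp
    then show ?thesis using w u v vis_v pr_0[of i] by (cases "vis v = 0") auto
  qed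
  have u': "u - 1 = v" if "u \<noteq> 0" using u that by (auto split: if_splits)
  show "walk_inv (Suc i) u vis ds z"
    unfolding walk_inv_def z append_Nil2 append_Nil
    using comps dist vis sub vn start u' 5 6 by (cases "u = 0") (simp_all del: set_concat)
qed

text \<open>If there is no successor, the walk began at a vertex without predecessor and is a
  maximal path. If the successor is already visited, it is the first vertex of the walk: finished
  components are closed under arcs, and a later vertex of the walk has its predecessor on
  it.\<close>

lemma walk_step:
  assumes I: "walk_inv i u vis ds z" and u: "u \<noteq> 0" and v: "v = u - 1"
    and vis': "vis' = vis(v := 1)"
    and u': "u' = (if su v \<noteq> 0 \<and> vis' (su v - 1) = 1 then 0 else su v)"
  shows "if u' = 0 then walk_inv i 0 vis' (ds @ [z @ [v]]) [] else walk_inv i u' vis' ds (z @ [v])"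
proof -
  have comps: "\<forall>d\<in>set ds. comp_of S d" and dist: "distinct (concat ds @ z)"
    and vis: "\<And>v. vis v = (if v \<in> set (concat ds @ z) then 1 else 0)" and sub: "set (concat ds @ z) \<subseteq> {..<n}"
    and vn: "v < n" "v \<notin> set (concat ds @ z)" and chain: "successively (\<lambda>x y. (x, y) \<in> S) (z @ [v])"
    and start: "pr (hd (z @ [v])) = 0 \<or> cyclic_outside ds"
    and low: "\<And>w. w < n \<Longrightarrow> w < i \<Longrightarrow> pr w = 0 \<Longrightarrow> w \<in> set (concat ds @ z) \<or> w = v"
    and low': "\<And>w. w < n \<Longrightarrow> n + w < i \<Longrightarrow> w \<in> set (concat ds @ z) \<or> w = v"
    using I u v unfolding walk_inv_def by auto
  let ?z = "z @ [v]"
  have vis'_eq: "vis' w = (if w \<in> set (concat ds @ ?z) then 1 else 0)" for w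
    unfolding vis' using vis vn by auto
  have arc: "(?z ! j, ?z ! Suc j) \<in> S" if "Suc j < length ?z" for j
    using chain that unfolding successively_conv_nth by blast
  show ?thesis
  proof (cases "u' = 0")
    case True
    have "comp_of S ?z"
    proof -
      have "(last ?z, hd ?z) \<in> S \<or> (\<forall>x. (x, hd ?z) \<notin> S) \<and> (\<forall>y. (last ?z, y) \<notin> S)"
      proof (cases "su v = 0")
        case True
        then have no: "(v, y) \<notin> S" for y using S_su by simp
        have "\<not> cyclic_outside ds" using no vn unfolding cyclic_outside_def by auto
        then have "pr (hd ?z) = 0" using start by blast
        then show ?thesis using no S_pr by simp
      next
        case False
        let ?w = "su v - 1"
        have vw: "(v, ?w) \<in> S" using False vn S_su by simp
        have "vis' ?w = 1"
        proof (rule ccontr)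
          assume "vis' ?w \<noteq> 1"
          then have "u' = su v" using u' by simp
          then show False using True False by simp
        qed
        then have "?w \<in> set (concat ds @ ?z)" unfolding vis'_eq[of ?w] by (metis zero_neq_one)
        then have w: "?w \<in> set (concat ds) \<or> ?w \<in> set ?z" by auto
        have "?w \<notin> set (concat ds)"
        proof
          assume "?w \<in> set (concat ds)"
          then obtain d where "d \<in> set ds" "?w \<in> set d" by auto
          then have "v \<in> set d" using comp_closed(2) comps vw by blast
          then show False using vn \<open>d \<in> set ds\<close> by auto
        qed
        then obtain j where j: "j < length ?z" "?z ! j = ?w" using w by (metis in_set_conv_nth)
        have "j = 0"
        proof (rule ccontr)
          assume j0: "j \<noteq> 0"
          then have "(?z ! (j - 1), ?w) \<in> S" using arc[of "j - 1"] j by simp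
          then have "?z ! (j - 1) = v" using vw S_pr by simp
          moreover have "j - 1 < length z" using j j0 by simp
          then have "?z ! (j - 1) \<in> set z" by (simp add: nth_append)
          ultimately show False using vn by auto
        qed
        then have "hd ?z = ?w" using j by (simp add: hd_conv_nth)
        then show ?thesis using vw by simp
      qed
      then show ?thesis using dist vn arc unfolding comp_of_def by auto
    qed
    moreover have "concat (ds @ [?z]) @ [] = concat ds @ ?z" by simp
    ultimately have "walk_inv i 0 vis' (ds @ [?z]) []"
      unfolding walk_inv_def
    proof (intro conjI)
      show "\<forall>w<n. w < i \<longrightarrow> pr w = 0 \<longrightarrow> w \<in> set (concat (ds @ [?z]) @ []) \<or> 0 = Suc w" using low by auto
      show "\<forall>w<n. n + w < i \<longrightarrow> w \<in> set (concat (ds @ [?z]) @ []) \<or> 0 = Suc w" using low' by auto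
      show "\<forall>w. vis' w = (if w \<in> set (concat (ds @ [?z]) @ []) then 1 else 0)"
        unfolding vis'_eq by simp
    qed (use comps dist vn sub in auto)
    then show ?thesis using True by simp
  next
    case False
    then have w: "u' = su v" "vis' (u' - 1) \<noteq> 1" using u' by (auto split: if_splits)
    then have vw: "(v, u' - 1) \<in> S" using False vn S_su by simp
    have "walk_inv i u' vis' ds ?z"
      unfolding walk_inv_def
    proof (intro conjI)
      show "distinct (concat ds @ ?z)" using dist vn by auto
      show "\<forall>w. vis' w = (if w \<in> set (concat ds @ ?z) then 1 else 0)" using vis'_eq by blast
      show "set (concat ds @ ?z) \<subseteq> {..<n}" using sub vn by auto
      show "\<forall>w<n. w < i \<longrightarrow> pr w = 0 \<longrightarrow> w \<in> set (concat ds @ ?z) \<or> u' = Suc w" using low by auto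
      show "\<forall>w<n. n + w < i \<longrightarrow> w \<in> set (concat ds @ ?z) \<or> u' = Suc w" using low' by auto
      have "successively (\<lambda>x y. (x, y) \<in> S) (?z @ [u' - 1])"
        using chain vw by (subst successively_append_iff) simp
      moreover have "hd (?z @ [u' - 1]) = hd ?z" by (cases z) simp_all
      moreover have "u' - 1 \<notin> set (concat ds @ ?z)"
      proof
        assume "u' - 1 \<in> set (concat ds @ ?z)"
        then have "vis' (u' - 1) = 1" unfolding vis'_eq by (rule if_P)
        then show False using w(2) by simp
      qed
      moreover have "u' - 1 < n" using vw S_pr by blast
      ultimately show "if u' = 0 then ?z = []
        else u' - 1 < n \<and> u' - 1 \<notin> set (concat ds @ ?z) \<and> successively (\<lambda>x y. (x, y) \<in> S) (?z @ [u' - 1]) \<and>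
          (pr (hd (?z @ [u' - 1])) = 0 \<or> cyclic_outside ds)"
        using start False by simp
    qed (rule comps)
    then show ?thesis using False by simp
  qed
qed

text \<open>\<open>c\<close> is the length of the unfinished last list, reduced to 0 when that list
  is full; \<open>c = 0\<close> thus makes the next vertex open a new list.\<close>

definition cut_inv where
  "cut_inv c outs ds z \<longleftrightarrow> concat outs = concat ds @ z \<and>
     (\<forall>p\<in>set outs. p \<noteq> [] \<and> length p \<le> k \<and> successively (\<lambda>x y. (x, y) \<in> S) p) \<and>
     length outs = (\<Sum>d\<leftarrow>ds. pieces k (length d)) + pieces k (length z) \<and>
     c = length z mod k \<and> (c \<noteq> 0 \<longrightarrow> outs \<noteq> [] \<and> length (last outs) = c)"

lemma cut_step:
  assumes I: "cut_inv c outs ds z" and chain: "successively (\<lambda>x y. (x, y) \<in> S) (z @ [v])"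
    and c': "c' = (if Suc c = k then 0 else Suc c)"
    and outs': "outs' = (if c = 0 then outs @ [[v]] else butlast outs @ [last outs @ [v]])"
  shows "cut_inv c' outs' ds (z @ [v])"
proof -
  have con: "concat outs = concat ds @ z"
    and ps: "\<And>p. p \<in> set outs \<Longrightarrow> p \<noteq> [] \<and> length p \<le> k \<and> successively (\<lambda>x y. (x, y) \<in> S) p"
    and len: "length outs = (\<Sum>d\<leftarrow>ds. pieces k (length d)) + pieces k (length z)"
    and c: "c = length z mod k" "c \<noteq> 0 \<Longrightarrow> outs \<noteq> [] \<and> length (last outs) = c"
    using I unfolding cut_inv_def by blast+
  have ck: "c < k" using c(1) k by simp
  have c'_mod: "c' = length (z @ [v]) mod k" unfolding c' c(1) by (simp add: mod_Suc)
  have pz: "pieces k (length (z @ [v])) = pieces k (length z) + (if c = 0 then 1 else 0)"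
    using pieces_Suc[OF k, of "length z"] c(1) by simp
  have c'_Suc: "c' \<noteq> 0 \<Longrightarrow> c' = Suc c" unfolding c' by (simp split: if_splits)
  show ?thesis
  proof (cases "c = 0")
    case True
    show ?thesis
      unfolding cut_inv_def
    proof (intro conjI)
      show "c' \<noteq> 0 \<longrightarrow> outs' \<noteq> [] \<and> length (last outs') = c'" using c'_Suc True outs' by auto
    qed (use True con ps len pz c'_mod k outs' in auto)
  next
    case False
    then obtain os l where outs: "outs = os @ [l]" and l: "length l = c"
      using c(2) by (metis append_butlast_last_id)
    have "l \<noteq> []" using l False by auto
    have "z \<noteq> []" using False c(1) by auto
    \<comment> \<open>The last list and the current walk end in the same vertex, because both end
      the same concatenation; the arc into \<open>v\<close> therefore extends the list as a
      path.\<close>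
    have "last l = last z"
    proof -
      have "last (concat outs) = last l" unfolding outs using \<open>l \<noteq> []\<close> by simp
      moreover have "last (concat outs) = last z" unfolding con using \<open>z \<noteq> []\<close> by simp
      ultimately show ?thesis by simp
    qed
    moreover have "(last z, v) \<in> S"
      using chain \<open>z \<noteq> []\<close> by (subst (asm) successively_append_iff) simp
    ultimately have "successively (\<lambda>x y. (x, y) \<in> S) (l @ [v])"
      using ps[of l] outs \<open>l \<noteq> []\<close> by (subst successively_append_iff) simp
    moreover have "length (l @ [v]) \<le> k" using l ck by simp
    moreover have o': "outs' = os @ [l @ [v]]" using outs' outs False by simp
    ultimately show ?thesis
      unfolding cut_inv_def
    proof (intro conjI)
      show "c' \<noteq> 0 \<longrightarrow> outs' \<noteq> [] \<and> length (last outs') = c'" using c'_Suc l o' by simp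
      show "c' = length (z @ [v]) mod k" by (rule c'_mod)
    qed (use con ps len pz False outs in auto)
  qed
qed

lemma cut_finish: "cut_inv c outs ds z \<Longrightarrow> cut_inv 0 outs (ds @ [z]) []"
  unfolding cut_inv_def using pieces_0[OF k] by auto

end

section \<open>The output program\<close>

definition emit_start :: com where
  "emit_start =
    If (Less (Reg ''i'') (Reg ''n'')) (Assign ''v'' (Reg ''i'')) (Assign ''v'' (Sub (Reg ''i'') (Reg ''n''))) ;;
    If (And (Equal (Get ''pr'' (Reg ''i'')) (Const 0)) (Equal (Get ''vis'' (Reg ''v'')) (Const 0)))
      (Assign ''u'' (Add (Reg ''v'') (Const 1)) ;; Assign ''c'' (Const 0)) Skip ;;
    Assign ''i'' (Add (Reg ''i'') (Const 1))"

definition emit_next :: "nat \<Rightarrow> com" where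
  "emit_next k =
    If (Equal (Reg ''c'') (Const k)) (Assign ''c'' (Const 0)) Skip ;;
    Assign ''u'' (Get ''su'' (Reg ''v'')) ;;
    If (And (Not (Equal (Reg ''u'') (Const 0))) (Equal (Get ''vis'' (Sub (Reg ''u'') (Const 1))) (Const 1)))
      (Assign ''u'' (Const 0)) Skip"

definition emit_step :: "nat \<Rightarrow> com" where
  "emit_step k =
    If (Equal (Reg ''c'') (Const 0)) (Assign ''q'' (Add (Reg ''q'') (Const 1))) Skip ;;
    Assign ''v'' (Sub (Reg ''u'') (Const 1)) ;;
    Put ''path'' (Reg ''p'') (Reg ''v'') ;;
    Assign ''p'' (Add (Reg ''p'') (Const 1)) ;;
    Put ''start'' (Reg ''q'') (Reg ''p'') ;;
    Put ''vis'' (Reg ''v'') (Const 1) ;;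
    Assign ''c'' (Add (Reg ''c'') (Const 1)) ;;
    emit_next k"

definition emit :: "nat \<Rightarrow> com" where
  "emit k =
    (Assign ''i'' (Const 0) ;; Assign ''u'' (Const 0) ;; Assign ''p'' (Const 0) ;; Assign ''q'' (Const 0)) ;;
    While (Less (Const 0) (Add (Reg ''u'') (Sub (Add (Reg ''n'') (Reg ''n'')) (Reg ''i''))))
      (If (Equal (Reg ''u'') (Const 0)) emit_start (emit_step k))"

lemma cost_emit: "cost emit_start \<le> 60" "cost (emit_step k) \<le> 80"
  by (simp_all add: emit_start_def emit_step_def emit_next_def)

lemma length_le_length_concat: "(\<And>p. p \<in> set ps \<Longrightarrow> p \<noteq> []) \<Longrightarrow> length ps \<le> length (concat ps)"
proof (induction ps)
  case (Cons p ps)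
  then have "length ps \<le> length (concat ps)" "p \<noteq> []" by simp_all
  then show ?case by (cases p) simp_all
qed simp

text \<open>
  The counter runs over the vertices twice. As \<open>pr\<close> vanishes from position \<open>n\<close> on, a walk starts at a
  vertex without predecessor in the first round and at any unvisited vertex, thus on a cycle, in the second.
\<close>

lemma (in walking) emit:
  assumes s: "reg s ''n'' = n" "arr s ''su'' = su" "arr s ''pr'' = pr"
    and zero: "arr s ''vis'' = (\<lambda>_. 0)" "arr s ''start'' = (\<lambda>_. 0)" and B: "2 * n + 2 \<le> B"
  shows "runs B (emit k) s (400 * n + 100)
    (\<lambda>s'. \<exists>ds. (\<forall>d\<in>set ds. comp_of S d) \<and> distinct (concat ds) \<and> set (concat ds) = {..<n} \<and>
      concat (output_paths s') = concat ds \<and>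
      (\<forall>p\<in>set (output_paths s'). p \<noteq> [] \<and> length p \<le> k \<and> successively (\<lambda>x y. (x, y) \<in> S) p) \<and>
      length (output_paths s') = (\<Sum>d\<leftarrow>ds. pieces k (length d)))"
proof -
  \<comment> \<open>Between walks the register \<open>c\<close> is out of date; it counts as 0 there
    and is reset when the next walk starts.\<close>
  define J where "J s' outs ds z \<longleftrightarrow> out_rep (arr s' ''path'') (arr s' ''start'') outs \<and> reg s' ''q'' = length outs \<and>
      reg s' ''p'' = length (concat outs) \<and> walk_inv (reg s' ''i'') (reg s' ''u'') (arr s' ''vis'') ds z \<and>
      cut_inv (if reg s' ''u'' = 0 then 0 else reg s' ''c'') outs ds z" for s' :: store and outs ds z
  \<comment> \<open>Each round either outputs a vertex or advances the counter, which gives the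
    potential \<open>3 * n\<close> at the start.\<close>
  define I where "I v s' \<longleftrightarrow> reg s' ''n'' = n \<and> arr s' ''su'' = su \<and> arr s' ''pr'' = pr \<and> reg s' ''i'' \<le> 2 * n \<and>
      v = (n - reg s' ''p'') + (2 * n - reg s' ''i'') \<and> (\<exists>outs ds z. J s' outs ds z)" for v and s' :: store
  have p_le: "length (concat outs) \<le> n" "length outs \<le> n" "length z \<le> n" if "J s' outs ds z" for s' :: store and outs ds z
  proof -
    have d: "concat outs = concat ds @ z" "distinct (concat ds @ z)" "set (concat ds @ z) \<subseteq> {..<n}"
      and ne: "\<And>p. p \<in> set outs \<Longrightarrow> p \<noteq> []"
      using that unfolding J_def walk_inv_def cut_inv_def by blast+
    have "card (set (concat ds @ z)) \<le> n" using card_mono[OF _ d(3)] by simp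
    then show 1: "length (concat outs) \<le> n" unfolding d(1) distinct_card[OF d(2)] .
    show "length outs \<le> n" using length_le_length_concat[of outs, OF ne] 1 by linarith
    show "length z \<le> n" using 1 unfolding d(1) by simp
  qed
  show ?thesis
    unfolding emit_def
  proof (rule runs_Seq[where ?T1.0 = 20 and ?T2.0 = "400 * n + 70" and R = "I (3 * n)"], goal_cases)
    case 1
    have "J s1 [] [] []" if "reg s1 ''i'' = 0" "reg s1 ''u'' = 0" "reg s1 ''p'' = 0" "reg s1 ''q'' = 0"
      "arr s1 ''vis'' = (\<lambda>_. 0)" "arr s1 ''start'' = (\<lambda>_. 0)" for s1
      using that k unfolding J_def walk_inv_def cut_inv_def out_rep_def by (simp add: pieces_0)
    then have "\<exists>outs ds z. J s1 outs ds z" if "reg s1 ''i'' = 0" "reg s1 ''u'' = 0" "reg s1 ''p'' = 0" "reg s1 ''q'' = 0"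
      "arr s1 ''vis'' = (\<lambda>_. 0)" "arr s1 ''start'' = (\<lambda>_. 0)" for s1
      using that by blast
    then show ?case
      using s zero by (intro runs_wpI) (simp_all add: I_def)
  next
    case (2 s0)
    show ?case
    proof (rule runs_WhileI[where I = I and v = "3 * n" and K = 100], goal_cases)
      case 1
      show ?case by (rule 2)
    next
      case (2 v s')
      let ?u = "reg s' ''u''" and ?i = "reg s' ''i''" and ?p = "reg s' ''p''" and ?q = "reg s' ''q''" and ?c = "reg s' ''c''"
        and ?vis = "arr s' ''vis''"
      have s': "reg s' ''n'' = n" "arr s' ''su'' = su" "arr s' ''pr'' = pr" "?i \<le> 2 * n"
        and v: "v = (n - ?p) + (2 * n - ?i)" using 2(1) unfolding I_def by blast+
      obtain outs ds z where J: "J s' outs ds z" using 2(1) unfolding I_def by blast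
      have o: "out_rep (arr s' ''path'') (arr s' ''start'') outs" "?q = length outs" "?p = length (concat outs)"
        and w: "walk_inv ?i ?u ?vis ds z" and cut: "cut_inv (if ?u = 0 then 0 else ?c) outs ds z"
        using J unfolding J_def by blast+
      show ?case
      proof (cases "?u = 0")
        case True
        have i: "?i < 2 * n" using 2(2) True s' by simp
        define x where "x = (if ?i < n then ?i else ?i - n)"
        define u where "u = (if pr ?i = 0 \<and> ?vis x = 0 then Suc x else 0)"
        note start = walk_start[OF w[unfolded True] i x_def u_def]
        have x: "x < n" using i unfolding x_def by auto
        have I1: "\<exists>v'<v. I v' s1" if "reg s1 ''n'' = n" "arr s1 ''su'' = su" "arr s1 ''pr'' = pr" "reg s1 ''i'' = Suc ?i"
          "reg s1 ''p'' = ?p" "reg s1 ''q'' = ?q" "reg s1 ''u'' = u" "u \<noteq> 0 \<longrightarrow> reg s1 ''c'' = 0" "arr s1 ''vis'' = ?vis"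
          "arr s1 ''path'' = arr s' ''path''" "arr s1 ''start'' = arr s' ''start''" for s1
        proof -
          have "J s1 outs ds z"
            using o start cut that True unfolding J_def by auto
          then have "I (v - 1) s1" using that v i unfolding I_def by auto
          moreover have "v - 1 < v" using v i by simp
          ultimately show ?thesis by blast
        qed
        have xs: "?i < n \<Longrightarrow> ?i = x" "\<not> ?i < n \<Longrightarrow> ?i - n = x" unfolding x_def by simp_all
        have "wp B emit_start (\<lambda>s'. \<exists>v'<v. I v' s') s'"
        proof (cases "pr ?i = 0 \<and> ?vis x = 0")
          case t: True
          then have "u = Suc x" unfolding u_def by simp
          then show ?thesis
            using t s' B i x xs by (cases "?i < n") (simp_all add: emit_start_def I1)
        next
          case t: False
          then have u0: "u = 0" unfolding u_def by (rule if_not_P)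
          from t consider "pr ?i \<noteq> 0" | "?vis x \<noteq> 0" by auto
          then show ?thesis
            by cases (use u0 True s' B i x xs in \<open>cases "?i < n"; simp add: emit_start_def I1\<close>)+
        qed
        then show ?thesis using True cost_emit(1) cost_emit(2)[of k] by (intro runs_wpI) simp_all
      next
        case False
        define x where "x = ?u - 1"
        define vis' where "vis' = ?vis(x := 1)"
        define u' where "u' = (if su x \<noteq> 0 \<and> vis' (su x - 1) = 1 then 0 else su x)"
        define c' where "c' = (if Suc ?c = k then 0 else Suc ?c)"
        define outs' where "outs' = (if ?c = 0 then outs @ [[x]] else butlast outs @ [last outs @ [x]])"
        define q' where "q' = (if ?c = 0 then Suc ?q else ?q)"
        note step = walk_step[OF w False x_def vis'_def u'_def]
        have chain: "successively (\<lambda>x y. (x, y) \<in> S) (z @ [x])"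
          using w False unfolding walk_inv_def x_def by simp
        have cut_c: "cut_inv ?c outs ds z" using cut False by simp
        note cut' = cut_step[OF cut_c chain c'_def outs'_def]
        have ne: "outs \<noteq> []" if "?c \<noteq> 0" using cut_c that unfolding cut_inv_def by blast
        have o': "out_rep ((arr s' ''path'')(?p := x)) ((arr s' ''start'')(q' := Suc ?p)) outs'" "q' = length outs'"
          using out_rep_new[OF o(1,3), of x] out_rep_extend[OF o(1,3) ne, of x] ne o(2)
          unfolding outs'_def q'_def by auto
        have len: "length (concat outs') = Suc ?p"
        proof -
          have "concat outs = concat ds @ z" "concat outs' = concat ds @ z @ [x]"
            using cut_c cut' unfolding cut_inv_def by auto
          then show ?thesis using o(3) by simp
        qed
        have ex: "\<exists>ds z. J s1 outs' ds z" if "reg s1 ''i'' = ?i" "reg s1 ''p'' = Suc ?p" "reg s1 ''q'' = q'"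
          "reg s1 ''u'' = u'" "reg s1 ''c'' = c'" "arr s1 ''vis'' = vis'"
          "arr s1 ''path'' = (arr s' ''path'')(?p := x)" "arr s1 ''start'' = (arr s' ''start'')(q' := Suc ?p)" for s1
        proof (cases "u' = 0")
          case True
          then have "J s1 outs' (ds @ [z @ [x]]) []"
            using that o' len step cut_finish[OF cut'] unfolding J_def by simp
          then show ?thesis by blast
        next
          case False
          then have "J s1 outs' ds (z @ [x])"
            using that o' len step cut' unfolding J_def by simp
          then show ?thesis by blast
        qed
        have p_n: "Suc ?p \<le> n" "q' \<le> n"
        proof -
          define s1 where "s1 = s'\<lparr>reg := (reg s')(''p'' := Suc ?p, ''q'' := q', ''u'' := u', ''c'' := c'),
            arr := (arr s')(''vis'' := vis', ''path'' := (arr s' ''path'')(?p := x),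
              ''start'' := (arr s' ''start'')(q' := Suc ?p))\<rparr>"
          have "\<exists>ds z. J s1 outs' ds z" by (rule ex) (simp_all add: s1_def)
          then obtain ds' z' where "J s1 outs' ds' z'" by blast
          from p_le(1,2)[OF this] len o'(2) show "Suc ?p \<le> n" "q' \<le> n" by simp_all
        qed
        have I1: "\<exists>v'<v. I v' s1" if "reg s1 ''n'' = n" "arr s1 ''su'' = su" "arr s1 ''pr'' = pr" "reg s1 ''i'' = ?i"
          "reg s1 ''p'' = Suc ?p" "reg s1 ''q'' = q'" "reg s1 ''u'' = u'" "reg s1 ''c'' = c'" "arr s1 ''vis'' = vis'"
          "arr s1 ''path'' = (arr s' ''path'')(?p := x)" "arr s1 ''start'' = (arr s' ''start'')(q' := Suc ?p)" for s1
        proof -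
          have "I (v - 1) s1" using that ex[of s1] v p_n s'(4) unfolding I_def by auto
          moreover have "v - 1 < v" using v p_n by simp
          ultimately show ?thesis by blast
        qed
        have x: "x < n" using w False unfolding walk_inv_def x_def by simp
        have su_le: "su x \<le> n"
        proof (cases "su x")
          case (Suc y)
          then have "(x, y) \<in> S" using S_su x by blast
          then show ?thesis using S_pr Suc by simp
        qed simp
        have c_n: "Suc ?c \<le> Suc n"
        proof -
          have "?c = length z mod k" using cut_c unfolding cut_inv_def by blast
          then show ?thesis using p_le(3)[OF J] mod_less_eq_dividend[of "length z" k] by linarith
        qed
        have ux: "?u - Suc 0 = x" unfolding x_def by simp
        have qc: "?c = 0 \<Longrightarrow> Suc ?q = q'" "?c \<noteq> 0 \<Longrightarrow> ?q = q'" unfolding q'_def by simp_all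
        have tail: "wp B (emit_next k) (\<lambda>s'. \<exists>v'<v. I v' s') s2"
          if "reg s2 ''n'' = n" "arr s2 ''su'' = su" "arr s2 ''pr'' = pr" "reg s2 ''i'' = ?i" "reg s2 ''v'' = x"
          "reg s2 ''p'' = Suc ?p" "reg s2 ''q'' = q'" "reg s2 ''c'' = Suc ?c" "arr s2 ''vis'' = vis'"
          "arr s2 ''path'' = (arr s' ''path'')(?p := x)" "arr s2 ''start'' = (arr s' ''start'')(q' := Suc ?p)" for s2
          using that su_le B
          by (cases "Suc ?c = k"; cases "su x \<noteq> 0 \<and> vis' (su x - 1) = 1")
            (simp_all add: emit_next_def I1 u'_def c'_def)
        have "wp B (emit_step k) (\<lambda>s'. \<exists>v'<v. I v' s') s'"
          unfolding emit_step_def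
          using p_n c_n x B s' qc
          by (cases "?c = 0") (simp_all add: ux tail vis'_def)
        then show ?thesis using False cost_emit(1) cost_emit(2)[of k] by (intro runs_wpI) simp_all
      qed
    next
      case 3
      show ?case by simp
    next
      case (4 v s')
      then have u: "reg s' ''u'' = 0" and i: "2 * n \<le> reg s' ''i''" unfolding I_def by auto
      obtain outs ds z where J: "J s' outs ds z" using 4(1) unfolding I_def by blast
      then have w: "walk_inv (reg s' ''i'') 0 (arr s' ''vis'') ds z" and cut: "cut_inv 0 outs ds z"
        using u unfolding J_def by auto
      then have z: "z = []" unfolding walk_inv_def by simp
      have out: "output_paths s' = outs" using J output_paths_out_rep unfolding J_def by blast
      have "set (concat ds) = {..<n}"
      proof
        show "set (concat ds) \<subseteq> {..<n}" using w z unfolding walk_inv_def by simp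
        show "{..<n} \<subseteq> set (concat ds)"
        proof
          fix x assume "x \<in> {..<n}"
          then have "x < n" "n + x < reg s' ''i'' \<or> reg s' ''i'' = 2 * n" using i by auto
          moreover have "reg s' ''i'' \<le> 2 * n" using 4(1) unfolding I_def by blast
          ultimately have "x < n" "n + x < reg s' ''i''" using i by auto
          then show "x \<in> set (concat ds)" using w z unfolding walk_inv_def by auto
        qed
      qed
      then show ?case
        using w cut z unfolding walk_inv_def cut_inv_def out by (intro exI[of _ ds]) (simp add: pieces_0[OF k])
    qed
  qed simp
qed

section \<open>Connecting the phases\<close>

definition out_of :: "(nat \<Rightarrow> nat) \<Rightarrow> (nat \<Rightarrow> nat) \<Rightarrow> nat \<Rightarrow> nat" where
  "out_of mate e x = (if mate x = 0 then 0 else Suc (e (mate x - 1)))"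

text \<open>Successor and predecessor agree exactly on 2-cycles. The number is the smaller vertex
  plus one, the same for both vertices.\<close>

definition pair_id :: "(nat \<Rightarrow> nat) \<Rightarrow> (nat \<Rightarrow> nat) \<Rightarrow> nat \<Rightarrow> nat" where
  "pair_id su pr v = (if su v \<noteq> 0 \<and> su v = pr v then min (su v) (Suc v) else 0)"

text \<open>\<open>rep\<close> is stored twice, at \<open>i\<close> and at \<open>n + i\<close>,
  because a right vertex of the second matching is some \<open>x\<close> or \<open>n + x\<close>;
  the 2-cycle at the outer end can then be looked up without a case distinction.\<close>

definition read_matching :: com where
  "read_matching =
    Assign ''i'' (Const 0) ;;
    While (Less (Reg ''i'') (Reg ''n''))
     (If (Equal (Get ''1L'' (Reg ''i'')) (Const 0)) Skip
        (Put ''su'' (Reg ''i'') (Add (Get ''head'' (Sub (Get ''1L'' (Reg ''i'')) (Const 1))) (Const 1))) ;;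
      If (Equal (Get ''1R'' (Reg ''i'')) (Const 0)) Skip
        (Put ''pr'' (Reg ''i'') (Add (Get ''tail'' (Sub (Get ''1R'' (Reg ''i'')) (Const 1))) (Const 1))) ;;
      Assign ''r'' (Const 0) ;;
      If (And (Not (Equal (Get ''su'' (Reg ''i'')) (Const 0))) (Equal (Get ''su'' (Reg ''i'')) (Get ''pr'' (Reg ''i''))))
        (If (Less (Get ''su'' (Reg ''i'')) (Add (Reg ''i'') (Const 1)))
          (Assign ''r'' (Get ''su'' (Reg ''i''))) (Assign ''r'' (Add (Reg ''i'') (Const 1))))
        Skip ;;
      Put ''rep'' (Reg ''i'') (Reg ''r'') ;;
      Put ''rep'' (Add (Reg ''i'') (Reg ''n'')) (Reg ''r'') ;;
      Assign ''i'' (Add (Reg ''i'') (Const 1)))"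

lemma read_matching:
  assumes s: "reg s ''n'' = n" "arr s ''tail'' = T" "arr s ''head'' = H"
    and zero: "arr s ''su'' = (\<lambda>_. 0)" "arr s ''pr'' = (\<lambda>_. 0)"
    and L: "\<And>x. arr s ''1L'' x \<noteq> 0 \<Longrightarrow> x < n \<and> H (arr s ''1L'' x - 1) < n"
    and R: "\<And>x. arr s ''1R'' x \<noteq> 0 \<Longrightarrow> x < n \<and> T (arr s ''1R'' x - 1) < n"
    and B: "2 * n + 2 \<le> B"
  shows "runs B read_matching s (150 * n + 20)
    (\<lambda>s'. arr s' ''su'' = out_of (arr s ''1L'') H \<and> arr s' ''pr'' = out_of (arr s ''1R'') T \<and>
      (\<forall>v<n. arr s' ''rep'' v = pair_id (arr s' ''su'') (arr s' ''pr'') v \<and>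
         arr s' ''rep'' (n + v) = pair_id (arr s' ''su'') (arr s' ''pr'') v))"
proof -
  let ?su = "out_of (arr s ''1L'') H" and ?pr = "out_of (arr s ''1R'') T"
  define I where "I v s' \<longleftrightarrow> reg s' ''n'' = n \<and> arr s' ''tail'' = T \<and> arr s' ''head'' = H \<and>
    arr s' ''1L'' = arr s ''1L'' \<and> arr s' ''1R'' = arr s ''1R'' \<and> reg s' ''i'' \<le> n \<and> v = n - reg s' ''i'' \<and>
    arr s' ''su'' = (\<lambda>x. if x < reg s' ''i'' then ?su x else 0) \<and>
    arr s' ''pr'' = (\<lambda>x. if x < reg s' ''i'' then ?pr x else 0) \<and>
    (\<forall>v<reg s' ''i''. arr s' ''rep'' v = pair_id ?su ?pr v \<and> arr s' ''rep'' (n + v) = pair_id ?su ?pr v)"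
    for v and s' :: store
  have su_le: "?su x \<le> n" and pr_le: "?pr x \<le> n" for x
    using L[of x] R[of x] unfolding out_of_def by auto
  have su_0: "?su x = 0" and pr_0: "?pr x = 0" if "\<not> x < n" for x
    using L[of x] R[of x] that unfolding out_of_def by auto
  show ?thesis
    unfolding read_matching_def
  proof (rule runs_Seq[where ?T1.0 = 5 and ?T2.0 = "150 * n + 10" and R = "I n"], goal_cases)
    case 1
    show ?case using s zero by (intro runs_wpI) (auto simp: I_def)
  next
    case (2 s0)
    show ?case
    proof (rule runs_WhileI[where I = I and v = n and K = 100], goal_cases)
      case (2 v s')
      let ?i = "reg s' ''i''"
      have s': "reg s' ''n'' = n" "arr s' ''tail'' = T" "arr s' ''head'' = H"
        "arr s' ''1L'' = arr s ''1L''" "arr s' ''1R'' = arr s ''1R''"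
        "arr s' ''su'' = (\<lambda>x. if x < ?i then ?su x else 0)"
        "arr s' ''pr'' = (\<lambda>x. if x < ?i then ?pr x else 0)"
        and rep: "\<forall>v<?i. arr s' ''rep'' v = pair_id ?su ?pr v \<and> arr s' ''rep'' (n + v) = pair_id ?su ?pr v"
        and v: "v = n - ?i" using 2(1) unfolding I_def by blast+
      have i: "?i < n" using 2(2) s' by simp
      have fin: "\<exists>v'<v. I v' s1" if "reg s1 ''n'' = n" "arr s1 ''tail'' = T" "arr s1 ''head'' = H"
        "arr s1 ''1L'' = arr s ''1L''" "arr s1 ''1R'' = arr s ''1R''" "reg s1 ''i'' = Suc ?i"
        "arr s1 ''su'' = (arr s' ''su'')(?i := ?su ?i)" "arr s1 ''pr'' = (arr s' ''pr'')(?i := ?pr ?i)"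
        "arr s1 ''rep'' = (arr s' ''rep'')(?i := pair_id ?su ?pr ?i, ?i + n := pair_id ?su ?pr ?i)" for s1
      proof -
        have "I (v - 1) s1"
          using that i rep v unfolding I_def s'(6,7) by (auto simp: less_Suc_eq fun_eq_iff)
        moreover have "v - 1 < v" using i v by simp
        ultimately show ?thesis by blast
      qed
      have fin1: "\<exists>v'<v. I v' s1" if "reg s1 ''n'' = n" "arr s1 ''tail'' = T" "arr s1 ''head'' = H"
        "arr s1 ''1L'' = arr s ''1L''" "arr s1 ''1R'' = arr s ''1R''" "reg s1 ''i'' = Suc ?i"
        "arr s1 ''su'' = (if ?su ?i = 0 then arr s' ''su'' else (arr s' ''su'')(?i := ?su ?i))"
        "arr s1 ''pr'' = (if ?pr ?i = 0 then arr s' ''pr'' else (arr s' ''pr'')(?i := ?pr ?i))"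
        "arr s1 ''rep'' = (arr s' ''rep'')(?i := pair_id ?su ?pr ?i, ?i + n := pair_id ?su ?pr ?i)" for s1
        by (rule fin) (use that s'(6,7) in \<open>auto simp: fun_eq_iff\<close>)
      have "out_of (arr s ''1L'') H ?i = Suc (H (arr s ''1L'' ?i - Suc 0))" if "arr s ''1L'' ?i \<noteq> 0"
        using that unfolding out_of_def by simp
      moreover have "out_of (arr s ''1L'') H ?i = 0" if "arr s ''1L'' ?i = 0"
        using that unfolding out_of_def by simp
      moreover have "out_of (arr s ''1R'') T ?i = Suc (T (arr s ''1R'' ?i - Suc 0))" if "arr s ''1R'' ?i \<noteq> 0"
        using that unfolding out_of_def by simp
      moreover have "out_of (arr s ''1R'') T ?i = 0" if "arr s ''1R'' ?i = 0"
        using that unfolding out_of_def by simp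
      ultimately show ?case
        using s'(1-5) i B su_le[of ?i] pr_le[of ?i]
        by (intro runs_wpI; cases "arr s ''1L'' ?i = 0"; cases "arr s ''1R'' ?i = 0")
          (auto simp: fin1 s'(6,7) pair_id_def)
    next
      case (4 v s')
      then have "reg s' ''i'' = n" unfolding I_def by auto
      moreover have "(\<lambda>x. if x < n then ?su x else 0) = ?su" "(\<lambda>x. if x < n then ?pr x else 0) = ?pr"
        using su_0 pr_0 by (auto simp: fun_eq_iff)
      ultimately show ?case using 4(1) unfolding I_def by simp
    qed (use 2 in auto)
  qed simp
qed

section \<open>The bipartite graph between 2-cycles and outer vertices\<close>

definition add_side :: "aexp \<Rightarrow> aexp \<Rightarrow> com" where
  "add_side l r =
    If (Equal l (Const 0)) Skip
     (Put ''T'' (Reg ''k'') l ;; Put ''H'' (Reg ''k'') r ;; Put ''O'' (Reg ''k'') (Reg ''i'') ;;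
      Assign ''k'' (Add (Reg ''k'') (Const 1)))"

definition build_sides :: com where
  "build_sides =
    (Assign ''i'' (Const 0) ;; Assign ''k'' (Const 0)) ;;
    While (Less (Reg ''i'') (Reg ''m''))
     (Assign ''x'' (Get ''tail'' (Reg ''i'')) ;; Assign ''w'' (Get ''head'' (Reg ''i'')) ;;
      If (Equal (Get ''rep'' (Reg ''x'')) (Get ''rep'' (Reg ''w''))) Skip
       (add_side (Get ''rep'' (Reg ''x'')) (Reg ''w'') ;;
        add_side (Get ''rep'' (Reg ''w'')) (Add (Reg ''n'') (Reg ''x''))) ;;
      Assign ''i'' (Add (Reg ''i'') (Const 1)))"

text \<open>
  The right vertices of the second matching are \<open>H j\<close> for the arc \<open>j\<close> that leaves the 2-cycle \<open>l\<close> and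
  \<open>n + T j\<close> for the arc \<open>j\<close> that enters it.
\<close>

definition is_side where
  "is_side n T H \<rho> l r j \<longleftrightarrow> l \<noteq> 0 \<and> \<rho> (T j) \<noteq> \<rho> (H j) \<and>
     (l = \<rho> (T j) \<and> r = H j \<or> l = \<rho> (H j) \<and> r = n + T j)"
  for n l r j :: nat and T H \<rho> :: "nat \<Rightarrow> nat"

text \<open>Soundness lets a matched side be traced to an input arc, completeness lets the arcs of
  an optimal partition compete with the matching, and the bound on \<open>k\<close> keeps the second
  matching within the time of the first up to a constant factor.\<close>

definition sides where
  "sides n T H \<rho> i k T2 H2 O2 \<longleftrightarrow> k \<le> 2 * i \<and>
     (\<forall>e<k. O2 e < i \<and> is_side n T H \<rho> (T2 e) (H2 e) (O2 e)) \<and>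
     (\<forall>j<i. \<forall>l r. is_side n T H \<rho> l r j \<longrightarrow> (\<exists>e<k. T2 e = l \<and> H2 e = r))"
  for n i k :: nat and T H \<rho> T2 H2 O2 :: "nat \<Rightarrow> nat"

lemma sides_Suc:
  assumes S: "sides n T H \<rho> i k T2 H2 O2" and k': "k \<le> k'" "k' \<le> k + 2"
    and same: "\<And>e. e < k \<Longrightarrow> T2' e = T2 e \<and> H2' e = H2 e \<and> O2' e = O2 e"
    and new: "\<And>e. k \<le> e \<Longrightarrow> e < k' \<Longrightarrow> O2' e = i \<and> is_side n T H \<rho> (T2' e) (H2' e) i"
    and all: "\<And>l r. is_side n T H \<rho> l r i \<Longrightarrow> \<exists>e. k \<le> e \<and> e < k' \<and> T2' e = l \<and> H2' e = r"
  shows "sides n T H \<rho> (Suc i) k' T2' H2' O2'"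
  unfolding sides_def
proof (intro conjI allI impI)
  show "k' \<le> 2 * Suc i" using S k'(2) unfolding sides_def by simp
  fix e assume e: "e < k'"
  have "e < k \<Longrightarrow> O2 e < i \<and> is_side n T H \<rho> (T2 e) (H2 e) (O2 e)" using S unfolding sides_def by blast
  then show "O2' e < Suc i" "is_side n T H \<rho> (T2' e) (H2' e) (O2' e)"
    using same[of e] new[of e] e by (cases "e < k"; simp)+
next
  fix j l r assume j: "j < Suc i" and side: "is_side n T H \<rho> l r j"
  show "\<exists>e<k'. T2' e = l \<and> H2' e = r"
  proof (cases "j = i")
    case True
    then show ?thesis using all side by blast
  next
    case False
    then obtain e where "e < k" "T2 e = l" "H2 e = r" using S side j unfolding sides_def by (metis less_antisym)
    then show ?thesis using same[of e] k'(1) by (intro exI[of _ e]) simp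
  qed
qed

lemma build_sides:
  assumes s: "reg s ''n'' = n" "reg s ''m'' = m" "arr s ''tail'' = T" "arr s ''head'' = H"
    and TH: "\<And>j. j < m \<Longrightarrow> T j < n \<and> H j < n"
    and rep: "\<And>v. v < n \<Longrightarrow> arr s ''rep'' v = \<rho> v" "\<And>v. \<rho> v \<le> B"
    and B: "2 * n + 2 \<le> B" "2 * m + 2 \<le> B"
  shows "runs B build_sides s (120 * m + 20)
    (\<lambda>s'. sides n T H \<rho> m (reg s' ''k'') (arr s' ''T'') (arr s' ''H'') (arr s' ''O''))"
proof -
  define I where "I v s' \<longleftrightarrow> reg s' ''n'' = n \<and> reg s' ''m'' = m \<and> arr s' ''tail'' = T \<and> arr s' ''head'' = H \<and>
    arr s' ''rep'' = arr s ''rep'' \<and> reg s' ''i'' \<le> m \<and> v = m - reg s' ''i'' \<and>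
    sides n T H \<rho> (reg s' ''i'') (reg s' ''k'') (arr s' ''T'') (arr s' ''H'') (arr s' ''O'')"
    for v and s' :: store
  show ?thesis
    unfolding build_sides_def
  proof (rule runs_Seq[where ?T1.0 = 8 and ?T2.0 = "120 * m + 10" and R = "I m"], goal_cases)
    case 1
    show ?case using s by (intro runs_wpI) (auto simp: I_def sides_def)
  next
    case (2 s0)
    show ?case
    proof (rule runs_WhileI[where I = I and v = m and K = 80], goal_cases)
      case (2 v s')
      let ?i = "reg s' ''i''" and ?k = "reg s' ''k''"
        and ?T = "arr s' ''T''" and ?H = "arr s' ''H''" and ?O = "arr s' ''O''"
      have s': "reg s' ''n'' = n" "reg s' ''m'' = m" "arr s' ''tail'' = T" "arr s' ''head'' = H"
        "arr s' ''rep'' = arr s ''rep''" and v: "v = m - ?i" and S: "sides n T H \<rho> ?i ?k ?T ?H ?O"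
        using 2(1) unfolding I_def by blast+
      have i: "?i < m" using 2(2) s' by simp
      have k_le: "?k \<le> 2 * ?i" using S unfolding sides_def by blast
      have x: "T ?i < n" "H ?i < n" using TH i by auto
      note r = rep(1)[OF x(1)] rep(1)[OF x(2)]
      have fin: "\<exists>v'<v. I v' s1" if "reg s1 ''n'' = n" "reg s1 ''m'' = m" "arr s1 ''tail'' = T" "arr s1 ''head'' = H"
        "arr s1 ''rep'' = arr s ''rep''" "reg s1 ''i'' = Suc ?i"
        "sides n T H \<rho> (Suc ?i) (reg s1 ''k'') (arr s1 ''T'') (arr s1 ''H'') (arr s1 ''O'')" for s1
      proof -
        have "I (v - 1) s1" using that i v unfolding I_def by auto
        moreover have "v - 1 < v" using i v by simp
        ultimately show ?thesis by blast
      qed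
      consider "\<rho> (T ?i) = \<rho> (H ?i)" | "\<rho> (T ?i) \<noteq> 0" "\<rho> (H ?i) = 0" | "\<rho> (T ?i) = 0" "\<rho> (H ?i) \<noteq> 0"
        | "\<rho> (T ?i) \<noteq> \<rho> (H ?i)" "\<rho> (T ?i) \<noteq> 0" "\<rho> (H ?i) \<noteq> 0" by metis
      then have "wp B (Assign ''x'' (Get ''tail'' (Reg ''i'')) ;; Assign ''w'' (Get ''head'' (Reg ''i'')) ;;
        If (Equal (Get ''rep'' (Reg ''x'')) (Get ''rep'' (Reg ''w''))) Skip
         (add_side (Get ''rep'' (Reg ''x'')) (Reg ''w'') ;;
          add_side (Get ''rep'' (Reg ''w'')) (Add (Reg ''n'') (Reg ''x''))) ;;
        Assign ''i'' (Add (Reg ''i'') (Const 1))) (\<lambda>s'. \<exists>v'<v. I v' s') s'"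
      proof cases
        case 1
        have "sides n T H \<rho> (Suc ?i) ?k ?T ?H ?O"
          by (rule sides_Suc[OF S]) (use 1 in \<open>auto simp: is_side_def\<close>)
        then show ?thesis
          using 1 s' i x r rep(2) B k_le by (simp add: fin)
      next
        case 2
        have "sides n T H \<rho> (Suc ?i) (Suc ?k) (?T(?k := \<rho> (T ?i))) (?H(?k := H ?i)) (?O(?k := ?i))"
          by (rule sides_Suc[OF S]) (use 2 in \<open>auto simp: is_side_def\<close>)
        then show ?thesis
          using 2 s' i x r rep(2)[of "T ?i"] B k_le by (simp add: fin add_side_def)
      next
        case 3
        have "sides n T H \<rho> (Suc ?i) (Suc ?k) (?T(?k := \<rho> (H ?i))) (?H(?k := n + T ?i)) (?O(?k := ?i))"
          by (rule sides_Suc[OF S]) (use 3 in \<open>auto simp: is_side_def\<close>)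
        then show ?thesis
          using 3 s' i x r rep(2)[of "H ?i"] B k_le by (simp add: fin add_side_def)
      next
        case 4
        have "sides n T H \<rho> (Suc ?i) (Suc (Suc ?k)) (?T(?k := \<rho> (T ?i), Suc ?k := \<rho> (H ?i)))
          (?H(?k := H ?i, Suc ?k := n + T ?i)) (?O(?k := ?i, Suc ?k := ?i))"
        proof (rule sides_Suc[OF S])
          fix l q assume "is_side n T H \<rho> l q ?i"
          then have "l = \<rho> (T ?i) \<and> q = H ?i \<or> l = \<rho> (H ?i) \<and> q = n + T ?i" unfolding is_side_def by blast
          then show "\<exists>e. ?k \<le> e \<and> e < Suc (Suc ?k) \<and> (?T(?k := \<rho> (T ?i), Suc ?k := \<rho> (H ?i))) e = l \<and>
            (?H(?k := H ?i, Suc ?k := n + T ?i)) e = q"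
            by (elim disjE) (rule exI[of _ ?k], simp, rule exI[of _ "Suc ?k"], simp)
        qed (use 4 in \<open>auto simp: is_side_def less_Suc_eq\<close>)
        then show ?thesis
          using 4 s' i x r rep(2)[of "T ?i"] rep(2)[of "H ?i"] B k_le by (simp add: fin add_side_def)
      qed
      then show ?case by (rule runs_wpI) (simp add: add_side_def)
    next
      case (4 v s')
      then have "reg s' ''i'' = m" unfolding I_def by auto
      then show ?case using 4(1) unfolding I_def by simp
    qed (use 2 in auto)
  qed simp
qed

section \<open>The functional graph and its indegrees\<close>

definition count_hosts :: com where
  "count_hosts =
    Assign ''i'' (Const 1) ;;
    While (Less (Reg ''i'') (Add (Reg ''n'') (Const 1)))
     (If (And (Equal (Get ''rep'' (Sub (Reg ''i'') (Const 1))) (Reg ''i''))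
            (Not (Equal (Get ''2L'' (Reg ''i'')) (Const 0))))
       (Put ''hs'' (Reg ''i'') (Get ''rep'' (Get ''H'' (Sub (Get ''2L'' (Reg ''i'')) (Const 1)))) ;;
        Put ''cnt'' (Get ''hs'' (Reg ''i'')) (Add (Get ''cnt'' (Get ''hs'' (Reg ''i''))) (Const 1)))
       Skip ;;
      Assign ''i'' (Add (Reg ''i'') (Const 1)))"

lemma count_hosts:
  assumes n: "reg s ''n'' = n" and R: "R \<subseteq> {1..n}"
    and rep: "\<And>r. 1 \<le> r \<Longrightarrow> r \<le> n \<Longrightarrow> arr s ''rep'' (r - 1) = r \<longleftrightarrow> r \<in> R"
    and h: "\<And>r. r \<in> R \<Longrightarrow> h r = (if arr s ''2L'' r = 0 then 0 else arr s ''rep'' (arr s ''H'' (arr s ''2L'' r - 1)))"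
    and h_le: "\<And>r. r \<in> R \<Longrightarrow> h r \<le> B" and zero: "arr s ''hs'' = (\<lambda>_. 0)" "arr s ''cnt'' = (\<lambda>_. 0)"
    and B: "2 * n + 2 \<le> B"
  shows "runs B count_hosts s (100 * n + 20)
    (\<lambda>s'. (\<forall>r\<in>R. arr s' ''hs'' r = h r) \<and> (\<forall>x. arr s' ''cnt'' x \<le> n) \<and>
      (\<forall>x. x \<noteq> 0 \<longrightarrow> arr s' ''cnt'' x = card {d \<in> R. h d = x}))"
proof -
  \<comment> \<open>The program skips unmatched 2-cycles. They have \<open>h d = 0\<close> just like
    matched ones without a host, so \<open>C\<close> agrees with the preimage of \<open>x\<close>
    under \<open>h\<close> only for nonzero \<open>x\<close>; the entry at 0 is never
    consulted.\<close>
  define C where "C i x = {d \<in> R. d < i \<and> arr s ''2L'' d \<noteq> 0 \<and> h d = x}" for i x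
  have finR: "finite R" using finite_subset[OF R] by simp
  have finC: "finite (C i x)" for i x unfolding C_def using finR by simp
  have C_le: "card (C i x) \<le> n" for i x
  proof -
    have "C i x \<subseteq> {1..n}" using R unfolding C_def by blast
    then show ?thesis using card_mono[of "{1..n}" "C i x"] by simp
  qed
  define I where "I v s' \<longleftrightarrow> reg s' ''n'' = n \<and> arr s' ''rep'' = arr s ''rep'' \<and> arr s' ''2L'' = arr s ''2L'' \<and>
    arr s' ''H'' = arr s ''H'' \<and> 1 \<le> reg s' ''i'' \<and> reg s' ''i'' \<le> Suc n \<and> v = Suc n - reg s' ''i'' \<and>
    (\<forall>r\<in>R. arr s' ''hs'' r = (if r < reg s' ''i'' then h r else 0)) \<and>
    (\<forall>x. arr s' ''cnt'' x = card (C (reg s' ''i'') x))" for v and s' :: store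
  show ?thesis
    unfolding count_hosts_def
  proof (rule runs_Seq[where ?T1.0 = 5 and ?T2.0 = "100 * n + 10" and R = "I n"], goal_cases)
    case 1
    have "C (Suc 0) x = {}" for x unfolding C_def using R by auto
    moreover have "\<forall>r\<in>R. \<not> r < Suc 0" using R by auto
    ultimately show ?case using n zero B by (intro runs_wpI) (auto simp: I_def)
  next
    case (2 s0)
    show ?case
    proof (rule runs_WhileI[where I = I and v = n and K = 60], goal_cases)
      case (2 v s')
      let ?i = "reg s' ''i''"
      have s': "reg s' ''n'' = n" "arr s' ''rep'' = arr s ''rep''" "arr s' ''2L'' = arr s ''2L''"
        "arr s' ''H'' = arr s ''H''" "1 \<le> ?i" and v: "v = Suc n - ?i"
        and hs: "\<forall>r\<in>R. arr s' ''hs'' r = (if r < ?i then h r else 0)"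
        and cnt: "\<And>x. arr s' ''cnt'' x = card (C ?i x)"
        using 2(1) unfolding I_def by blast+
      have i: "?i \<le> n" using 2(2) s' by simp
      have step: "\<exists>v'<v. I v' s1" if "reg s1 ''n'' = n" "arr s1 ''rep'' = arr s ''rep''" "arr s1 ''2L'' = arr s ''2L''"
        "arr s1 ''H'' = arr s ''H''" "reg s1 ''i'' = Suc ?i"
        "\<forall>r\<in>R. arr s1 ''hs'' r = (if r < Suc ?i then h r else 0)"
        "\<And>x. arr s1 ''cnt'' x = card (C (Suc ?i) x)" for s1
      proof -
        have "I (v - 1) s1" using that i v unfolding I_def by auto
        moreover have "v - 1 < v" using i v by simp
        ultimately show ?thesis by blast
      qed
      have rep_i: "arr s ''rep'' (?i - Suc 0) = ?i \<longleftrightarrow> ?i \<in> R" using rep[OF s'(5) i] by simp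
      have "wp B (If (And (Equal (Get ''rep'' (Sub (Reg ''i'') (Const 1))) (Reg ''i''))
            (Not (Equal (Get ''2L'' (Reg ''i'')) (Const 0))))
       (Put ''hs'' (Reg ''i'') (Get ''rep'' (Get ''H'' (Sub (Get ''2L'' (Reg ''i'')) (Const 1)))) ;;
        Put ''cnt'' (Get ''hs'' (Reg ''i'')) (Add (Get ''cnt'' (Get ''hs'' (Reg ''i''))) (Const 1)))
       Skip ;;
      Assign ''i'' (Add (Reg ''i'') (Const 1))) (\<lambda>s'. \<exists>v'<v. I v' s') s'"
      proof (cases "?i \<in> R \<and> arr s ''2L'' ?i \<noteq> 0")
        case True
        have hi: "arr s ''rep'' (arr s ''H'' (arr s ''2L'' ?i - Suc 0)) = h ?i" using h[of ?i] True by simp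
        have "C (Suc ?i) x = (if x = h ?i then insert ?i (C ?i x) else C ?i x)" for x
          using True unfolding C_def by (auto simp: less_Suc_eq)
        moreover have "?i \<notin> C ?i x" for x unfolding C_def by simp
        ultimately have C': "card (C (Suc ?i) x) = (if x = h ?i then Suc (card (C ?i x)) else card (C ?i x))" for x
          using finC by simp
        have "Suc (card (C ?i (h ?i))) \<le> B" using C_le[of ?i "h ?i"] B by linarith
        then show ?thesis
          using True s' rep_i hi h_le[of ?i] hs cnt i B
          by (auto simp: C' less_Suc_eq intro!: step)
      next
        case False
        have "C (Suc ?i) x = C ?i x" for x
          using False unfolding C_def by (auto simp: less_Suc_eq)
        moreover have "?i \<in> R \<Longrightarrow> h ?i = 0" using False h[of ?i] by simp
        ultimately have fin: "\<exists>v'<v. I v' (s'\<lparr>reg := (reg s')(''i'' := Suc ?i)\<rparr>)"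
          using s' hs cnt by (intro step) (auto simp: less_Suc_eq)
        from False consider "?i \<notin> R" | "arr s ''2L'' ?i = 0" by auto
        then show ?thesis
          by cases (use s' rep_i fin i B in auto)
      qed
      then show ?case by (rule runs_wpI) simp
    next
      case (4 v s')
      then have i: "reg s' ''i'' = Suc n" unfolding I_def by auto
      have R_less: "r < Suc n" if "r \<in> R" for r using R that by auto
      moreover have "C (Suc n) x = {d \<in> R. h d = x}" if x: "x \<noteq> 0" for x
      proof -
        have "arr s ''2L'' d \<noteq> 0" if d: "d \<in> R" "h d = x" for d
        proof
          assume "arr s ''2L'' d = 0"
          then show False using h[OF d(1)] d(2) x by simp
        qed
        then show ?thesis using R_less unfolding C_def by blast
      qed
      ultimately show ?case using 4(1) C_le unfolding I_def i by simp
    qed (use 2 in auto)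
  qed simp
qed

section \<open>Forcing the arcs of the guests\<close>

definition attach_guests :: com where
  "attach_guests =
    Assign ''r'' (Const 1) ;;
    While (Less (Reg ''r'') (Add (Reg ''n'') (Const 1)))
     (If (And (And (Equal (Get ''rep'' (Sub (Reg ''r'') (Const 1))) (Reg ''r''))
                (Equal (Get ''lab'' (Reg ''r'')) (Const 1)))
            (And (Not (Equal (Get ''2L'' (Reg ''r'')) (Const 0)))
               (Not (And (Not (Equal (Get ''hs'' (Reg ''r'')) (Const 0)))
                  (Equal (Get ''lab'' (Get ''hs'' (Reg ''r''))) (Const 1))))))
       (Assign ''j'' (Get ''O'' (Sub (Get ''2L'' (Reg ''r'')) (Const 1))) ;;
        Assign ''x'' (Get ''tail'' (Reg ''j'')) ;; Assign ''w'' (Get ''head'' (Reg ''j'')) ;;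
        Assign ''y'' (Get ''su'' (Reg ''x'')) ;; Assign ''z'' (Get ''pr'' (Reg ''w'')) ;;
        If (Equal (Reg ''y'') (Const 0)) Skip (Put ''pr'' (Sub (Reg ''y'') (Const 1)) (Const 0)) ;;
        If (Equal (Reg ''z'') (Const 0)) Skip (Put ''su'' (Sub (Reg ''z'') (Const 1)) (Const 0)) ;;
        Put ''su'' (Reg ''x'') (Add (Reg ''w'') (Const 1)) ;; Put ''pr'' (Reg ''w'') (Add (Reg ''x'') (Const 1)))
       Skip ;;
      Assign ''r'' (Add (Reg ''r'') (Const 1)))"

text \<open>The old partners of \<open>x\<close> and \<open>w\<close> are cleared before the new arc
  is entered, so the update is also right if the arc is already present.\<close>

lemma succ_rep_force:
  assumes S: "succ_rep n S su pr" and xw: "x < n" "w < n"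
  shows "succ_rep n (insert (x, w) {(a, b) \<in> S. a \<noteq> x \<and> b \<noteq> w})
    ((if pr w = 0 then su else su(pr w - 1 := 0))(x := Suc w))
    ((if su x = 0 then pr else pr(su x - 1 := 0))(w := Suc x))"
proof -
  have su: "(a, b) \<in> S \<longleftrightarrow> a < n \<and> su a = Suc b" and pr: "(a, b) \<in> S \<longleftrightarrow> b < n \<and> pr b = Suc a" for a b
    using S unfolding succ_rep_def by blast+
  have 1: "a < n \<and> su a = Suc w \<longleftrightarrow> pr w = Suc a" for a using su[of a w] pr[of a w] xw by simp
  have 2: "b < n \<and> pr b = Suc x \<longleftrightarrow> su x = Suc b" for b using su[of x b] pr[of x b] xw by simp
  have "(a, b) \<in> insert (x, w) {(a, b) \<in> S. a \<noteq> x \<and> b \<noteq> w} \<longleftrightarrow>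
    a < n \<and> ((if pr w = 0 then su else su(pr w - 1 := 0))(x := Suc w)) a = Suc b" for a b
    using 1[of a] su[of a b] xw by (cases "a = x"; cases "pr w"; auto)
  moreover have "(a, b) \<in> insert (x, w) {(a, b) \<in> S. a \<noteq> x \<and> b \<noteq> w} \<longleftrightarrow>
    b < n \<and> ((if su x = 0 then pr else pr(su x - 1 := 0))(w := Suc x)) b = Suc a" for a b
    using 2[of b] pr[of a b] xw by (cases "b = w"; cases "su x"; auto)
  ultimately show ?thesis unfolding succ_rep_def by blast
qed

lemma attach_guests:
  assumes att: "attachments {..<n} M rep A f g" and A_sub: "A \<subseteq> {1..n}"
    and n: "reg s ''n'' = n" and M: "succ_rep n M (arr s ''su'') (arr s ''pr'')"
    and pr_0: "\<And>i. n \<le> i \<Longrightarrow> arr s ''pr'' i = 0"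
    and A_iff: "\<And>r. 1 \<le> r \<Longrightarrow> r \<le> n \<Longrightarrow> r \<in> A \<longleftrightarrow> arr s ''rep'' (r - 1) = r \<and> arr s ''lab'' r = 1 \<and> arr s ''2L'' r \<noteq> 0 \<and>
       \<not> (arr s ''hs'' r \<noteq> 0 \<and> arr s ''lab'' (arr s ''hs'' r) = 1)"
    and fg: "\<And>r. r \<in> A \<Longrightarrow> f r = arr s ''tail'' (arr s ''O'' (arr s ''2L'' r - 1)) \<and>
       g r = arr s ''head'' (arr s ''O'' (arr s ''2L'' r - 1)) \<and> arr s ''O'' (arr s ''2L'' r - 1) \<le> B"
    and B: "2 * n + 2 \<le> B"
  shows "runs B attach_guests s (150 * n + 20)
    (\<lambda>s'. succ_rep n (attachments.S M A f g) (arr s' ''su'') (arr s' ''pr'') \<and> (\<forall>i\<ge>n. arr s' ''pr'' i = 0))"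
proof -
  interpret attachments "{..<n}" M rep A f g by (rule att)
  \<comment> \<open>The forced arcs have distinct tails and distinct heads, so none displaces
    another; inserting them one by one yields the same set as forcing all at once.\<close>
  define SA where "SA X = {(f r, g r) | r. r \<in> X} \<union> {(x, y) \<in> M. x \<notin> f ` X \<and> y \<notin> g ` X}" for X
  have SA_insert: "SA (insert r X) = insert (f r, g r) {(a, b) \<in> SA X. a \<noteq> f r \<and> b \<noteq> g r}"
    if "X \<subseteq> A" "r \<in> A" "r \<notin> X" for X r
  proof -
    have "f r' \<noteq> f r" "g r' \<noteq> g r" if "r' \<in> X" for r'
      using inj_onD[OF inj_on_s, of r' r] inj_onD[OF inj_on_d, of r' r] that \<open>X \<subseteq> A\<close> \<open>r \<in> A\<close> \<open>r \<notin> X\<close> by auto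
    then show ?thesis unfolding SA_def by auto
  qed
  define I where "I v s' \<longleftrightarrow> reg s' ''n'' = n \<and>
    (\<forall>a. a \<notin> {''su'', ''pr''} \<longrightarrow> arr s' a = arr s a) \<and>
    1 \<le> reg s' ''r'' \<and> reg s' ''r'' \<le> Suc n \<and> v = Suc n - reg s' ''r'' \<and>
    succ_rep n (SA {r \<in> A. r < reg s' ''r''}) (arr s' ''su'') (arr s' ''pr'') \<and> (\<forall>i\<ge>n. arr s' ''pr'' i = 0)"
    for v and s' :: store
  show ?thesis
    unfolding attach_guests_def
  proof (rule runs_Seq[where ?T1.0 = 5 and ?T2.0 = "150 * n + 10" and R = "I n"], goal_cases)
    case 1
    have no: "{r. r = 0 \<and> r \<in> A} = {}" using A_sub by auto
    have "SA {} = M" unfolding SA_def by auto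
    then show ?case using n M pr_0 B by (intro runs_wpI) (auto simp: I_def no)
  next
    case (2 s0)
    show ?case
    proof (rule runs_WhileI[where I = I and v = n and K = 100], goal_cases)
      case (2 v s')
      let ?r = "reg s' ''r''" and ?su = "arr s' ''su''" and ?pr = "arr s' ''pr''"
      have s': "reg s' ''n'' = n" and same: "\<And>a. a \<noteq> ''su'' \<Longrightarrow> a \<noteq> ''pr'' \<Longrightarrow> arr s' a = arr s a"
        and r1: "1 \<le> ?r" and v: "v = Suc n - ?r" and S: "succ_rep n (SA {r \<in> A. r < ?r}) ?su ?pr"
        and p0: "\<And>i. n \<le> i \<Longrightarrow> ?pr i = 0"
        using 2(1) unfolding I_def by blast+
      have r: "?r \<le> n" using 2(2) s' by simp
      have step: "\<exists>v'<v. I v' s1" if "reg s1 ''n'' = n" "\<And>a. a \<noteq> ''su'' \<Longrightarrow> a \<noteq> ''pr'' \<Longrightarrow> arr s1 a = arr s a"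
        "reg s1 ''r'' = Suc ?r" "succ_rep n (SA {r \<in> A. r < Suc ?r}) (arr s1 ''su'') (arr s1 ''pr'')"
        "\<And>i. n \<le> i \<Longrightarrow> arr s1 ''pr'' i = 0" for s1
      proof -
        have "I (v - 1) s1" using that r v unfolding I_def by auto
        moreover have "v - 1 < v" using r v by simp
        ultimately show ?thesis by blast
      qed
      have test: "?r \<in> A \<longleftrightarrow> arr s ''rep'' (?r - Suc 0) = ?r \<and> arr s ''lab'' ?r = 1 \<and> arr s ''2L'' ?r \<noteq> 0 \<and>
       \<not> (arr s ''hs'' ?r \<noteq> 0 \<and> arr s ''lab'' (arr s ''hs'' ?r) = 1)" using A_iff[OF r1 r] by simp
      show ?case
      proof (cases "?r \<in> A")
        case True
        let ?x = "f ?r" and ?w = "g ?r" and ?j = "arr s ''O'' (arr s ''2L'' ?r - Suc 0)"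
        have xw: "?x < n" "?w < n" using arc_V[OF True] by auto
        have j: "arr s ''tail'' ?j = ?x" "arr s ''head'' ?j = ?w" "?j \<le> B" using fg[OF True] by auto
        have less: "{r \<in> A. r < Suc ?r} = insert ?r {r \<in> A. r < ?r}" using True by auto
        have "?r \<notin> {r \<in> A. r < ?r}" by simp
        then have SA': "SA {r \<in> A. r < Suc ?r} = insert (?x, ?w) {(a, b) \<in> SA {r \<in> A. r < ?r}. a \<noteq> ?x \<and> b \<noteq> ?w}"
          unfolding less by (intro SA_insert True) auto
        note force = succ_rep_force[OF S xw]
        have pos: "?su x \<le> n \<and> ?pr x \<le> n" if "x < n" for x
          using S that unfolding succ_rep_def
          by (cases "?su x"; cases "?pr x") (auto simp: less_eq_Suc_le[symmetric])
        define su' where "su' = (if ?pr ?w = 0 then ?su else ?su(?pr ?w - 1 := 0))(?x := Suc ?w)"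
        define pr' where "pr' = (if ?su ?x = 0 then ?pr else ?pr(?su ?x - 1 := 0))(?w := Suc ?x)"
        have p0': "pr' i = 0" if "n \<le> i" for i using p0[OF that] that xw unfolding pr'_def by auto
        have fin: "\<exists>v'<v. I v' s1" if "reg s1 ''n'' = n" "\<And>a. a \<noteq> ''su'' \<Longrightarrow> a \<noteq> ''pr'' \<Longrightarrow> arr s1 a = arr s a"
          "reg s1 ''r'' = Suc ?r" "arr s1 ''su'' = su'" "arr s1 ''pr'' = pr'" for s1
          by (rule step) (use that force p0' in \<open>simp_all add: SA' su'_def pr'_def\<close>)
        have t: "arr s ''rep'' (?r - Suc 0) = ?r" "arr s ''lab'' ?r = 1" "arr s ''2L'' ?r \<noteq> 0"
          "arr s ''hs'' ?r = 0 \<or> arr s ''lab'' (arr s ''hs'' ?r) \<noteq> 1" using test True by auto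
        have le: "Suc ?x \<le> B" "Suc ?w \<le> B" "?su ?x \<le> B" "?pr ?w \<le> B" "Suc ?r \<le> B" "?x \<le> B" "?w \<le> B"
          using xw pos[OF xw(1)] pos[OF xw(2)] B r by auto
        show ?thesis
          by (rule runs_wpI; cases "?su ?x = 0"; cases "?pr ?w = 0"; cases "arr s ''hs'' ?r = 0")
            (use t in \<open>simp_all add: same s'(1) j le fin su'_def pr'_def\<close>)
      next
        case False
        then have "{r \<in> A. r < Suc ?r} = {r \<in> A. r < ?r}" by (auto simp: less_Suc_eq)
        then have fin: "\<exists>v'<v. I v' (s'\<lparr>reg := (reg s')(''r'' := Suc ?r)\<rparr>)"
          using s' same S p0 by (intro step) simp_all
        have "\<not> (arr s ''rep'' (?r - Suc 0) = ?r \<and> arr s ''lab'' ?r = 1 \<and> arr s ''2L'' ?r \<noteq> 0 \<and>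
          (arr s ''hs'' ?r = 0 \<or> arr s ''lab'' (arr s ''hs'' ?r) \<noteq> 1))"
          using False unfolding test by simp
        then consider "arr s ''rep'' (?r - Suc 0) \<noteq> ?r" | "arr s ''lab'' ?r \<noteq> 1" | "arr s ''2L'' ?r = 0"
          | "arr s ''hs'' ?r \<noteq> 0" "arr s ''lab'' (arr s ''hs'' ?r) = 1" by auto
        then show ?thesis
          by cases (rule runs_wpI, use fin same s' r B in simp, simp)+
      qed
    next
      case (4 v s')
      then have r: "reg s' ''r'' = Suc n" unfolding I_def by auto
      have "{r \<in> A. r < Suc n} = A" using A_sub by auto
      moreover have "SA A = S" unfolding SA_def S_def by simp
      ultimately show ?case using 4(1) unfolding I_def r by simp
    qed (use 2 in auto)
  qed simp
qed

section \<open>The approximation guarantee\<close>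

locale pair_cover =
  fixes n m :: nat and T H mL mR :: "nat \<Rightarrow> nat"
  assumes TH: "\<And>j. j < m \<Longrightarrow> T j < n \<and> H j < n \<and> T j \<noteq> H j"
    and max: "maximum_matching_rep m T H mL mR"
begin

lemma mat: "matching_rep m T H mL mR"
  using max unfolding maximum_matching_rep_def by blast

definition su where "su = out_of mL H"
definition pr where "pr = out_of mR T"
definition M where "M = {(x, y). su x = Suc y}"
definition rho where "rho = pair_id su pr"
definition ids where "ids = {r. 1 \<le> r \<and> r \<le> n \<and> rho (r - 1) = r}"

lemma su_arc: "su x = Suc y \<longleftrightarrow> mL x \<noteq> 0 \<and> y = H (mL x - 1)"
  unfolding su_def out_of_def by auto

lemma pr_arc: "pr y = Suc x \<longleftrightarrow> mR y \<noteq> 0 \<and> x = T (mR y - 1)"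
  unfolding pr_def out_of_def by auto

lemma M_arc:
  assumes "(x, y) \<in> M"
  obtains j where "j < m" "T j = x" "H j = y"
proof -
  have "mL x \<noteq> 0" "y = H (mL x - 1)" using assms su_arc unfolding M_def by auto
  then show ?thesis using that[of "mL x - 1"] matching_repL[OF mat, of x] by simp
qed

lemma M_V: "(x, y) \<in> M \<Longrightarrow> x < n \<and> y < n \<and> x \<noteq> y"
  using M_arc TH by metis

lemma M_su: "(x, y) \<in> M \<longleftrightarrow> su x = Suc y"
  unfolding M_def by simp

lemma M_pr: "(x, y) \<in> M \<longleftrightarrow> pr y = Suc x"
proof
  assume "(x, y) \<in> M"
  then have "mL x \<noteq> 0" "y = H (mL x - 1)" using su_arc unfolding M_def by auto
  then show "pr y = Suc x" using matching_repL[OF mat, of x] pr_arc by auto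
next
  assume "pr y = Suc x"
  then have "mR y \<noteq> 0" "x = T (mR y - 1)" using pr_arc by auto
  then show "(x, y) \<in> M" using matching_repR[OF mat, of y] su_arc unfolding M_def by auto
qed

lemma succ_rep_M: "succ_rep n M su pr"
  unfolding succ_rep_def using M_V M_su M_pr by blast

lemma pr_zero: "n \<le> i \<Longrightarrow> pr i = 0"
  using M_V[of "pr i - 1" i] M_pr[of "pr i - 1" i] by (cases "pr i") auto

lemma su_le: "su x \<le> n"
  using M_V[of x "su x - 1"] M_su[of x "su x - 1"] by (cases "su x") auto

lemma card_M: "card M = card {x. mL x \<noteq> 0}"
proof -
  have z: "su x = 0 \<longleftrightarrow> mL x = 0" for x unfolding su_def out_of_def by simp
  have "(x, y) \<in> M \<longleftrightarrow> mL x \<noteq> 0 \<and> y = su x - 1" for x y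
    unfolding M_def using z[of x] by (cases "su x") auto
  then have "M = (\<lambda>x. (x, su x - 1)) ` {x. mL x \<noteq> 0}" by auto
  moreover have "inj_on (\<lambda>x. (x, su x - 1)) {x. mL x \<noteq> 0}" by (rule inj_onI) simp
  ultimately show ?thesis by (simp add: card_image)
qed

lemma M_right: "(x, y) \<in> M \<Longrightarrow> (x, y') \<in> M \<Longrightarrow> y = y'"
  using M_su by simp

lemma M_left: "(x, y) \<in> M \<Longrightarrow> (x', y) \<in> M \<Longrightarrow> x = x'"
  using M_pr by simp

lemma rho_nonzero: "rho x \<noteq> 0 \<longleftrightarrow> (\<exists>y. (x, y) \<in> M \<and> (y, x) \<in> M)"
proof
  assume "rho x \<noteq> 0"
  then have s: "su x \<noteq> 0" "su x = pr x" unfolding rho_def pair_id_def by (auto split: if_splits)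
  have "(x, su x - 1) \<in> M" using M_su s(1) by simp
  moreover have "(su x - 1, x) \<in> M" using M_pr s by simp
  ultimately show "\<exists>y. (x, y) \<in> M \<and> (y, x) \<in> M" by blast
next
  assume "\<exists>y. (x, y) \<in> M \<and> (y, x) \<in> M"
  then obtain y where "su x = Suc y" "pr x = Suc y" using M_su M_pr by blast
  then show "rho x \<noteq> 0" unfolding rho_def pair_id_def by simp
qed

lemma rho_pair: "(x, y) \<in> M \<Longrightarrow> (y, x) \<in> M \<Longrightarrow> rho x = Suc (min x y)"
  using M_su[of x y] M_pr[of y x] unfolding rho_def pair_id_def by simp

text \<open>The number of a 2-cycle is one of its vertices plus one, so equal numbers give a common
  vertex, and the uniqueness of neighbours does the rest.\<close>

lemma rho_eq:
  assumes "rho x \<noteq> 0"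
  shows "rho x = rho y \<longleftrightarrow> x = y \<or> (x, y) \<in> M"
proof -
  obtain p where p: "(x, p) \<in> M" "(p, x) \<in> M" using assms rho_nonzero by blast
  show ?thesis
  proof
    assume eq: "rho x = rho y"
    then obtain q where q: "(y, q) \<in> M" "(q, y) \<in> M" using assms rho_nonzero[of y] by auto
    have "min x p = min y q" using eq rho_pair[OF p] rho_pair[OF q] by simp
    then consider "x = y" | "x = q" | "p = y" | "p = q" by (metis min_def)
    then show "x = y \<or> (x, y) \<in> M"
    proof cases
      case 4
      then show ?thesis using M_left p q by blast
    qed (use p q in auto)
  next
    assume "x = y \<or> (x, y) \<in> M"
    then show "rho x = rho y"
    proof
      assume "(x, y) \<in> M"
      then have "y = p" using M_right p by blast
      then show ?thesis using rho_pair[OF p] rho_pair[OF p(2) p(1)] by (simp add: min.commute)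
    qed simp
  qed
qed

lemma rho_in_ids: "rho x \<noteq> 0 \<Longrightarrow> rho x \<in> ids"
proof -
  assume x: "rho x \<noteq> 0"
  then obtain p where p: "(x, p) \<in> M" "(p, x) \<in> M" using rho_nonzero by blast
  have r: "rho x = Suc (min x p)" using rho_pair[OF p] .
  have "rho (min x p) = rho x" using rho_eq[OF x, of "min x p"] p(1) by (auto simp: min_def)
  then show ?thesis using r M_V[OF p(1)] unfolding ids_def by auto
qed

lemma rho_le: "rho x \<le> n"
  using rho_in_ids[of x] unfolding ids_def by (cases "rho x = 0") auto

lemma ids_vertex: "r \<in> ids \<Longrightarrow> r \<noteq> 0 \<and> (\<exists>x\<in>{..<n}. rho x = r)"
  unfolding ids_def by (intro conjI bexI[of _ "r - 1"]) auto

lemma ids_sub: "ids \<subseteq> {1..n}" and finite_ids: "finite ids"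
proof -
  show "ids \<subseteq> {1..n}" unfolding ids_def by auto
  then show "finite ids" using finite_subset by blast
qed

end

section \<open>The second matching as a choice of arcs at 2-cycles\<close>

locale side_matching = pair_cover +
  fixes k2 :: nat and T2 H2 O2 mL2 mR2 :: "nat \<Rightarrow> nat"
  assumes sides: "sides n T H rho m k2 T2 H2 O2"
    and max2: "maximum_matching_rep k2 T2 H2 mL2 mR2"
begin

lemma mat2: "matching_rep k2 T2 H2 mL2 mR2"
  using max2 unfolding maximum_matching_rep_def by blast

definition f where "f r = T (O2 (mL2 r - 1))"
definition g where "g r = H (O2 (mL2 r - 1))"
text \<open>The value 0 has two causes, no matched arc or an outer end on no 2-cycle;
  \<open>mL2\<close> tells them apart.\<close>

definition h where "h r = (if mL2 r = 0 then 0 else rho (if rho (f r) = r then g r else f r))"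

lemma matched:
  assumes "mL2 r \<noteq> 0"
  shows "O2 (mL2 r - 1) < m" "r \<in> ids" "rho (f r) \<noteq> rho (g r)"
    "rho (f r) = r \<and> H2 (mL2 r - 1) = g r \<or> rho (g r) = r \<and> H2 (mL2 r - 1) = n + f r"
proof -
  have "mL2 r - 1 < k2" "T2 (mL2 r - 1) = r" using matching_repL[OF mat2 assms] assms by auto
  then have *: "O2 (mL2 r - 1) < m" "is_side n T H rho r (H2 (mL2 r - 1)) (O2 (mL2 r - 1))"
    using sides unfolding sides_def by metis+
  then show "O2 (mL2 r - 1) < m" by blast
  have r: "r \<noteq> 0" "rho (f r) \<noteq> rho (g r)"
    "r = rho (f r) \<and> H2 (mL2 r - 1) = g r \<or> r = rho (g r) \<and> H2 (mL2 r - 1) = n + f r"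
    using *(2) unfolding is_side_def f_def g_def by blast+
  then show "rho (f r) \<noteq> rho (g r)"
    "rho (f r) = r \<and> H2 (mL2 r - 1) = g r \<or> rho (g r) = r \<and> H2 (mL2 r - 1) = n + f r"
    by metis+
  from r(1,3) show "r \<in> ids" using rho_in_ids by metis
qed

lemma fg_arc:
  assumes "mL2 r \<noteq> 0"
  shows "f r < n" "g r < n"
  using TH[OF matched(1)[OF assms]] unfolding f_def g_def by auto

lemma h_other: "mL2 r \<noteq> 0 \<Longrightarrow> rho (f r) = r \<Longrightarrow> h r = rho (g r)"
  "mL2 r \<noteq> 0 \<Longrightarrow> rho (g r) = r \<Longrightarrow> h r = rho (f r)"
  using matched(3)[of r] unfolding h_def by auto

lemma h_matched: "h r \<noteq> 0 \<Longrightarrow> mL2 r \<noteq> 0"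
  unfolding h_def by (auto split: if_splits)

lemma labelling_ids: "labelling ids h n"
proof
  show "ids \<subseteq> {1..n}" by (rule ids_sub)
  show "h r \<in> ids" if "r \<in> ids" "h r \<noteq> 0" for r
    using that rho_in_ids unfolding h_def by (auto split: if_splits)
  show "h r \<noteq> r" if "r \<in> ids" for r
  proof (cases "mL2 r = 0")
    case True
    then show ?thesis using ids_vertex[OF that] unfolding h_def by simp
  next
    case False
    then show ?thesis using matched(3,4)[OF False] h_other[OF False] by metis
  qed
qed

end

sublocale side_matching \<subseteq> lab: labelling ids h n
  by (rule labelling_ids)

section \<open>Guests, lost 2-cycles and the final estimate\<close>

locale labelled_pairs = side_matching +
  fixes lb :: "nat \<Rightarrow> nat"
  assumes consistent: "lab.consistent lb" and labels: "\<And>r. r \<in> ids \<Longrightarrow> lb r = 1 \<or> lb r = 2"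
begin

definition A where "A = {r \<in> ids. lb r = 1 \<and> mL2 r \<noteq> 0 \<and> \<not> (h r \<noteq> 0 \<and> lb (h r) = 1)}"

lemma other_notin_A: "r \<in> A \<Longrightarrow> h r \<notin> A"
  unfolding A_def using ids_vertex[of 0] by (cases "h r = 0") auto

text \<open>A side ends in \<open>g r\<close> if it leaves and in \<open>n + f r\<close> if it
  enters, so \<open>inj_d\<close> and \<open>inj_s\<close> both express that right vertices are
  matched at most once.\<close>

lemma attachments_A: "attachments {..<n} M rho A f g"
proof
  have A: "r \<in> ids" "mL2 r \<noteq> 0" if "r \<in> A" for r using that unfolding A_def by auto
  show "finite {..<n}" "M \<subseteq> {..<n} \<times> {..<n}" using M_V by auto
  show "(x, x) \<notin> M" for x using M_V by blast
  show "finite A" "0 \<notin> A" using finite_ids ids_vertex unfolding A_def by auto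
  show "f r \<in> {..<n} \<and> g r \<in> {..<n}" if "r \<in> A" for r using fg_arc[OF A(2)[OF that]] by simp
  show "rho (f r) = r \<and> rho (g r) \<notin> A \<or> rho (g r) = r \<and> rho (f r) \<notin> A" if r: "r \<in> A" for r
    using matched(4)[OF A(2)[OF r]] h_other[OF A(2)[OF r]] other_notin_A[OF r] by auto
  have same: "r = r'" if "r \<in> A" "r' \<in> A" "H2 (mL2 r - 1) = H2 (mL2 r' - 1)" for r r'
  proof -
    have "mL2 r = mL2 r'" using matching_repL(3)[OF mat2 A(2)] that by metis
    then show ?thesis using matching_repL(2)[OF mat2 A(2)] that by metis
  qed
  show "r = r'" if "r \<in> A" "r' \<in> A" "rho (f r) = r" "rho (f r') = r'" "g r = g r'" for r r'
  proof (rule same[OF that(1,2)])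
    show "H2 (mL2 r - 1) = H2 (mL2 r' - 1)"
      using matched(3,4)[OF A(2)[OF that(1)]] matched(3,4)[OF A(2)[OF that(2)]] that by auto
  qed
  show "r = r'" if "r \<in> A" "r' \<in> A" "rho (g r) = r" "rho (g r') = r'" "f r = f r'" for r r'
  proof (rule same[OF that(1,2)])
    show "H2 (mL2 r - 1) = H2 (mL2 r' - 1)"
      using matched(3,4)[OF A(2)[OF that(1)]] matched(3,4)[OF A(2)[OF that(2)]] that by auto
  qed
qed (fact M_right M_left rho_nonzero rho_eq)+

end

sublocale labelled_pairs \<subseteq> att: attachments "{..<n}" M rho A f g
  by (rule attachments_A)

context labelled_pairs
begin

lemma host_h: "r \<in> A \<Longrightarrow> att.host r = h r"
  using h_other[of r] att.arc[of r] unfolding att.host_def A_def by auto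

definition unmatched where "unmatched = {r \<in> ids. mL2 r = 0}"
definition lost where "lost = {r \<in> ids. lb r = 1 \<and> h r \<noteq> 0 \<and> lb (h r) = 1}"

text \<open>A lost 2-cycle is a guest that points to a guest; \<open>consistent\<close> allows this
  only where a cycle was closed, so its target is the single guest of a host and gets
  attached.\<close>

lemma lost_sole:
  assumes "r \<in> lost"
  shows "lab.sole_guest lb (h r)" "h r \<in> A"
proof -
  have r: "r \<in> ids" "lb r = 1" "h r \<noteq> 0" "lb (h r) = 1" using assms unfolding lost_def by auto
  have hr: "h r \<in> ids" using lab.h_R r by blast
  have "\<not> (\<forall>d\<in>ids. h d = h r \<longrightarrow> lb d = 2)" using r by auto
  then show s: "lab.sole_guest lb (h r)"
    using consistent hr r(4) unfolding lab.consistent_def by blast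
  then have "h (h r) \<in> ids" "lb (h (h r)) = 2" unfolding lab.sole_guest_def by blast+
  moreover from this have "mL2 (h r) \<noteq> 0" using ids_vertex[of "h (h r)"] h_matched by blast
  ultimately show "h r \<in> A" using hr r unfolding A_def by auto
qed

lemma pieces_lost_bound:
  assumes k: "k \<ge> 7" and ds: "\<forall>d\<in>set ds. comp_of att.S d" "distinct (concat ds)" "set (concat ds) = {..<n}"
  shows "3 * (\<Sum>d\<leftarrow>ds. pieces k (length d)) + 2 * card M \<le> 3 * n + card unmatched"
proof -
  have ne: "d \<noteq> []" if "d \<in> set ds" for d using ds(1) that unfolding comp_of_def by blast
  then have "removeAll [] ds = ds" by (induction ds) auto
  then have dist: "distinct ds" using ds(2) unfolding distinct_concat_iff by simp
  have inj: "inj_on h lost"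
  proof (rule inj_onI)
    fix r r' assume r: "r \<in> lost" "r' \<in> lost" "h r = h r'"
    then have "lb r \<noteq> 2" "lb r' \<noteq> 2" "r \<in> ids" "r' \<in> ids" unfolding lost_def by auto
    then show "r = r'" using lost_sole(1)[OF r(1)] r(3) unfolding lab.sole_guest_def by metis
  qed
  have fin: "finite unmatched" "finite lost" unfolding unmatched_def lost_def using finite_ids by auto
  have "3 * (\<Sum>d\<in>set ds. pieces k (length d)) + card (h ` lost) + 2 * card M
    \<le> 3 * card {..<n} + card (unmatched \<union> lost)"
  proof (rule att.pieces_bound[OF k])
    show "comp_of att.S z" if "z \<in> set ds" for z using ds(1) that by blast
    show "(\<Union>z\<in>set ds. set z) = {..<n}" using ds(3) by simp
    show "z = z'" if "z \<in> set ds" "z' \<in> set ds" "x \<in> set z" "x \<in> set z'" for z z' x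
      using ds(2) that unfolding distinct_concat_iff by blast
    show "h ` lost \<subseteq> A" using lost_sole(2) by blast
    show "att.host q \<noteq> 0" if ql: "q \<in> h ` lost" for q
    proof -
      obtain r where "r \<in> lost" "q = h r" using ql by blast
      then have "lab.sole_guest lb q" "q \<in> A" using lost_sole by auto
      then show ?thesis using host_h ids_vertex unfolding lab.sole_guest_def by auto
    qed
    show "r' = q" if ql: "q \<in> h ` lost" and r': "r' \<in> A" "att.host r' = att.host q" for q r'
    proof -
      obtain r where "r \<in> lost" "q = h r" using ql by blast
      then have q: "lab.sole_guest lb q" "q \<in> A" using lost_sole by auto
      have "h r' = h q" "r' \<in> ids" "lb r' \<noteq> 2" using r' host_h q(2) unfolding A_def by auto
      then show ?thesis using q(1) unfolding lab.sole_guest_def by blast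
    qed
    \<comment> \<open>A matched guest that is not lost would belong to \<open>A\<close>. A 2-cycle
      with label 2 has a guest by consistency, and that guest is attached, so the 2-cycle would be a
      host.\<close>
    show "rho x \<in> unmatched \<union> lost" if x: "rho x \<noteq> 0" "rho x \<notin> A" "rho x \<notin> att.host ` A" for x
    proof (rule ccontr)
      let ?r = "rho x"
      assume no: "?r \<notin> unmatched \<union> lost"
      have r: "?r \<in> ids" using rho_in_ids x(1) .
      have "lb ?r \<noteq> 1" using no x(2) r unfolding unmatched_def lost_def A_def by auto
      then have "lb ?r = 2" using labels[OF r] by blast
      then obtain d where d: "d \<in> ids" "h d = ?r" "lb d = 1" using consistent r unfolding lab.consistent_def by blast
      then have "mL2 d \<noteq> 0" using x(1) h_matched[of d] by simp
      then have "d \<in> A" using d \<open>lb ?r = 2\<close> unfolding A_def by auto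
      then show False using x(3) host_h d(2) by force
    qed
  qed (use fin in auto)
  moreover have "card (unmatched \<union> lost) \<le> card unmatched + card lost" by (rule card_Un_le)
  moreover have "card (h ` lost) = card lost" by (rule card_image[OF inj])
  moreover have "(\<Sum>d\<in>set ds. pieces k (length d)) = (\<Sum>d\<leftarrow>ds. pieces k (length d))"
    using sum_list_distinct_conv_sum_set[OF dist, of "\<lambda>d. pieces k (length d)"] by simp
  ultimately show ?thesis by simp
qed

lemma approximation:
  assumes k: "k \<ge> 7" and ds: "\<forall>d\<in>set ds. comp_of att.S d" "distinct (concat ds)" "set (concat ds) = {..<n}"
    and inj: "inj_on (\<lambda>j. (T j, H j)) {..<m}"
    and Q: "path_system {..<n} ((\<lambda>j. (T j, H j)) ` {..<m}) k Q"
  shows "3 * (\<Sum>d\<leftarrow>ds. pieces k (length d)) \<le> (k + 2) * card Q"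
proof -
  interpret path_system "{..<n}" "(\<lambda>j. (T j, H j)) ` {..<m}" k Q by (rule Q)
  have maxM: "card N \<le> card M" if "N \<subseteq> {..<m}" "inj_on T N" "inj_on H N" for N
    using max that unfolding maximum_matching_rep_def card_M by blast
  have "card {..<n} \<le> card M + card Q"
    by (rule maximum_matching_bound[OF refl inj]) (rule maxM)
  then have 1: "n \<le> card M + card Q" by simp
  have pair: "x = y \<or> x = z \<or> y = z" if "rho x \<noteq> 0" "rho x = rho y" "rho x = rho z" for x y z
  proof -
    have y: "x = y \<or> (x, y) \<in> M" by (rule iffD1[OF rho_eq[OF that(1)] that(2)])
    have z: "x = z \<or> (x, z) \<in> M" by (rule iffD1[OF rho_eq[OF that(1)] that(3)])
    show ?thesis
    proof (rule ccontr)
      assume no: "\<not> ?thesis"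
      then have "(x, y) \<in> M" "(x, z) \<in> M" using y z by simp_all
      then have "y = z" by (rule M_right)
      then show False using no by simp
    qed
  qed
  have iso: "n + (k - 2) * card (isolated rho) \<le> k * card Q" "finite (isolated rho)"
    using isolated_bound[of rho] pair k by auto
  have side_ex: "\<exists>e<k2. T2 e = l \<and> H2 e = r" if "j < m" "is_side n T H rho l r j" for l r j
    using sides that unfolding sides_def by blast
  have ids_bound: "card ids \<le> card {x. mL2 x \<noteq> 0} + card (isolated rho)"
  proof (rule matching_sides_bound[where rep = rho and m = k2 and T = T2 and H = H2 and f = "\<lambda>x. x" and g = "\<lambda>x. n + x"])
    fix x y assume xy: "(x, y) \<in> (\<lambda>j. (T j, H j)) ` {..<m}" "rho x \<noteq> rho y"
    then obtain j where j: "j < m" "x = T j" "y = H j" by auto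
    show "\<exists>e<k2. T2 e = rho x \<and> H2 e = y" if "rho x \<noteq> 0"
      by (rule side_ex[OF j(1)]) (use j xy that in \<open>simp add: is_side_def\<close>)
    show "\<exists>e<k2. T2 e = rho y \<and> H2 e = n + x" if "rho y \<noteq> 0"
      by (rule side_ex[OF j(1)]) (use j xy that in \<open>simp add: is_side_def\<close>)
  next
    show "card N \<le> card {x. mL2 x \<noteq> 0}" if "N \<subseteq> {..<k2}" "inj_on T2 N" "inj_on H2 N" for N
      using max2 that unfolding maximum_matching_rep_def by blast
  qed (use ids_vertex finite_ids iso(2) in auto)
  have "card ids = card unmatched + card {x. mL2 x \<noteq> 0}"
  proof -
    have "ids = unmatched \<union> {x. mL2 x \<noteq> 0}" using matched(2) unfolding unmatched_def by auto
    moreover have "card (unmatched \<union> {x. mL2 x \<noteq> 0}) = card unmatched + card {x. mL2 x \<noteq> 0}"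
      by (rule card_Un_disjoint)
        (use finite_ids matched_finite[OF mat2] in \<open>auto simp: unmatched_def\<close>)
    ultimately show ?thesis by simp
  qed
  then have un: "card unmatched \<le> card (isolated rho)" using ids_bound by simp
  have main: "3 * (\<Sum>d\<leftarrow>ds. pieces k (length d)) + 2 * card M \<le> 3 * n + card unmatched"
    by (rule pieces_lost_bound[OF k ds])
  \<comment> \<open>The estimate is \<open>3 * n - 2 * card M + card unmatched <= n + 2 * card Q +
    card (isolated rho)\<close>, and the isolated 2-cycles are absorbed by the \<open>k - 2\<close>
    missing vertices that each contributes to \<open>n <= k * card Q\<close>.\<close>
  have "1 * card (isolated rho) \<le> (k - 2) * card (isolated rho)" by (rule mult_le_mono1) (use k in simp)
  then have "3 * (\<Sum>d\<leftarrow>ds. pieces k (length d)) \<le> k * card Q + 2 * card Q"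
    using 1 iso(1) un main by linarith
  then show ?thesis by (simp add: algebra_simps)
qed

end

section \<open>The algorithm\<close>

definition algorithm :: "nat \<Rightarrow> com" where
  "algorithm k =
    matching CHR ''1'' ''tail'' ''head'' ''m'' ;; read_matching ;; build_sides ;;
    matching CHR ''2'' ''T'' ''H'' ''k'' ;; count_hosts ;; label_hosts ;; attach_guests ;; emit k"

lemma runsE:
  assumes "runs B c s T Q"
  obtains t s' where "exec B c s t s'" "t \<le> T" "Q s'"
    "\<And>x. x \<notin> written_regs c \<Longrightarrow> reg s' x = reg s x" "\<And>a. a \<notin> written_arrs c \<Longrightarrow> arr s' a = arr s a"
  using assms exec_frame unfolding runs_def by meson

lemmas matching_defs = matching_def build_adjacency_def matching_phase_def scan_free_def scan_tree_def
  relax_def augment_def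

text \<open>The first instance thus leaves the arrays of the second one zero, and neither touches
  the input or the arrays in between.\<close>

lemma written_matching:
  "written_regs (matching c tn hn mn) \<subseteq> range (Cons c)" "written_arrs (matching c tn hn mn) \<subseteq> range (Cons c)"
  by (auto simp: matching_defs)

lemma k_path_partition_system:
  assumes G: "pair_digraph G" "pverts G = V" and Q: "k_path_partition G k Q"
  shows "path_system V (parcs G) k Q"
proof
  interpret pair_digraph G by (rule G)
  show "finite V" using pair_finite_verts G(2) by simp
  have vp: "vpath p (with_proj G)" "length p \<le> k" if "p \<in> Q" for p
    using Q that unfolding k_path_partition_def by blast+
  show "p \<noteq> [] \<and> distinct p \<and> length p \<le> k" if "p \<in> Q" for p
    using vp[OF that] unfolding vpath_def vwalk_def by blast
  show "(p ! i, p ! Suc i) \<in> parcs G" if p: "p \<in> Q" "Suc i < length p" for p i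
  proof -
    have "set (vwalk_arcs p) \<subseteq> parcs G"
      using vp(1)[OF p(1)] unfolding vpath_def vwalk_def by simp
    moreover have "(p ! i, p ! Suc i) \<in> set (vwalk_arcs p)" using p(2)
    proof (induction p arbitrary: i rule: vwalk_arcs.induct)
      case (3 x y xs)
      then show ?case by (cases i) auto
    qed auto
    ultimately show ?thesis by blast
  qed
  show "p = p'" if "p \<in> Q" "p' \<in> Q" "x \<in> set p" "x \<in> set p'" for p p' x
    using Q that unfolding k_path_partition_def disjoint_family_on_def by blast
  show "(\<Union>p\<in>Q. set p) = V" using Q G(2) unfolding k_path_partition_def by blast
qed

lemma vwalk_arcs_successively:
  "successively (\<lambda>x y. (x, y) \<in> E) p \<Longrightarrow> set (vwalk_arcs p) \<subseteq> E"
  by (induction p rule: vwalk_arcs.induct) auto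

lemma k_path_partition_lists:
  assumes G: "pair_digraph G" and E: "E \<subseteq> parcs G"
    and ps: "\<forall>p\<in>set ps. p \<noteq> [] \<and> length p \<le> k \<and> successively (\<lambda>x y. (x, y) \<in> E) p"
    and dist: "distinct (concat ps)" "set (concat ps) = pverts G"
  shows "k_path_partition G k (set ps)" "distinct ps"
proof -
  interpret pair_digraph G by (rule G)
  have "removeAll [] ps = ps" using ps by (induction ps) auto
  then show "distinct ps" using dist(1) unfolding distinct_concat_iff by simp
  have "vpath p (with_proj G)" if p: "p \<in> set ps" for p
  proof -
    have "distinct p" using dist(1) p unfolding distinct_concat_iff by blast
    moreover have "set p \<subseteq> pverts G" using dist(2) p by auto
    moreover have "set (vwalk_arcs p) \<subseteq> parcs G"
      using vwalk_arcs_successively[of E p] ps p E by blast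
    ultimately show ?thesis using ps p unfolding vpath_def vwalk_def by simp
  qed
  moreover have "disjoint_family_on set (set ps)"
    using dist(1) unfolding distinct_concat_iff disjoint_family_on_def by blast
  moreover have "(\<Union>p\<in>set ps. set p) = pverts G" using dist(2) by simp
  ultimately show "k_path_partition G k (set ps)"
    using ps unfolding k_path_partition_def by blast
qed

lemma algorithm_correct:
  assumes k: "k \<ge> 7" and G: "pair_digraph G" and es: "arc_list_of G n es"
  defines "m \<equiv> length es"
  shows "\<exists>t s. exec ((n + 2) ^ 3) (algorithm k) (input_store n es) t s \<and>
    t \<le> 8000 * ((n + 1) * (m + 1)) \<and> distinct (output_paths s) \<and> k_path_partition G k (set (output_paths s)) \<and>
    (\<forall>Q. k_path_partition G k Q \<longrightarrow> 3 * card (set (output_paths s)) \<le> (k + 2) * card Q)"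
proof -
  define B where "B = (n + 2) ^ 3"
  define s0 where "s0 = input_store n es"
  define T where "T = arr s0 ''tail''"
  define H where "H = arr s0 ''head''"
  interpret G: pair_digraph G by (rule G)
  have V: "pverts G = {..<n}" and dist: "distinct es" and E: "set es = parcs G"
    using es unfolding arc_list_of_def by auto
  have nth: "(T j, H j) = es ! j" if "j < m" for j
    using that unfolding T_def H_def s0_def input_store_def m_def by simp
  have E_img: "parcs G = (\<lambda>j. (T j, H j)) ` {..<m}"
  proof -
    have "(\<lambda>j. (T j, H j)) ` {..<m} = (\<lambda>j. es ! j) ` {..<m}" by (intro image_cong refl nth) simp
    then show ?thesis unfolding E[symmetric] set_conv_nth m_def by auto
  qed
  have inj: "inj_on (\<lambda>j. (T j, H j)) {..<m}"
    by (rule inj_onI) (use nth dist in \<open>auto simp: m_def nth_eq_iff_index_eq\<close>)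
  have TH: "T j < n \<and> H j < n \<and> T j \<noteq> H j" if "j < m" for j
  proof -
    have "(T j, H j) \<in> parcs G" using that unfolding E_img by blast
    then show ?thesis
      using G.arc_fst_in_verts[of "(T j, H j)"] G.arc_snd_in_verts[of "(T j, H j)"] G.pair_no_loops[of "(T j, H j)"]
      unfolding V by simp
  qed
  \<comment> \<open>A word must hold indices of the up to \<open>2 * m\<close> sides as well as
    numbers up to \<open>2 * n + 4\<close>; with at most \<open>n * n\<close> arcs, the cube of
    \<open>n + 2\<close> is large enough.\<close>
  have "m \<le> n * n"
  proof -
    have "card (parcs G) \<le> card ({..<n} \<times> {..<n})"
      by (rule card_mono) (use TH in \<open>auto simp: E_img\<close>)
    then show ?thesis using distinct_card[OF dist] E unfolding m_def by (simp add: card_cartesian_product)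
  qed
  moreover have "2 * (n * n) + 4 * n + 4 \<le> (n + 2) ^ 3"
    by (simp add: power3_eq_cube algebra_simps)
  ultimately have B: "2 * n + 4 \<le> B" "2 * m + 2 \<le> B" unfolding B_def by linarith+
  have s0: "reg s0 ''n'' = n" "reg s0 ''m'' = m" "arr s0 ''tail'' = T" "arr s0 ''head'' = H"
    and reg0: "\<And>x. x \<noteq> ''n'' \<Longrightarrow> x \<noteq> ''m'' \<Longrightarrow> reg s0 x = 0"
    and arr0: "\<And>a. a \<noteq> ''tail'' \<Longrightarrow> a \<noteq> ''head'' \<Longrightarrow> arr s0 a = (\<lambda>_. 0)"
    unfolding T_def H_def s0_def input_store_def m_def by simp_all
  interpret m1: matching_program B "CHR ''1''" "''tail''" "''head''" "''m''" m n n T H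
    by unfold_locales (use TH B in auto)
  have "runs B (matching CHR ''1'' ''tail'' ''head'' ''m'') s0 (1000 * (n + 1) * (m + 1))
    (\<lambda>s'. maximum_matching_rep m T H (arr s' ''1L'') (arr s' ''1R''))"
    by (rule m1.matching) (simp_all add: m1.input_def s0 reg0 arr0)
  then obtain t1 s1 where 1: "exec B (matching CHR ''1'' ''tail'' ''head'' ''m'') s0 t1 s1"
    "t1 \<le> 1000 * (n + 1) * (m + 1)" "maximum_matching_rep m T H (arr s1 ''1L'') (arr s1 ''1R'')"
    and f1': "\<And>x. x \<notin> range (Cons CHR ''1'') \<Longrightarrow> reg s1 x = reg s0 x"
      "\<And>a. a \<notin> range (Cons CHR ''1'') \<Longrightarrow> arr s1 a = arr s0 a"
    using written_matching by (elim runsE) blast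
  have f1: "(\<And>y. x \<noteq> CHR ''1'' # y) \<Longrightarrow> reg s1 x = reg s0 x"
    "(\<And>y. x \<noteq> CHR ''1'' # y) \<Longrightarrow> arr s1 x = arr s0 x" for x
    using f1'[of x] by auto
  have s1: "reg s1 ''n'' = n" "reg s1 ''m'' = m" "arr s1 ''tail'' = T" "arr s1 ''head'' = H"
    using f1 s0 by auto
  have arr1: "arr s1 a = (\<lambda>_. 0)" if "a \<noteq> ''tail''" "a \<noteq> ''head''" "\<And>y. a \<noteq> CHR ''1'' # y" for a
    using f1 arr0 that by simp
  interpret pair_cover n m T H "arr s1 ''1L''" "arr s1 ''1R''"
    by unfold_locales (use TH 1(3) in auto)
  have "runs B read_matching s1 (150 * n + 20)
    (\<lambda>s'. arr s' ''su'' = su \<and> arr s' ''pr'' = pr \<and>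
      (\<forall>v<n. arr s' ''rep'' v = rho v \<and> arr s' ''rep'' (n + v) = rho v))"
  proof (rule runs_mono[OF read_matching[OF s1(1,3,4)]])
    show "x < n \<and> H (arr s1 ''1L'' x - 1) < n" if "arr s1 ''1L'' x \<noteq> 0" for x
      using matching_repL[OF mat that] TH[of "arr s1 ''1L'' x - 1"] that by auto
    show "x < n \<and> T (arr s1 ''1R'' x - 1) < n" if "arr s1 ''1R'' x \<noteq> 0" for x
      using matching_repR[OF mat that] TH[of "arr s1 ''1R'' x - 1"] that by auto
    show "arr s1 ''su'' = (\<lambda>_. 0)" "arr s1 ''pr'' = (\<lambda>_. 0)" by (simp_all add: arr1)
    show "2 * n + 2 \<le> B" using B by simp
  qed (simp_all add: rho_def su_def pr_def)
  then obtain t2 s2 where 2: "exec B read_matching s1 t2 s2" "t2 \<le> 150 * n + 20"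
    "arr s2 ''su'' = su" "arr s2 ''pr'' = pr" "\<And>v. v < n \<Longrightarrow> arr s2 ''rep'' v = rho v"
    "\<And>v. v < n \<Longrightarrow> arr s2 ''rep'' (n + v) = rho v"
    and f2: "\<And>x. x \<notin> {''i'', ''r''} \<Longrightarrow> reg s2 x = reg s1 x"
      "\<And>a. a \<notin> {''su'', ''pr'', ''rep''} \<Longrightarrow> arr s2 a = arr s1 a"
    by (elim runsE) (auto simp: read_matching_def)
  have s2: "reg s2 ''n'' = n" "reg s2 ''m'' = m" "arr s2 ''tail'' = T" "arr s2 ''head'' = H"
    using f2 s1 by auto
  have rho_B: "rho v \<le> B" for v using rho_le[of v] B by linarith
  have "runs B build_sides s2 (120 * m + 20)
    (\<lambda>s'. sides n T H rho m (reg s' ''k'') (arr s' ''T'') (arr s' ''H'') (arr s' ''O''))"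
    by (rule build_sides[OF s2]) (use TH 2(5) rho_B B in auto)
  then obtain t3 s3 where 3: "exec B build_sides s2 t3 s3" "t3 \<le> 120 * m + 20"
    "sides n T H rho m (reg s3 ''k'') (arr s3 ''T'') (arr s3 ''H'') (arr s3 ''O'')"
    and f3: "\<And>x. x \<notin> {''i'', ''k'', ''x'', ''w''} \<Longrightarrow> reg s3 x = reg s2 x"
      "\<And>a. a \<notin> {''T'', ''H'', ''O''} \<Longrightarrow> arr s3 a = arr s2 a"
    by (elim runsE) (auto simp: build_sides_def add_side_def)
  define k2 where "k2 = reg s3 ''k''"
  define T2 where "T2 = arr s3 ''T''"
  define H2 where "H2 = arr s3 ''H''"
  define O2 where "O2 = arr s3 ''O''"
  have sides: "sides n T H rho m k2 T2 H2 O2" using 3(3) unfolding k2_def T2_def H2_def O2_def .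
  have side: "O2 e < m" "T2 e \<le> n" "H2 e < 2 * n" if "e < k2" for e
  proof -
    have e: "O2 e < m" "is_side n T H rho (T2 e) (H2 e) (O2 e)" using sides that unfolding sides_def by blast+
    then show "O2 e < m" "T2 e \<le> n" "H2 e < 2 * n"
      using TH[OF e(1)] rho_le unfolding is_side_def by auto
  qed
  have k2m: "k2 \<le> 2 * m" using sides unfolding sides_def by blast
  \<comment> \<open>Left vertices are the numbers of 2-cycles, at most \<open>n\<close>, whence the
    bound \<open>n + 1\<close>; right vertices are \<open>x\<close> or \<open>n + x\<close> with
    \<open>x < n\<close>.\<close>
  interpret m2: matching_program B "CHR ''2''" "''T''" "''H''" "''k''" k2 "n + 1" "2 * n" T2 H2
    by unfold_locales (use side k2m B in \<open>auto simp: less_Suc_eq_le\<close>)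
  have "runs B (matching CHR ''2'' ''T'' ''H'' ''k'') s3 (1000 * (n + 1 + 1) * (k2 + 1))
    (\<lambda>s'. maximum_matching_rep k2 T2 H2 (arr s' ''2L'') (arr s' ''2R''))"
  proof (rule m2.matching)
    show "m2.input s3" unfolding m2.input_def by (simp add: k2_def T2_def H2_def)
  qed (simp_all add: f3 f2 f1 reg0 arr0)
  then obtain t4 s4 where 4: "exec B (matching CHR ''2'' ''T'' ''H'' ''k'') s3 t4 s4"
    "t4 \<le> 1000 * (n + 1 + 1) * (k2 + 1)" "maximum_matching_rep k2 T2 H2 (arr s4 ''2L'') (arr s4 ''2R'')"
    and f4': "\<And>x. x \<notin> range (Cons CHR ''2'') \<Longrightarrow> reg s4 x = reg s3 x"
      "\<And>a. a \<notin> range (Cons CHR ''2'') \<Longrightarrow> arr s4 a = arr s3 a"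
    using written_matching by (elim runsE) blast
  have f4: "(\<And>y. x \<noteq> CHR ''2'' # y) \<Longrightarrow> reg s4 x = reg s3 x"
    "(\<And>y. x \<noteq> CHR ''2'' # y) \<Longrightarrow> arr s4 x = arr s3 x" for x
    using f4'[of x] by auto
  interpret side_matching n m T H "arr s1 ''1L''" "arr s1 ''1R''" k2 T2 H2 O2 "arr s4 ''2L''" "arr s4 ''2R''"
    by unfold_locales (use sides 4(3) in auto)
  have rep4: "arr s4 ''rep'' = arr s2 ''rep''" using f4 f3 by auto
  have rep_ids: "arr s2 ''rep'' (r - 1) = r \<longleftrightarrow> r \<in> ids" if "1 \<le> r" "r \<le> n" for r
    using 2(5)[of "r - 1"] that unfolding ids_def by auto
  have h_rep: "h r = (if arr s4 ''2L'' r = 0 then 0 else arr s2 ''rep'' (H2 (arr s4 ''2L'' r - 1)))" for r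
  proof (cases "arr s4 ''2L'' r = 0")
    case False
    have "H2 (arr s4 ''2L'' r - 1) = (if rho (f r) = r then g r else n + f r)"
      using matched(3,4)[OF False] by auto
    then show ?thesis using False fg_arc[OF False] 2(5,6) unfolding h_def by auto
  qed (simp add: h_def)
  have h_le: "h r \<le> B" for r using rho_B unfolding h_def by auto
  have "runs B count_hosts s4 (100 * n + 20)
    (\<lambda>s'. (\<forall>r\<in>ids. arr s' ''hs'' r = h r) \<and> (\<forall>x. arr s' ''cnt'' x \<le> n) \<and>
      (\<forall>x. x \<noteq> 0 \<longrightarrow> arr s' ''cnt'' x = card {d \<in> ids. h d = x}))"
  proof (rule count_hosts[OF _ ids_sub])
    show "arr s4 ''rep'' (r - 1) = r \<longleftrightarrow> r \<in> ids" if "1 \<le> r" "r \<le> n" for r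
      using rep_ids[OF that] rep4 by simp
    show "h r = (if arr s4 ''2L'' r = 0 then 0 else arr s4 ''rep'' (arr s4 ''H'' (arr s4 ''2L'' r - 1)))" for r
      using h_rep[of r] rep4 f4(2)[of "''H''"] by (simp add: H2_def image_iff)
    show "reg s4 ''n'' = n" using f4(1)[of "''n''"] f3 s2 by auto
    show "arr s4 ''hs'' = (\<lambda>_. 0)" "arr s4 ''cnt'' = (\<lambda>_. 0)"
      using f4(2)[of "''hs''"] f4(2)[of "''cnt''"] by (auto simp: f3 f2 arr1)
  qed (use h_le B in auto)
  then obtain t5 s5 where 5: "exec B count_hosts s4 t5 s5" "t5 \<le> 100 * n + 20"
    "\<And>r. r \<in> ids \<Longrightarrow> arr s5 ''hs'' r = h r" "\<And>x. arr s5 ''cnt'' x \<le> n"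
    "\<And>x. x \<noteq> 0 \<Longrightarrow> arr s5 ''cnt'' x = card {d \<in> ids. h d = x}"
    and f5: "\<And>x. x \<notin> {''i''} \<Longrightarrow> reg s5 x = reg s4 x" "\<And>a. a \<notin> {''hs'', ''cnt''} \<Longrightarrow> arr s5 a = arr s4 a"
    by (elim runsE) (auto simp: count_hosts_def)
  have "runs B label_hosts s5 (300 * n + 100)
    (\<lambda>s'. lab.consistent (arr s' ''lab'') \<and> (\<forall>r\<in>ids. arr s' ''lab'' r = 1 \<or> arr s' ''lab'' r = 2))"
  proof (rule lab.label_hosts)
    show "reg s5 ''n'' = n" using f5 f4(1)[of "''n''"] f3 s2 by auto
    show "arr s5 ''rep'' (r - 1) = r \<longleftrightarrow> r \<in> ids" if "1 \<le> r" "r \<le> n" for r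
      using rep_ids[OF that] rep4 f5 by simp
    show "lab.counted (\<lambda>_. 0) (arr s5 ''cnt'')"
      using 5(5) ids_vertex unfolding lab.counted_def lab.waiting_def by auto
    show "arr s5 ''cnt'' r \<le> B" for r using 5(4)[of r] B by linarith
    show "arr s5 ''lab'' = (\<lambda>_. 0)" using f5(2)[of "''lab''"] f4(2)[of "''lab''"] by (auto simp: f3 f2 arr1)
  qed (use 5(3) B in auto)
  then obtain t6 s6 where 6: "exec B label_hosts s5 t6 s6" "t6 \<le> 300 * n + 100"
    "lab.consistent (arr s6 ''lab'')" "\<And>r. r \<in> ids \<Longrightarrow> arr s6 ''lab'' r = 1 \<or> arr s6 ''lab'' r = 2"
    and f6: "\<And>x. x \<notin> {''i'', ''c'', ''r'', ''h''} \<Longrightarrow> reg s6 x = reg s5 x"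
      "\<And>a. a \<notin> {''lab'', ''cnt''} \<Longrightarrow> arr s6 a = arr s5 a"
    by (elim runsE) (auto simp: label_hosts_def label_start_def label_guest_def)
  interpret labelled_pairs n m T H "arr s1 ''1L''" "arr s1 ''1R''" k2 T2 H2 O2 "arr s4 ''2L''" "arr s4 ''2R''"
    "arr s6 ''lab''"
    by unfold_locales (use 6(3,4) in auto)
  have s6: "reg s6 ''n'' = n" "arr s6 ''su'' = su" "arr s6 ''pr'' = pr" "arr s6 ''tail'' = T" "arr s6 ''head'' = H"
    "arr s6 ''O'' = O2" "arr s6 ''2L'' = arr s4 ''2L''" "arr s6 ''rep'' = arr s2 ''rep''" "arr s6 ''hs'' = arr s5 ''hs''"
    using f4(1)[of "''n''"] f4(2)[of "''su''"] f4(2)[of "''pr''"] f4(2)[of "''tail''"] f4(2)[of "''head''"]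
      f4(2)[of "''O''"] f4(2)[of "''rep''"] 2(3,4) s2
    by (auto simp: f6 f5 f3 O2_def)
  have O_le: "O2 (arr s4 ''2L'' r - 1) \<le> B" if "r \<in> A" for r
    using matched(1)[of r] that B unfolding A_def by auto
  have "runs B attach_guests s6 (150 * n + 20)
    (\<lambda>s'. succ_rep n att.S (arr s' ''su'') (arr s' ''pr'') \<and> (\<forall>i\<ge>n. arr s' ''pr'' i = 0))"
  proof (rule attach_guests[OF attachments_A])
    show "A \<subseteq> {1..n}" using ids_sub unfolding A_def by blast
    show "succ_rep n M (arr s6 ''su'') (arr s6 ''pr'')" using succ_rep_M s6 by simp
    show "r \<in> A \<longleftrightarrow> arr s6 ''rep'' (r - 1) = r \<and> arr s6 ''lab'' r = 1 \<and> arr s6 ''2L'' r \<noteq> 0 \<and>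
       \<not> (arr s6 ''hs'' r \<noteq> 0 \<and> arr s6 ''lab'' (arr s6 ''hs'' r) = 1)" if r: "1 \<le> r" "r \<le> n" for r
      using rep_ids[OF r] 5(3)[of r] unfolding A_def s6 by auto
  qed (use O_le B pr_zero in \<open>auto simp: s6 f_def g_def\<close>)
  then obtain t7 s7 where 7: "exec B attach_guests s6 t7 s7" "t7 \<le> 150 * n + 20"
    "succ_rep n att.S (arr s7 ''su'') (arr s7 ''pr'')" "\<And>i. n \<le> i \<Longrightarrow> arr s7 ''pr'' i = 0"
    and f7: "\<And>x. x \<notin> {''r'', ''j'', ''x'', ''w'', ''y'', ''z''} \<Longrightarrow> reg s7 x = reg s6 x"
      "\<And>a. a \<notin> {''su'', ''pr''} \<Longrightarrow> arr s7 a = arr s6 a"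
    by (elim runsE) (auto simp: attach_guests_def)
  interpret w: walking n att.S "arr s7 ''su''" "arr s7 ''pr''" k
    by unfold_locales (use 7(3,4) k in auto)
  have "reg s7 ''n'' = n" "arr s7 ''vis'' = (\<lambda>_. 0)" "arr s7 ''start'' = (\<lambda>_. 0)"
    using f4(2)[of "''vis''"] f4(2)[of "''start''"] s6(1) by (auto simp: f7 f6 f5 f3 f2 arr1)
  from w.emit[OF this(1) refl refl this(2,3), of B] B
  obtain t8 s8 ds where 8: "exec B (emit k) s7 t8 s8" "t8 \<le> 400 * n + 100"
    "\<forall>d\<in>set ds. comp_of att.S d" "distinct (concat ds)" "set (concat ds) = {..<n}"
    "concat (output_paths s8) = concat ds"
    "\<forall>p\<in>set (output_paths s8). p \<noteq> [] \<and> length p \<le> k \<and> successively (\<lambda>x y. (x, y) \<in> att.S) p"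
    "length (output_paths s8) = (\<Sum>d\<leftarrow>ds. pieces k (length d))"
    by (auto simp: runs_def)
  have S_E: "att.S \<subseteq> parcs G"
  proof
    fix e assume "e \<in> att.S"
    then consider r where "r \<in> A" "e = (f r, g r)" | x y where "(x, y) \<in> M" "e = (x, y)"
      unfolding att.S_def by auto
    then show "e \<in> parcs G"
    proof cases
      case 1
      then have j: "O2 (arr s4 ''2L'' r - 1) < m" using matched(1)[of r] unfolding A_def by blast
      show ?thesis
        unfolding E_img 1(2) f_def g_def by (rule imageI[of _ _ "\<lambda>j. (T j, H j)"]) (use j in simp)
    next
      case 2
      obtain j where "j < m" "T j = x" "H j = y" by (rule M_arc[OF 2(1)])
      then show ?thesis unfolding E_img 2(2) by blast
    qed
  qed
  have "distinct (concat (output_paths s8))" "set (concat (output_paths s8)) = pverts G"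
    using 8 V by simp_all
  note part = k_path_partition_lists[OF G S_E 8(7) this]
  have "3 * card (set (output_paths s8)) \<le> (k + 2) * card Q" if "k_path_partition G k Q" for Q
  proof -
    have "path_system {..<n} ((\<lambda>j. (T j, H j)) ` {..<m}) k Q"
      using k_path_partition_system[OF G V that] E_img by simp
    from approximation[OF k 8(3-5) inj this] show ?thesis
      using 8(8) distinct_card[OF part(2)] by simp
  qed
  moreover have "exec B (algorithm k) s0 (1 + t1 + (1 + t2 + (1 + t3 + (1 + t4 + (1 + t5 + (1 + t6 + (1 + t7 + t8))))))) s8"
    unfolding algorithm_def
    by (intro exec.Seq[OF 1(1)] exec.Seq[OF 2(1)] exec.Seq[OF 3(1)] exec.Seq[OF 4(1)] exec.Seq[OF 5(1)]
        exec.Seq[OF 6(1)] exec.Seq[OF 7(1)] 8(1))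
  moreover have "1 + t1 + (1 + t2 + (1 + t3 + (1 + t4 + (1 + t5 + (1 + t6 + (1 + t7 + t8)))))) \<le> 8000 * ((n + 1) * (m + 1))"
  proof -
    \<comment> \<open>The second matching has up to \<open>2 * m\<close> arcs and
      \<open>n + 1\<close> left vertices, hence the factor 4 relative to the first. The other parts
      are linear in \<open>n\<close> and \<open>m\<close>.\<close>
    have "1000 * (n + 1 + 1) * (k2 + 1) \<le> 1000 * (n + 1 + 1) * (2 * m + 1)" using k2m by (intro mult_le_mono2) simp
    also have "\<dots> \<le> 4000 * ((n + 1) * (m + 1))" by (simp add: algebra_simps)
    finally have "t4 \<le> 4000 * ((n + 1) * (m + 1))" using 4(2) by linarith
    moreover have "t1 \<le> 1000 * ((n + 1) * (m + 1))" using 1(2) by (simp only: mult.assoc)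
    moreover have "n + 1 \<le> (n + 1) * (m + 1)" "m + 1 \<le> (n + 1) * (m + 1)" by simp_all
    ultimately show ?thesis using 2(2) 3(2) 5(2) 6(2) 7(2) 8(2) by linarith
  qed
  ultimately show ?thesis using part unfolding B_def s0_def by blast
qed

theorem theorem2:
  fixes k :: nat
  assumes "k \<ge> 7"
  shows "\<exists>(P :: com) (C :: real) (d :: nat).
    \<forall>(G :: nat pair_pre_digraph) (n :: nat) (es :: (nat \<times> nat) list) (m :: nat).
      pair_digraph G \<longrightarrow> arc_list_of G n es \<longrightarrow> m = card (parcs G) \<longrightarrow>
      (\<exists>(t :: nat) (s :: store).
         exec ((n + 2) ^ d) P (input_store n es) t s \<and>
         real t \<le> C * (if m = 0 then real n + 1 else real n * real m * log 2 (real n)) \<and>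
         distinct (output_paths s) \<and>
         k_path_partition G k (set (output_paths s)) \<and>
         (\<forall>Qstar. minimum_k_path_partition G k Qstar \<longrightarrow>
            real (card (set (output_paths s))) \<le> (real k + 2) / 3 * real (card Qstar)))"
\<comment> \<open>The factor is \<open>4 * 8000\<close>, from
  \<open>(n + 1) * (m + 1) <= 4 * n * m\<close> for positive \<open>n\<close> and \<open>m\<close>;
  the exponent 3 is that of the word bound.\<close>
proof (rule exI[of _ "algorithm k"], rule exI[of _ 32000], rule exI[of _ 3], intro allI impI)
  fix G :: "nat pair_pre_digraph" and n m :: nat and es :: "(nat \<times> nat) list"
  assume G: "pair_digraph G" and es: "arc_list_of G n es" and m: "m = card (parcs G)"
  interpret G: pair_digraph G by (rule G)
  have m_es: "m = length es" using es m distinct_card[of es] unfolding arc_list_of_def by simp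
  obtain t s where ts: "exec ((n + 2) ^ 3) (algorithm k) (input_store n es) t s"
    "t \<le> 8000 * ((n + 1) * (m + 1))" "distinct (output_paths s)" "k_path_partition G k (set (output_paths s))"
    "\<And>Q. k_path_partition G k Q \<Longrightarrow> 3 * card (set (output_paths s)) \<le> (k + 2) * card Q"
    using algorithm_correct[OF assms G es] unfolding m_es by blast
  have "real t \<le> 32000 * (if m = 0 then real n + 1 else real n * real m * log 2 (real n))"
  proof (cases "m = 0")
    case True
    then have "real t \<le> real (8000 * (n + 1))" using ts(2) by simp
    then show ?thesis using True by simp
  next
    case False
    \<comment> \<open>An arc has two different ends, so \<open>n >= 2\<close> and the logarithm is
      at least 1.\<close>
    then obtain e where "e \<in> parcs G" using m by (metis card.empty ex_in_conv)
    then have "fst e < n" "snd e < n" "fst e \<noteq> snd e"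
      using G.arc_fst_in_verts G.arc_snd_in_verts G.pair_no_loops es unfolding arc_list_of_def by auto
    then have n2: "2 \<le> n" by linarith
    have "(n + 1) * (m + 1) \<le> (2 * n) * (2 * m)" using n2 False by (intro mult_le_mono) auto
    then have "8000 * ((n + 1) * (m + 1)) \<le> 8000 * ((2 * n) * (2 * m))" by (rule mult_le_mono2)
    then have "t \<le> 32000 * (n * m)" using ts(2) by (simp add: algebra_simps)
    then have "real t \<le> real (32000 * (n * m))" by (rule of_nat_mono)
    then have "real t \<le> 32000 * (real n * real m)" by simp
    moreover have "1 \<le> log 2 (real n)" using n2 by simp
    then have "real n * real m * 1 \<le> real n * real m * log 2 (real n)" by (intro mult_left_mono) auto
    ultimately show ?thesis using False by simp
  qed
  moreover have "real (card (set (output_paths s))) \<le> (real k + 2) / 3 * real (card Qstar)"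
    if "minimum_k_path_partition G k Qstar" for Qstar
  proof -
    have "k_path_partition G k Qstar"
      using that unfolding minimum_k_path_partition_def is_arg_min_def by blast
    then have "real (3 * card (set (output_paths s))) \<le> real ((k + 2) * card Qstar)"
      using ts(5) of_nat_mono by blast
    then show ?thesis by (simp add: field_simps)
  qed
  ultimately show "\<exists>t s. exec ((n + 2) ^ 3) (algorithm k) (input_store n es) t s \<and>
         real t \<le> 32000 * (if m = 0 then real n + 1 else real n * real m * log 2 (real n)) \<and>
         distinct (output_paths s) \<and>
         k_path_partition G k (set (output_paths s)) \<and>
         (\<forall>Qstar. minimum_k_path_partition G k Qstar \<longrightarrow>
            real (card (set (output_paths s))) \<le> (real k + 2) / 3 * real (card Qstar))"
    using ts by blast
qed

end
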